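(* Let $G=(V,E)$ be a simple (no self-loops, no parallel edges), undirected, connected graph with $n=|V|$ vertices and $m=|E|$ edges, given by adjacency lists, and let $k\in[2,n]$ be an integer. Let $s$ be the number of $k$-subtrees of $G$. There is an algorithm that lists every $k$-subtree of $G$ exactly once in $O(sk^2)$ time using $O(mk)$ space.
   Context: A $k$-subtree of $G$ is an edge subset $T\subseteq E$ with $|T|=k-1$ that is acyclic and connected and whose edges have exactly $k$ distinct endpoints (an acyclic connected subgraph of $G$ with $k$ vertices). Each $k$-subtree is output explicitly as its list of edges. Running times are in the standard RAM model. *)

theory Defs
  imports Main
begin

section \<open>Graphs and their k-subtrees\<close>

text \<open>An undirected edge is the two-element set of its endpoints, so parallel edges and
  self-loops cannot occur.\<close>

definition simple_graph :: "'a set \<Rightarrow> 'a set set \<Rightarrow> bool" where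
  "simple_graph V E \<longleftrightarrow> finite V \<and> (\<forall>e\<in>E. e \<subseteq> V \<and> card e = 2)"

definition connected_graph :: "'a set \<Rightarrow> 'a set set \<Rightarrow> bool" where
  "connected_graph V E \<longleftrightarrow> (\<forall>u\<in>V. \<forall>v\<in>V. (u, v) \<in> {(x, y). {x, y} \<in> E}\<^sup>*)"

text \<open>A cycle is given by its pairwise distinct vertices in cyclic order.\<close>

definition is_cycle :: "'a set set \<Rightarrow> 'a list \<Rightarrow> bool" where
  "is_cycle E vs \<longleftrightarrow> 3 \<le> length vs \<and> distinct vs \<and>
     (\<forall>i<length vs. {vs ! i, vs ! (Suc i mod length vs)} \<in> E)"

definition acyclic_edges :: "'a set set \<Rightarrow> bool" where
  "acyclic_edges E \<longleftrightarrow> (\<nexists>vs. is_cycle E vs)"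

definition k_subtrees :: "'a set set \<Rightarrow> nat \<Rightarrow> 'a set set set" where
  "k_subtrees E k =
     {T. T \<subseteq> E \<and> card T = k - 1 \<and> acyclic_edges T \<and> connected_graph (\<Union>T) T \<and> card (\<Union>T) = k}"


section \<open>Random access machines\<close>

text \<open>A program works on registers, which are named by the instructions, on a memory that is
  addressed indirectly through registers, and on a write-only output stream. Every instruction takes
  one time step. Numbers are naturals: \<open>Sub\<close> is truncated, and \<open>x div 0 = 0\<close>. That a computation
  only handles short machine words is not built into the step function; it is the separate
  predicate \<open>ram_words\<close> below.\<close>

datatype arith_op = Add | Sub | Mul | Div

datatype instr =
    Const nat nat               \<comment> \<open>\<open>R[r] := c\<close>\<close>
  | Arith arith_op nat nat nat  \<comment> \<open>\<open>R[r] := R[a] op R[b]\<close>\<close>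
  | Load nat nat                \<comment> \<open>\<open>R[r] := M[R[a]]\<close>\<close>
  | Store nat nat               \<comment> \<open>\<open>M[R[a]] := R[r]\<close>\<close>
  | Jump nat
  | JumpLess nat nat nat        \<comment> \<open>\<open>if R[a] < R[b] goto l\<close>\<close>
  | JumpEq nat nat nat          \<comment> \<open>\<open>if R[a] = R[b] goto l\<close>\<close>
  | Output nat

type_synonym program = "instr list"

record config =
  pc :: nat
  regs :: "nat \<Rightarrow> nat"
  mem :: "nat \<Rightarrow> nat"
  out :: "nat list"

fun arith :: "arith_op \<Rightarrow> nat \<Rightarrow> nat \<Rightarrow> nat" where
  "arith Add x y = x + y"
| "arith Sub x y = x - y"
| "arith Mul x y = x * y"
| "arith Div x y = x div y"

fun exec :: "instr \<Rightarrow> config \<Rightarrow> config" where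
  "exec (Const r x) c = c\<lparr>pc := Suc (pc c), regs := (regs c)(r := x)\<rparr>"
| "exec (Arith f r a b) c =
     c\<lparr>pc := Suc (pc c), regs := (regs c)(r := arith f (regs c a) (regs c b))\<rparr>"
| "exec (Load r a) c = c\<lparr>pc := Suc (pc c), regs := (regs c)(r := mem c (regs c a))\<rparr>"
| "exec (Store a r) c = c\<lparr>pc := Suc (pc c), mem := (mem c)(regs c a := regs c r)\<rparr>"
| "exec (Jump l) c = c\<lparr>pc := l\<rparr>"
| "exec (JumpLess a b l) c = c\<lparr>pc := (if regs c a < regs c b then l else Suc (pc c))\<rparr>"
| "exec (JumpEq a b l) c = c\<lparr>pc := (if regs c a = regs c b then l else Suc (pc c))\<rparr>"
| "exec (Output r) c = c\<lparr>pc := Suc (pc c), out := out c @ [regs c r]\<rparr>"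

text \<open>The machine stops as soon as control leaves the program.\<close>

definition halted :: "program \<Rightarrow> config \<Rightarrow> bool" where
  "halted P c \<longleftrightarrow> length P \<le> pc c"

definition step :: "program \<Rightarrow> config \<Rightarrow> config" where
  "step P c = (if halted P c then c else exec (P ! pc c) c)"

definition conf_at :: "program \<Rightarrow> config \<Rightarrow> nat \<Rightarrow> config" where
  "conf_at P c t = (step P ^^ t) c"

definition ram_halts :: "program \<Rightarrow> config \<Rightarrow> bool" where
  "ram_halts P c \<longleftrightarrow> (\<exists>t. halted P (conf_at P c t))"

definition ram_time :: "program \<Rightarrow> config \<Rightarrow> nat" where
  "ram_time P c = (LEAST t. halted P (conf_at P c t))"

definition ram_output :: "program \<Rightarrow> config \<Rightarrow> nat list" where
  "ram_output P c = out (conf_at P c (ram_time P c))"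

fun accessed :: "instr \<Rightarrow> config \<Rightarrow> nat set" where
  "accessed (Load r a) c = {regs c a}"
| "accessed (Store a r) c = {regs c a}"
| "accessed _ c = {}"

fun instr_regs :: "instr \<Rightarrow> nat set" where
  "instr_regs (Const r x) = {r}"
| "instr_regs (Arith f r a b) = {r, a, b}"
| "instr_regs (Load r a) = {r, a}"
| "instr_regs (Store a r) = {a, r}"
| "instr_regs (Jump l) = {}"
| "instr_regs (JumpLess a b l) = {a, b}"
| "instr_regs (JumpEq a b l) = {a, b}"
| "instr_regs (Output r) = {r}"

text \<open>Space counts the registers of the program, the \<open>N\<close> memory cells holding the input, and all
  further memory cells ever read or written; the output stream is not charged.\<close>

definition ram_space :: "program \<Rightarrow> config \<Rightarrow> nat \<Rightarrow> nat" where
  "ram_space P c N =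
     card (\<Union>i\<in>set P. instr_regs i) +
     card ({..<N} \<union>
       (\<Union>t<ram_time P c. accessed (P ! pc (conf_at P c t)) (conf_at P c t)))"

definition ram_words :: "program \<Rightarrow> config \<Rightarrow> nat \<Rightarrow> bool" where
  "ram_words P c W \<longleftrightarrow>
     (\<forall>t a. regs (conf_at P c t) a < W \<and> mem (conf_at P c t) a < W)"


section \<open>Input and output conventions\<close>

text \<open>A graph handed to a machine has vertex set \<open>{..<n}\<close>. The neighbours of a vertex may be listed
  in any order.\<close>

definition adjacency_lists :: "nat \<Rightarrow> nat set set \<Rightarrow> nat list list \<Rightarrow> bool" where
  "adjacency_lists n E adj \<longleftrightarrow> length adj = n \<and>
     (\<forall>v<n. distinct (adj ! v) \<and> set (adj ! v) = {u. {v, u} \<in> E})"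

text \<open>Memory layout: cells \<open>0, \<dots>, n\<close> hold pointers, the list of vertex \<open>v\<close> occupying the cells from
  the address in cell \<open>v\<close> up to, but excluding, the address in cell \<open>v + 1\<close>.\<close>

definition input_words :: "nat list list \<Rightarrow> nat list" where
  "input_words adj =
     map (\<lambda>v. Suc (length adj) + length (concat (take v adj))) [0..<Suc (length adj)] @ concat adj"

definition initial_config :: "nat list list \<Rightarrow> nat \<Rightarrow> config" where
  "initial_config adj k =
     \<lparr>pc = 0,
      regs = (\<lambda>_. 0)(0 := length adj, 1 := k),
      mem = (\<lambda>a. if a < length (input_words adj) then input_words adj ! a else 0),
      out = []\<rparr>"

definition edges_of :: "(nat \<times> nat) list \<Rightarrow> nat set set" where
  "edges_of T = (\<lambda>(u, v). {u, v}) ` set T"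

definition words_of :: "(nat \<times> nat) list \<Rightarrow> nat list" where
  "words_of T = concat (map (\<lambda>(u, v). [u, v]) T)"

text \<open>Since every tree is written as \<open>l\<close> edges, i.e. \<open>2 * l\<close> words, no separators are needed in
  the output stream. The requirement \<open>distinct\<close> is on the edge sets, so a tree may not be repeated
  with its edges or their endpoints in a different order.\<close>

definition lists_exactly_once :: "nat \<Rightarrow> nat list \<Rightarrow> nat set set set \<Rightarrow> bool" where
  "lists_exactly_once l ws \<T> \<longleftrightarrow>
     (\<exists>Ts. ws = concat (map words_of Ts) \<and>
           (\<forall>T\<in>set Ts. length T = l \<and> distinct (map (\<lambda>(u, v). {u, v}) T)) \<and>
           distinct (map edges_of Ts) \<and>
           set (map edges_of Ts) = \<T>)"

end

theory Submission
  imports Defs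
begin

text \<open>Roots are taken in the reverse of a depth-first order of the whole graph and deleted afterwards, so
  that the remaining graph stays connected; a \<open>k\<close>-subtree is listed when the first of its vertices is the
  root, as a tree of arcs directed away from it. For a fixed root, the trees that contain a partial tree
  \<open>S\<close> and avoid the removed arcs are listed by binary partition. A depth-first search from the
  contracted \<open>S\<close>, stopped at \<open>k\<close> vertices, yields one such tree \<open>T\<close>. Walk through its vertices in
  reverse finishing order and add them to \<open>S\<close>. As a vertex finished before \<open>z\<close> was discovered has no
  arc to a vertex discovered later, the tree arc into \<open>z\<close> is contained in every solution as long as the
  vertices passed so far have no arcs leaving \<open>S\<close> other than tree arcs. If this persists to the end, \<open>T\<close>
  is the only solution. Otherwise the first arc \<open>a \<rightarrow> y\<close> leaving \<open>S\<close> outside \<open>T\<close> splits the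
  solutions into those that contain it, which exist because \<open>S\<close> with \<open>y\<close> can be extended, and those
  that do not, one of which is \<open>T\<close>. Hence the recursion tree has only binary nodes and leaves, one leaf
  for each tree.

  Removed arcs are unlinked from doubly linked adjacency lists (only \<open>a \<rightarrow> y\<close>, since \<open>a\<close> stays in the
  partial tree), so a search scans only arcs between the at most \<open>k\<close> visited vertices, and a node costs
  \<open>O(k\<^sup>2)\<close>. Each edge lies in a \<open>k\<close>-subtree, so \<open>m \<le> s (k - 1)\<close> pays for the preprocessing.\<close>


section \<open>A structured language on top of the machine\<close>

text \<open>Time is amortized over the solutions below a root. A call with \<open>s\<close>
  solutions is allowed \<open>200 * k^2\<close> ticks per solution minus \<open>100 * k^2\<close>. A
  leaf costs at most the remaining \<open>100 * k^2\<close>; at a binary node the two children fall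
  short of the allowance by another \<open>100 * k^2\<close>, which pays for the node itself. This
  needs both branches to be nonempty. The backtracking stack is bounded by the number of arcs plus
  \<open>k\<close>, since each frame goes with a longer partial tree or with a removed arc. Memory
  is therefore linear in the number of edges. The obstacle is the concrete machine, for which time,
  touched cells and word sizes must all be certified. They are built into the rules of a small
  structured language with a clock, and one simulation theorem transfers them at the price of a
  factor ten. In this language the recursion is a loop with an explicit stack, which is why the main
  induction is phrased with continuations.\<close>

datatype test = Lt nat nat | Eq nat nat

fun holds :: "test \<Rightarrow> (nat \<Rightarrow> nat) \<Rightarrow> bool" where
  "holds (Lt a b) R \<longleftrightarrow> R a < R b"
| "holds (Eq a b) R \<longleftrightarrow> R a = R b"

datatype com =
    Cst nat nat
  | Mov nat nat
  | Inc nat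
  | Dec nat
  | LdIn nat nat
  | Ld nat nat nat nat  \<comment> \<open>\<open>R[r] := A[j, R[u], R[v]]\<close>\<close>
  | St nat nat nat nat  \<comment> \<open>\<open>A[j, R[u], R[v]] := R[r]\<close>\<close>
  | Emit nat
  | Skip
  | Seq com com (infixr \<open>;;\<close> 60)
  | Cond test com com
  | Loop test com

type_synonym arrays = "nat \<times> nat \<times> nat \<Rightarrow> nat"
type_synonym state = "(nat \<Rightarrow> nat) \<times> arrays \<times> nat list \<times> nat"

fun writes :: "com \<Rightarrow> nat set" where
  "writes (Cst r x) = {r}"
| "writes (Mov r a) = {r}"
| "writes (Inc r) = {r}"
| "writes (Dec r) = {r}"
| "writes (LdIn r a) = {r}"
| "writes (Ld r j u v) = {r}"
| "writes (St j u v r) = {}"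
| "writes (Emit r) = {}"
| "writes Skip = {}"
| "writes (Seq c d) = writes c \<union> writes d"
| "writes (Cond b c d) = writes c \<union> writes d"
| "writes (Loop b c) = writes c"

fun stores :: "com \<Rightarrow> nat set" where
  "stores (St j u v r) = {j}"
| "stores (Seq c d) = stores c \<union> stores d"
| "stores (Cond b c d) = stores c \<union> stores d"
| "stores (Loop b c) = stores c"
| "stores _ = {}"

fun emits :: "com \<Rightarrow> bool" where
  "emits (Emit r) \<longleftrightarrow> True"
| "emits (Seq c d) \<longleftrightarrow> emits c \<or> emits d"
| "emits (Cond b c d) \<longleftrightarrow> emits c \<or> emits d"
| "emits (Loop b c) \<longleftrightarrow> emits c"
| "emits _ \<longleftrightarrow> False"

text \<open>A frame condition read off the syntax of a command. \<open>wp_mono\<close> and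
  \<open>wp_Loop\<close> supply it to every continuation and loop body, so that specifications only
  mention what a command alters.\<close>

definition unchanged ::
  "com \<Rightarrow> (nat \<Rightarrow> nat) \<Rightarrow> arrays \<Rightarrow> nat list \<Rightarrow> (nat \<Rightarrow> nat) \<Rightarrow> arrays \<Rightarrow> nat list \<Rightarrow> bool" where
  "unchanged c R A Z R' A' Z' \<longleftrightarrow> (\<forall>r. r \<notin> writes c \<longrightarrow> R' r = R r) \<and>
     (\<forall>j u v. j \<notin> stores c \<longrightarrow> A' (j, u, v) = A (j, u, v)) \<and> (\<not> emits c \<longrightarrow> Z' = Z)"

lemma unchanged_refl: "unchanged c R A Z R A Z"
  by (simp add: unchanged_def)

lemma unchanged_trans:
  "unchanged c R A Z R' A' Z' \<Longrightarrow> unchanged c R' A' Z' R'' A'' Z'' \<Longrightarrow> unchanged c R A Z R'' A'' Z''"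
  by (simp add: unchanged_def)

text \<open>The big-step semantics only admits computations that read the input within its \<open>N\<close> cells,
  touch array cells in \<open>Ok\<close> only and keep all values below \<open>B\<close>. The last component of a state
  counts the executed instructions and tests.\<close>

locale machine =
  fixes inp :: "nat \<Rightarrow> nat" and N :: nat and Ok :: "(nat \<times> nat \<times> nat) set" and B :: nat
begin

inductive big :: "com \<Rightarrow> state \<Rightarrow> state \<Rightarrow> bool" where
  Cst: "x < B \<Longrightarrow> big (Cst r x) (R, A, Z, t) (R(r := x), A, Z, Suc t)"
| Mov: "big (Mov r a) (R, A, Z, t) (R(r := R a), A, Z, Suc t)"
| Inc: "Suc (R r) < B \<Longrightarrow> big (Inc r) (R, A, Z, t) (R(r := Suc (R r)), A, Z, Suc t)"
| Dec: "big (Dec r) (R, A, Z, t) (R(r := R r - 1), A, Z, Suc t)"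
| LdIn: "R a < N \<Longrightarrow> big (LdIn r a) (R, A, Z, t) (R(r := inp (R a)), A, Z, Suc t)"
| Ld: "(j, R u, R v) \<in> Ok \<Longrightarrow>
    big (Ld r j u v) (R, A, Z, t) (R(r := A (j, R u, R v)), A, Z, Suc t)"
| St: "(j, R u, R v) \<in> Ok \<Longrightarrow>
    big (St j u v r) (R, A, Z, t) (R, A((j, R u, R v) := R r), Z, Suc t)"
| Emit: "big (Emit r) (R, A, Z, t) (R, A, Z @ [R r], Suc t)"
| Skip: "big Skip s s"
| Seq: "big c s s' \<Longrightarrow> big d s' s'' \<Longrightarrow> big (Seq c d) s s''"
| CondT: "holds b R \<Longrightarrow> big c (R, A, Z, Suc t) s' \<Longrightarrow> big (Cond b c d) (R, A, Z, t) s'"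
| CondF: "\<not> holds b R \<Longrightarrow> big d (R, A, Z, Suc t) s' \<Longrightarrow> big (Cond b c d) (R, A, Z, t) s'"
| LoopT: "holds b R \<Longrightarrow> big c (R, A, Z, Suc t) s' \<Longrightarrow> big (Loop b c) s' s'' \<Longrightarrow>
    big (Loop b c) (R, A, Z, t) s''"
| LoopF: "\<not> holds b R \<Longrightarrow> big (Loop b c) (R, A, Z, t) (R, A, Z, Suc t)"

inductive_cases bigE:
  "big (Cst r x) s s'" "big (Mov r a) s s'" "big (Inc r) s s'" "big (Dec r) s s'"
  "big (LdIn r a) s s'" "big (Ld r j u v) s s'" "big (St j u v r) s s'" "big (Emit r) s s'"
  "big Skip s s'" "big (Seq c d) s s'" "big (Cond b c d) s s'"

lemma big_unchanged:
  "big c s s' \<Longrightarrow> unchanged c (fst s) (fst (snd s)) (fst (snd (snd s)))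
     (fst s') (fst (snd s')) (fst (snd (snd s')))"
  by (induction rule: big.induct) (auto simp: unchanged_def)

text \<open>Asserts an admissible terminating run, so that termination, admissible cells and the
  value bound come with every postcondition. The clock is an argument of the postcondition, which
  turns time bounds into ordinary assertions.\<close>

definition wp where
  "wp c Q R A Z t \<longleftrightarrow> (\<exists>R' A' Z' t'. big c (R, A, Z, t) (R', A', Z', t') \<and> Q R' A' Z' t')"

lemma wp_simps [simp]:
  "wp (Cst r x) Q R A Z t \<longleftrightarrow> x < B \<and> Q (R(r := x)) A Z (Suc t)"
  "wp (Mov r a) Q R A Z t \<longleftrightarrow> Q (R(r := R a)) A Z (Suc t)"
  "wp (Inc r) Q R A Z t \<longleftrightarrow> Suc (R r) < B \<and> Q (R(r := Suc (R r))) A Z (Suc t)"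
  "wp (Dec r) Q R A Z t \<longleftrightarrow> Q (R(r := R r - 1)) A Z (Suc t)"
  "wp (LdIn r a) Q R A Z t \<longleftrightarrow> R a < N \<and> Q (R(r := inp (R a))) A Z (Suc t)"
  "wp (Ld r j u v) Q R A Z t \<longleftrightarrow> (j, R u, R v) \<in> Ok \<and> Q (R(r := A (j, R u, R v))) A Z (Suc t)"
  "wp (St j u v r) Q R A Z t \<longleftrightarrow> (j, R u, R v) \<in> Ok \<and> Q R (A((j, R u, R v) := R r)) Z (Suc t)"
  "wp (Emit r) Q R A Z t \<longleftrightarrow> Q R A (Z @ [R r]) (Suc t)"
  "wp Skip Q R A Z t \<longleftrightarrow> Q R A Z t"
  "wp (Seq c d) Q R A Z t \<longleftrightarrow> wp c (wp d Q) R A Z t"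
  "wp (Cond b c d) Q R A Z t \<longleftrightarrow>
     (if holds b R then wp c Q R A Z (Suc t) else wp d Q R A Z (Suc t))"
  unfolding wp_def by (auto elim!: bigE intro: big.intros) (fastforce intro: big.intros)+

lemma wp_mono:
  "wp c Q R A Z t \<Longrightarrow> (\<And>R' A' Z' t'. unchanged c R A Z R' A' Z' \<Longrightarrow> Q R' A' Z' t' \<Longrightarrow> Q' R' A' Z' t') \<Longrightarrow>
   wp c Q' R A Z t"
  unfolding wp_def using big_unchanged by fastforce

lemma wp_Loop_unfold:
  assumes "if holds b R then wp c (wp (Loop b c) Q) R A Z (Suc t) else Q R A Z (Suc t)"
  shows "wp (Loop b c) Q R A Z t"
  using assms unfolding wp_def by (fastforce split: if_splits intro: LoopT LoopF)

text \<open>The index \<open>i\<close> of the invariant is a variant. In most applications it is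
  also a time credit: an invariant such as \<open>t' + 4 * p \<le> t + 4 * l + 1\<close> pays in
  advance for the \<open>p\<close> remaining iterations.\<close>

lemma wp_Loop:
  fixes I :: "nat \<Rightarrow> (nat \<Rightarrow> nat) \<Rightarrow> arrays \<Rightarrow> nat list \<Rightarrow> nat \<Rightarrow> bool"
  assumes "I i R0 A0 Z0 t0"
    and body: "\<And>i R A Z t. I i R A Z t \<Longrightarrow> unchanged c R0 A0 Z0 R A Z \<Longrightarrow> holds b R \<Longrightarrow>
      wp c (\<lambda>R A Z t. \<exists>j<i. I j R A Z t) R A Z (Suc t)"
    and exit: "\<And>i R A Z t. I i R A Z t \<Longrightarrow> unchanged c R0 A0 Z0 R A Z \<Longrightarrow> \<not> holds b R \<Longrightarrow> Q R A Z (Suc t)"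
  shows "wp (Loop b c) Q R0 A0 Z0 t0"
proof -
  have "wp (Loop b c) Q R A Z t" if "I i R A Z t" "unchanged c R0 A0 Z0 R A Z" for i R A Z t
    using that
  proof (induction i arbitrary: R A Z t rule: less_induct)
    case (less i)
    show ?case
    proof (rule wp_Loop_unfold, cases "holds b R")
      case True
      have "wp c (wp (Loop b c) Q) R A Z (Suc t)"
        by (rule wp_mono[OF body[OF less.prems True]]) (blast intro: less.IH unchanged_trans less.prems(2))
      then show "if holds b R then wp c (wp (Loop b c) Q) R A Z (Suc t) else Q R A Z (Suc t)"
        using True by simp
    next
      case False
      then show "if holds b R then wp c (wp (Loop b c) Q) R A Z (Suc t) else Q R A Z (Suc t)"
        using exit[OF less.prems] by simp
    qed
  qed
  then show ?thesis
    using assms(1) unchanged_refl by blast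
qed

end


section \<open>Compilation\<close>

text \<open>Cell \<open>(j, u, v)\<close> of the arrays lives at address \<open>10 * ((u + n + 1) * (n + 1) + v) + j\<close>,
  which is beyond the input. Registers 50 and 51 are scratch.\<close>

definition addr :: "nat \<Rightarrow> nat \<times> nat \<times> nat \<Rightarrow> nat" where
  "addr n = (\<lambda>(j, u, v). ((u + (n + 1)) * (n + 1) + v) * 10 + j)"

definition address_code :: "nat \<Rightarrow> nat \<Rightarrow> nat \<Rightarrow> instr list" where
  "address_code j u v =
     [Const 50 1, Arith Add 50 0 50, Arith Add 51 u 50, Arith Mul 51 51 50, Arith Add 51 51 v,
      Const 50 10, Arith Mul 51 51 50, Const 50 j, Arith Add 51 51 50]"

fun branch :: "test \<Rightarrow> nat \<Rightarrow> instr" where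
  "branch (Lt a b) l = JumpLess a b l"
| "branch (Eq a b) l = JumpEq a b l"

fun code_length :: "com \<Rightarrow> nat" where
  "code_length (Cst r x) = 1"
| "code_length (Mov r a) = 2"
| "code_length (Inc r) = 2"
| "code_length (Dec r) = 2"
| "code_length (LdIn r a) = 1"
| "code_length (Ld r j u v) = 10"
| "code_length (St j u v r) = 10"
| "code_length (Emit r) = 1"
| "code_length Skip = 0"
| "code_length (Seq c d) = code_length c + code_length d"
| "code_length (Cond b c d) = code_length c + code_length d + 2"
| "code_length (Loop b c) = code_length c + 3"

fun compile :: "nat \<Rightarrow> com \<Rightarrow> instr list" where
  "compile p (Cst r x) = [Const r x]"
| "compile p (Mov r a) = [Const 50 0, Arith Add r a 50]"
| "compile p (Inc r) = [Const 50 1, Arith Add r r 50]"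
| "compile p (Dec r) = [Const 50 1, Arith Sub r r 50]"
| "compile p (LdIn r a) = [Load r a]"
| "compile p (Ld r j u v) = address_code j u v @ [Load r 51]"
| "compile p (St j u v r) = address_code j u v @ [Store 51 r]"
| "compile p (Emit r) = [Output r]"
| "compile p Skip = []"
| "compile p (Seq c d) = compile p c @ compile (p + code_length c) d"
| "compile p (Cond b c d) =
     [branch b (p + code_length d + 2)] @ compile (p + 1) d @
     [Jump (p + code_length d + 2 + code_length c)] @ compile (p + code_length d + 2) c"
| "compile p (Loop b c) =
     [branch b (p + 2), Jump (p + 3 + code_length c)] @ compile (p + 2) c @ [Jump p]"

lemma length_compile [simp]: "length (compile p c) = code_length c"
  by (induction c arbitrary: p) (auto simp: address_code_def)

fun compilable :: "com \<Rightarrow> bool" where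
  "compilable (Cst r x) \<longleftrightarrow> 0 < r \<and> r < 50"
| "compilable (Mov r a) \<longleftrightarrow> 0 < r \<and> r < 50 \<and> a < 50"
| "compilable (Inc r) \<longleftrightarrow> 0 < r \<and> r < 50"
| "compilable (Dec r) \<longleftrightarrow> 0 < r \<and> r < 50"
| "compilable (LdIn r a) \<longleftrightarrow> 0 < r \<and> r < 50 \<and> a < 50"
| "compilable (Ld r j u v) \<longleftrightarrow> 0 < r \<and> r < 50 \<and> j < 10 \<and> u < 50 \<and> v < 50"
| "compilable (St j u v r) \<longleftrightarrow> r < 50 \<and> j < 10 \<and> u < 50 \<and> v < 50"
| "compilable (Emit r) \<longleftrightarrow> r < 50"
| "compilable Skip \<longleftrightarrow> True"
| "compilable (Seq c d) \<longleftrightarrow> compilable c \<and> compilable d"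
| "compilable (Cond (Lt a b) c d) \<longleftrightarrow> a < 50 \<and> b < 50 \<and> compilable c \<and> compilable d"
| "compilable (Cond (Eq a b) c d) \<longleftrightarrow> a < 50 \<and> b < 50 \<and> compilable c \<and> compilable d"
| "compilable (Loop (Lt a b) c) \<longleftrightarrow> a < 50 \<and> b < 50 \<and> compilable c"
| "compilable (Loop (Eq a b) c) \<longleftrightarrow> a < 50 \<and> b < 50 \<and> compilable c"

lemma compilable_test:
  "compilable (Cond b c d) \<longleftrightarrow> compilable (Cond b Skip Skip) \<and> compilable c \<and> compilable d"
  "compilable (Loop b c) \<longleftrightarrow> compilable (Cond b Skip Skip) \<and> compilable c"
  by (cases b; auto)+

section \<open>Machine executions with their footprint\<close>

definition words_below :: "nat \<Rightarrow> config \<Rightarrow> bool" where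
  "words_below W c \<longleftrightarrow> (\<forall>a. regs c a < W \<and> mem c a < W)"

text \<open>The word bound is imposed on every configuration except the last, so that runs compose
  without overlapping conditions; \<open>run_complete\<close> asks for the last one
  separately.\<close>

inductive run :: "program \<Rightarrow> nat set \<Rightarrow> nat \<Rightarrow> config \<Rightarrow> nat \<Rightarrow> config \<Rightarrow> bool" for P S W where
  run_refl: "run P S W c 0 c"
| run_step: "pc c < length P \<Longrightarrow> accessed (P ! pc c) c \<subseteq> S \<Longrightarrow> words_below W c \<Longrightarrow>
    run P S W (exec (P ! pc c) c) t c' \<Longrightarrow> run P S W c (Suc t) c'"

lemma run_trans: "run P S W c t c' \<Longrightarrow> run P S W c' t' c'' \<Longrightarrow> run P S W c (t + t') c''"
  by (induction rule: run.induct) (auto intro: run.intros)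

lemma run_conf_at:
  "run P S W c t c' \<Longrightarrow> conf_at P c t = c' \<and> (\<forall>i<t. \<not> halted P (conf_at P c i) \<and>
     accessed (P ! pc (conf_at P c i)) (conf_at P c i) \<subseteq> S \<and> words_below W (conf_at P c i))"
proof (induction rule: run.induct)
  case (run_refl c)
  then show ?case by (simp add: conf_at_def)
next
  case (run_step c t c')
  have st: "conf_at P c (Suc i) = conf_at P (exec (P ! pc c) c) i" for i
    using run_step(1) by (simp add: conf_at_def funpow_swap1 step_def halted_def)
  show ?case
  proof (intro conjI)
    show "conf_at P c (Suc t) = c'"
      using run_step.IH st by simp
    show "\<forall>i<Suc t. \<not> halted P (conf_at P c i) \<and>
       accessed (P ! pc (conf_at P c i)) (conf_at P c i) \<subseteq> S \<and> words_below W (conf_at P c i)"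
    proof (intro allI impI)
      fix i assume "i < Suc t"
      then show "\<not> halted P (conf_at P c i) \<and>
       accessed (P ! pc (conf_at P c i)) (conf_at P c i) \<subseteq> S \<and> words_below W (conf_at P c i)"
        using run_step.IH run_step.hyps(1-3) st
        by (cases i) (auto simp: conf_at_def halted_def)
    qed
  qed
qed

lemma run_complete:
  assumes "run P S W c t c'" "pc c' = length P" "words_below W c'" "finite S"
  shows "ram_halts P c" "ram_time P c = t" "ram_output P c = out c'"
    "ram_space P c N \<le> card (\<Union>i\<in>set P. instr_regs i) + card ({..<N} \<union> S)" "ram_words P c W"
proof -
  note r = run_conf_at[OF assms(1)]
  have h: "halted P (conf_at P c t)"
    using r assms(2) by (simp add: halted_def)
  then show "ram_halts P c"
    by (auto simp: ram_halts_def)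
  show tm: "ram_time P c = t"
    unfolding ram_time_def using r h by (intro Least_equality) (auto simp: not_le[symmetric])
  show "ram_output P c = out c'"
    using tm r by (simp add: ram_output_def)
  have "(\<Union>i<t. accessed (P ! pc (conf_at P c i)) (conf_at P c i)) \<subseteq> S"
    using r by blast
  then have "{..<N} \<union> (\<Union>i<t. accessed (P ! pc (conf_at P c i)) (conf_at P c i)) \<subseteq> {..<N} \<union> S"
    by blast
  then show "ram_space P c N \<le> card (\<Union>i\<in>set P. instr_regs i) + card ({..<N} \<union> S)"
    unfolding ram_space_def tm using assms(4) by (simp add: card_mono)
  \<comment> \<open>The word bound speaks about all times, and after halting the configuration stays
    the same.\<close>
  have "conf_at P c (t + i) = c'" for i
  proof (induction i)
    case (Suc i)
    then show ?case
      using assms(2) by (simp add: conf_at_def step_def halted_def)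
  qed (use r in simp)
  then have "words_below W (conf_at P c i)" for i
    using r assms(3) by (cases "i < t") (auto dest: le_Suc_ex simp: not_less)
  then show "ram_words P c W"
    by (auto simp: ram_words_def words_below_def)
qed

definition code_at :: "program \<Rightarrow> nat \<Rightarrow> instr list \<Rightarrow> bool" where
  "code_at P p is \<longleftrightarrow> (\<exists>pre post. P = pre @ is @ post \<and> length pre = p)"

lemma code_at_Nil: "code_at P p [] \<longleftrightarrow> p \<le> length P"
proof
  assume "p \<le> length P"
  then have "P = take p P @ [] @ drop p P \<and> length (take p P) = p"
    by simp
  then show "code_at P p []"
    unfolding code_at_def by blast
qed (auto simp: code_at_def)

lemma code_at_Cons: "code_at P p (i # is) \<longleftrightarrow> p < length P \<and> P ! p = i \<and> code_at P (Suc p) is"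
proof
  assume "code_at P p (i # is)"
  then obtain pre post where "P = pre @ (i # is) @ post" "length pre = p"
    by (auto simp: code_at_def)
  then show "p < length P \<and> P ! p = i \<and> code_at P (Suc p) is"
    unfolding code_at_def by (intro conjI exI[of _ "pre @ [i]"] exI[of _ post]) (auto simp: nth_append)
next
  assume a: "p < length P \<and> P ! p = i \<and> code_at P (Suc p) is"
  then obtain pre post where p: "P = pre @ is @ post" "length pre = Suc p"
    by (auto simp: code_at_def)
  then obtain pre' x where "pre = pre' @ [x]"
    by (cases pre rule: rev_cases) auto
  with a p show "code_at P p (i # is)"
    by (auto simp: code_at_def nth_append)
qed

lemma code_at_append: "code_at P p (is @ js) \<longleftrightarrow> code_at P p is \<and> code_at P (p + length is) js"
proof (induction "is" arbitrary: p)
  case Nil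
  then show ?case
    by (auto simp: code_at_Nil code_at_def)
next
  case (Cons i js)
  then show ?case
    by (auto simp: code_at_Cons)
qed

text \<open>Turns the side conditions of a straight-line block into a recursive function, so that
  blocks can be checked by symbolic execution.\<close>

fun safe :: "nat set \<Rightarrow> nat \<Rightarrow> instr list \<Rightarrow> config \<Rightarrow> bool" where
  "safe S W [] c \<longleftrightarrow> True"
| "safe S W (i # is) c \<longleftrightarrow> accessed i c \<subseteq> S \<and> words_below W c \<and> safe S W is (exec i c)"

fun no_jump :: "instr \<Rightarrow> bool" where
  "no_jump (Jump l) = False"
| "no_jump (JumpLess a b l) = False"
| "no_jump (JumpEq a b l) = False"
| "no_jump _ = True"

lemma run_straight:
  assumes "code_at P (pc c) is" "safe S W is c" "\<forall>i\<in>set is. no_jump i" "fold exec is c = c'"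
    "l = length is"
  shows "run P S W c l c'"
  using assms
proof (induction "is" arbitrary: c l)
  case Nil
  then show ?case by (auto intro: run_refl)
next
  case (Cons i js)
  then have "pc (exec i c) = Suc (pc c)"
    by (cases i) auto
  with Cons show ?case
    by (auto simp: code_at_Cons intro!: run_step)
qed

lemma digits_unique:
  assumes "a * b + c = a' * b + c'" "c < b" "c' < (b::nat)"
  shows "a = a'" "c = c'"
  using arg_cong[OF assms(1), of "\<lambda>x. x div b"] arg_cong[OF assms(1), of "\<lambda>x. x mod b"] assms(2,3)
  by simp_all

text \<open>An address is a number in mixed radix: the digit \<open>j\<close> in base 10, the digit
  \<open>v\<close> in base \<open>n + 1\<close>, and \<open>u + (n + 1)\<close> as leading part. The
  leading part is unbounded because the stack arrays may be indexed beyond \<open>n\<close>.\<close>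

lemma addr_inj:
  assumes "addr n (j, u, v) = addr n (j', u', v')" "j < 10" "j' < 10" "v \<le> n" "v' \<le> n"
  shows "(j, u, v) = (j', u', v')"
proof -
  note e = digits_unique[OF assms(1)[unfolded addr_def prod.case] assms(2,3)]
  have "u + (n + 1) = u' + (n + 1)" "v = v'"
    by (rule digits_unique[OF e(1)]; use assms in simp)+
  with e(2) show ?thesis
    by simp
qed

text \<open>The leading part of an address is at least \<open>n + 1\<close>; this keeps the array
  cells clear of the input.\<close>

lemma addr_ge: "10 * (n + 1) ^ 2 \<le> addr n x"
  by (cases x) (auto simp: addr_def power2_eq_square algebra_simps)

text \<open>The bound on \<open>W\<close> exceeds every address formed from \<open>u < B\<close> and
  \<open>v \<le> n\<close>; the slack of 20 covers the literals of the address computation.\<close>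

locale compiler = machine +
  fixes n W :: nat
  assumes Ok: "\<And>j u v. (j, u, v) \<in> Ok \<Longrightarrow> j < 10 \<and> v \<le> n"
    and inp: "\<And>a. a < N \<Longrightarrow> inp a < B"
    and N: "N \<le> 10 * (n + 1) ^ 2"
    and W: "((B + (n + 1)) * (n + 1) + n) * 10 + 20 \<le> W"
    and B: "B \<ge> 1"
begin

text \<open>Memory has to agree with the arrays on \<open>Ok\<close> only; other cells merely hold
  short words. There are two bounds because source values stay below \<open>B\<close> while the
  scratch registers hold addresses.\<close>

definition simulates :: "config \<Rightarrow> state \<Rightarrow> bool" where
  "simulates c = (\<lambda>(R, A, Z, t). (\<forall>r<50. regs c r = R r) \<and> words_below W c \<and>
     (\<forall>r. R r < B) \<and> (\<forall>x\<in>Ok. A x < B) \<and> (\<forall>x\<in>Ok. mem c (addr n x) = A x) \<and>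
     (\<forall>a<N. mem c a = inp a) \<and> out c = Z \<and> R 0 = n)"

abbreviation space :: "nat set" where "space \<equiv> {..<N} \<union> addr n ` Ok"

lemma bounds: "B \<le> W" "n + 20 \<le> W"
proof -
  define M where "M = (B + (n + 1)) * (n + 1)"
  have "B + (n + 1) \<le> M"
    unfolding M_def by simp
  with W[folded M_def] show "B \<le> W" "n + 20 \<le> W"
    by auto
qed

lemma addr_less_W: "u < B \<Longrightarrow> v \<le> n \<Longrightarrow> j < 10 \<Longrightarrow> addr n (j, u, v) < W"
proof -
  assume a: "u < B" "v \<le> n" "j < 10"
  define X Y where "X = (u + (n + 1)) * (n + 1)" and "Y = (B + (n + 1)) * (n + 1)"
  have "X \<le> Y"
    unfolding X_def Y_def using a by (intro mult_le_mono) auto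
  then show ?thesis
    using W a unfolding addr_def prod.case X_def[symmetric] Y_def[symmetric] by auto
qed

lemma length_address_code [simp]: "length (address_code j u v) = 9"
  by (simp add: address_code_def)

lemma run_address_code:
  assumes "code_at P (pc c) (address_code j u v)" "simulates c (R, A, Z, t)"
    "(j, R u, R v) \<in> Ok" "u < 50" "v < 50"
  shows "\<exists>c'. run P space W c 9 c' \<and> simulates c' (R, A, Z, t) \<and> pc c' = pc c + 9 \<and>
    regs c' 51 = addr n (j, R u, R v)"
proof -
  note s = assms(2)[unfolded simulates_def words_below_def, simplified]
  have o: "j < 10" "R v \<le> n" "R u < B"
    using Ok assms(3) s by blast+
  define n1 p q x y z where "n1 = n + 1" and "p = R u + n1" and "q = p * n1" and "x = q + R v"
    and "y = x * 10" and "z = y + j"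
  have e: "arith Add n 1 = n1" "arith Add (R u) n1 = p" "arith Mul p n1 = q" "arith Add q (R v) = x"
    "arith Mul x 10 = y" "arith Add y j = z"
    by (simp_all add: n1_def p_def q_def x_def y_def z_def)
  have z: "addr n (j, R u, R v) = z"
    by (simp only: addr_def prod.case n1_def p_def q_def x_def y_def z_def)
  \<comment> \<open>The intermediate values grow towards the address \<open>z\<close>, so the bound
    on \<open>z\<close> covers them.\<close>
  have "p \<le> q"
    by (simp add: q_def n1_def)
  moreover have "z < W"
    using addr_less_W o z by metis
  ultimately have b: "z < W" "y < W" "x < W" "q < W" "p < W" "n1 < W" "10 < W" "1 < W" "j < W"
    using bounds o unfolding n1_def p_def x_def y_def z_def by auto
  let ?c = "c\<lparr>pc := pc c + 9, regs := (regs c)(50 := j, 51 := z)\<rparr>"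
  have sim: "simulates ?c (R, A, Z, t)"
    using s b unfolding simulates_def words_below_def by auto
  have r: "regs c u = R u" "regs c v = R v" "regs c 0 = n" using s assms by auto
  have w: "\<forall>a. regs c a < W" "\<forall>a. mem c a < W" using s by auto
  have f: "fold exec (address_code j u v) c = ?c"
    using assms(4,5) r e by (simp add: address_code_def del: arith.simps)
  have "safe space W (address_code j u v) c"
    using assms(4,5) r e b w by (simp add: address_code_def words_below_def del: arith.simps)
  then have "run P space W c 9 ?c"
    by (rule run_straight[OF assms(1) _ _ f]) (auto simp: address_code_def)
  then show ?thesis
    using sim by (intro exI[of _ ?c]) (simp add: z)
qed


lemma run_one:
  assumes "code_at P (pc c) [i]" "accessed i c \<subseteq> S" "words_below W c"
  shows "run P S W c 1 (exec i c)"
  using assms by (auto simp: code_at_Cons intro!: run_step run_refl)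

lemma simulates_words: "simulates c s \<Longrightarrow> words_below W c"
  by (auto simp: simulates_def)

lemma simulates_write:
  assumes "simulates c (R, A, Z, t)" "x < B" "0 < r" "r < 50"
    "regs c' = f" "f = (regs c)(r := x) \<or> (\<exists>y < 20. f = (regs c)(50 := y, r := x))" "mem c' = mem c" "out c' = out c"
  shows "simulates c' (R(r := x), A, Z, t')"
  using assms bounds unfolding simulates_def words_below_def by auto

lemma simulates_pc: "simulates c (R, A, Z, t) \<Longrightarrow> simulates (c\<lparr>pc := p\<rparr>) (R, A, Z, t')"
  by (auto simp: simulates_def words_below_def)

text \<open>Injectivity of \<open>addr\<close> on \<open>Ok\<close> protects the other array cells,
  and the distance between arrays and input protects the input.\<close>

lemma simulates_store:
  assumes "simulates c (R, A, Z, t)" "x \<in> Ok" "y < B"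
  shows "simulates (c\<lparr>pc := p, mem := (mem c)(addr n x := y)\<rparr>) (R, A(x := y), Z, t')"
proof -
  have "addr n x' = addr n x \<longleftrightarrow> x' = x" if "x' \<in> Ok" for x'
    using addr_inj Ok that assms(2) by (cases x, cases x') metis
  moreover have "addr n x \<noteq> a" if "a < N" for a
    using addr_ge[of n x] N that by linarith
  ultimately show ?thesis
    using assms bounds unfolding simulates_def words_below_def by auto
qed

lemma run_Cond:
  assumes "simulates c (R, A, Z, t)" "pc c = p" "code_at P p [branch b l]" 
    "compilable (Cond b Skip Skip)"
  shows "run P space W c 1 (c\<lparr>pc := if holds b R then l else Suc p\<rparr>)"
proof -
  have "exec (branch b l) c = c\<lparr>pc := if holds b R then l else Suc p\<rparr>"
    using assms by (cases b) (auto simp: simulates_def)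
  moreover have "run P space W c 1 (exec (branch b l) c)"
    using assms simulates_words by (intro run_one) (auto, cases b, auto)
  ultimately show ?thesis by simp
qed

definition ticks :: "state \<Rightarrow> nat" where "ticks = (\<lambda>(R, A, Z, t). t)"

text \<open>Each counted step expands into at most ten instructions. Array accesses attain this
  factor, with nine instructions for the address and one for the access.\<close>

theorem compile_correct:
  assumes "big c s s'" "compilable c" "code_at P p (compile p c)" "pc cf = p" "simulates cf s"
  shows "\<exists>t cf'. run P space W cf t cf' \<and> simulates cf' s' \<and> pc cf' = p + code_length c \<and>
    t + 10 * ticks s \<le> 10 * ticks s'"
  using assms
proof (induction arbitrary: p cf rule: big.induct)
  case (Cst x r R A Z t)
  have "run P space W cf 1 (exec (Const r x) cf)"
    using Cst by (intro run_one) (auto dest: simulates_words)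
  moreover have "simulates (exec (Const r x) cf) (R(r := x), A, Z, Suc t)"
    by (rule simulates_write[OF Cst(5) Cst(1)]) (use Cst in auto)
  ultimately show ?case
    using Cst(4) by (intro exI[of _ 1] exI[of _ "exec (Const r x) cf"]) (auto simp: ticks_def)
next
  case (Mov r a R A Z t)
  let ?l = "[Const 50 0, Arith Add r a 50]"
  have s: "simulates (fold exec ?l cf) (R(r := R a), A, Z, Suc t)"
    by (rule simulates_write[OF Mov(4)]) (use Mov in \<open>auto simp: simulates_def intro!: exI[of _ 0]\<close>)
  have "run P space W cf 2 (fold exec ?l cf)"
    using Mov bounds by (intro run_straight[of P cf ?l]) (auto simp: simulates_def words_below_def)
  then show ?case
    using s Mov(3) by (intro exI[of _ 2] exI[of _ "fold exec ?l cf"]) (auto simp: ticks_def)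
next
  case (Inc R r A Z t)
  let ?l = "[Const 50 1, Arith Add r r 50]"
  have s: "simulates (fold exec ?l cf) (R(r := Suc (R r)), A, Z, Suc t)"
    by (rule simulates_write[OF Inc(5)]) (use Inc in \<open>auto simp: simulates_def intro!: exI[of _ 1]\<close>)
  have "run P space W cf 2 (fold exec ?l cf)"
    using Inc bounds by (intro run_straight[of P cf ?l]) (auto simp: simulates_def words_below_def)
  then show ?case
    using s Inc(4) by (intro exI[of _ 2] exI[of _ "fold exec ?l cf"]) (auto simp: ticks_def)
next
  case (Dec r R A Z t)
  let ?l = "[Const 50 1, Arith Sub r r 50]"
  have s: "simulates (fold exec ?l cf) (R(r := R r - 1), A, Z, Suc t)"
    by (rule simulates_write[OF Dec(4)])
      (use Dec in \<open>auto simp: simulates_def less_imp_diff_less intro!: exI[of _ 1]\<close>)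
  have "run P space W cf 2 (fold exec ?l cf)"
    using Dec bounds by (intro run_straight[of P cf ?l]) (auto simp: simulates_def words_below_def)
  then show ?case
    using s Dec(3) by (intro exI[of _ 2] exI[of _ "fold exec ?l cf"]) (auto simp: ticks_def)
next
  case (LdIn R a r A Z t)
  have "run P space W cf 1 (exec (Load r a) cf)"
    using LdIn by (intro run_one) (auto simp: simulates_def)
  moreover have "simulates (exec (Load r a) cf) (R(r := inp (R a)), A, Z, Suc t)"
    by (rule simulates_write[OF LdIn(5) inp]) (use LdIn in \<open>auto simp: simulates_def\<close>)
  ultimately show ?case
    using LdIn(4) by (intro exI[of _ 1] exI[of _ "exec (Load r a) cf"]) (auto simp: ticks_def)
next
  case (Ld j R u v r A Z t)
  from Ld(3,4) have "code_at P (pc cf) (address_code j u v)"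
    by (simp add: code_at_append)
  from run_address_code[OF this Ld(5) Ld(1)] Ld(2) obtain c1 where
    c1: "run P space W cf 9 c1" "simulates c1 (R, A, Z, t)" "pc c1 = pc cf + 9"
      "regs c1 51 = addr n (j, R u, R v)"
    by auto
  have "code_at P (pc c1) [Load r 51]"
    using Ld(3,4) c1(3) by (simp add: code_at_append)
  then have "run P space W c1 1 (exec (Load r 51) c1)"
    using Ld(1) c1(4) simulates_words[OF c1(2)] by (intro run_one) auto
  note r = run_trans[OF c1(1) this]
  have "simulates (exec (Load r 51) c1) (R(r := A (j, R u, R v)), A, Z, Suc t)"
    by (rule simulates_write[OF c1(2)]) (use Ld c1 in \<open>auto simp: simulates_def\<close>)
  then show ?case
    using Ld(4) c1(3) r by (intro exI[of _ 10] exI[of _ "exec (Load r 51) c1"]) (auto simp: ticks_def)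
next
  case (St j R u v r A Z t)
  from St(3,4) have "code_at P (pc cf) (address_code j u v)"
    by (simp add: code_at_append)
  from run_address_code[OF this St(5) St(1)] St(2) obtain c1 where
    c1: "run P space W cf 9 c1" "simulates c1 (R, A, Z, t)" "pc c1 = pc cf + 9"
      "regs c1 51 = addr n (j, R u, R v)"
    by auto
  have "code_at P (pc c1) [Store 51 r]"
    using St(3,4) c1(3) by (simp add: code_at_append)
  then have "run P space W c1 1 (exec (Store 51 r) c1)"
    using St(1) c1(4) simulates_words[OF c1(2)] by (intro run_one) auto
  note r = run_trans[OF c1(1) this]
  have x: "regs c1 r = R r" "R r < B"
    using c1(2) St(2) by (auto simp: simulates_def)
  have "simulates (exec (Store 51 r) c1) (R, A((j, R u, R v) := R r), Z, Suc t)"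
    using simulates_store[OF c1(2) St(1) x(2), of "Suc (pc c1)"] c1(4) x(1) by simp
  then show ?case
    using St(4) c1(3) r by (intro exI[of _ 10] exI[of _ "exec (Store 51 r) c1"]) (auto simp: ticks_def)
next
  case (Emit r R A Z t)
  have "run P space W cf 1 (exec (Output r) cf)"
    using Emit by (intro run_one) (auto dest: simulates_words)
  moreover have "simulates (exec (Output r) cf) (R, A, Z @ [R r], Suc t)"
    using Emit by (auto simp: simulates_def words_below_def)
  ultimately show ?case
    using Emit(3) by (intro exI[of _ 1] exI[of _ "exec (Output r) cf"]) (auto simp: ticks_def)
next
  case (Skip s)
  then show ?case
    by (intro exI[of _ 0] exI[of _ cf]) (auto intro: run_refl)
next
  case (Seq c s s' d s'')
  then have c: "compilable c" "compilable d" "code_at P p (compile p c)"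
    "code_at P (p + code_length c) (compile (p + code_length c) d)"
    by (auto simp: code_at_append)
  from Seq.IH(1)[OF c(1,3) Seq.prems(3,4)] obtain t1 c1 where
    1: "run P space W cf t1 c1" "simulates c1 s'" "pc c1 = p + code_length c"
      "t1 + 10 * ticks s \<le> 10 * ticks s'"
    by auto
  from Seq.IH(2)[OF c(2,4) 1(3,2)] obtain t2 c2 where
    2: "run P space W c1 t2 c2" "simulates c2 s''" "pc c2 = p + code_length c + code_length d"
      "t2 + 10 * ticks s' \<le> 10 * ticks s''"
    by auto
  show ?case
    using run_trans[OF 1(1) 2(1)] 1 2 by (intro exI[of _ "t1 + t2"] exI[of _ c2]) auto
next
  case (CondT b R c A Z t s' d)
  let ?l = "p + code_length d + 2"
  have co: "compilable (Cond b Skip Skip)" "compilable c"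
    using CondT.prems(1) compilable_test by blast+
  have code: "code_at P p [branch b ?l]" "code_at P ?l (compile ?l c)"
    using CondT.prems(2) unfolding compile.simps code_at_append by (simp_all add: add_ac)
  have 1: "run P space W cf 1 (cf\<lparr>pc := ?l\<rparr>)"
    using run_Cond[OF CondT.prems(4,3) code(1) co(1)] CondT.hyps(1) by simp
  from CondT.IH[OF co(2) code(2) _ simulates_pc[OF CondT.prems(4)]] obtain t2 c2 where
    2: "run P space W (cf\<lparr>pc := ?l\<rparr>) t2 c2" "simulates c2 s'" "pc c2 = ?l + code_length c"
      "t2 + 10 * ticks (R, A, Z, Suc t) \<le> 10 * ticks s'"
    by auto
  show ?case
    using run_trans[OF 1 2(1)] 2 by (intro exI[of _ "1 + t2"] exI[of _ c2]) (auto simp: ticks_def)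
next
  case (CondF b R d A Z t s' c)
  let ?l = "p + code_length d + 2"
  have co: "compilable (Cond b Skip Skip)" "compilable d"
    using CondF.prems(1) compilable_test by blast+
  have code: "code_at P p [branch b ?l]" "code_at P (Suc p) (compile (Suc p) d)" "code_at P (p + 1 + code_length d) [Jump (?l + code_length c)]"
    using CondF.prems(2) unfolding compile.simps code_at_append by (simp_all add: add_ac)
  have 1: "run P space W cf 1 (cf\<lparr>pc := Suc p\<rparr>)"
    using run_Cond[OF CondF.prems(4,3) code(1) co(1)] CondF.hyps(1) by simp
  from CondF.IH[OF co(2) code(2) _ simulates_pc[OF CondF.prems(4)]] obtain t2 c2 where
    2: "run P space W (cf\<lparr>pc := Suc p\<rparr>) t2 c2" "simulates c2 s'" "pc c2 = Suc p + code_length d"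
      "t2 + 10 * ticks (R, A, Z, Suc t) \<le> 10 * ticks s'"
    by auto
  have 3: "run P space W c2 1 (c2\<lparr>pc := ?l + code_length c\<rparr>)"
    using run_one[of P c2 "Jump (?l + code_length c)"] code(3) 2 simulates_words by simp
  have "simulates (c2\<lparr>pc := ?l + code_length c\<rparr>) s'"
    using 2(2) simulates_pc by (cases s') blast
  then show ?case
    using run_trans[OF 1 run_trans[OF 2(1) 3]] 2
    by (intro exI[of _ "1 + (t2 + 1)"] exI[of _ "c2\<lparr>pc := ?l + code_length c\<rparr>"]) (auto simp: ticks_def)
next
  case (LoopT b R c A Z t s' s'')
  have co: "compilable (Cond b Skip Skip)" "compilable c"
    using LoopT.prems(1) compilable_test by blast+
  have code: "code_at P p [branch b (p + 2)]" "code_at P (p + 2) (compile (p + 2) c)" "code_at P (p + 2 + code_length c) [Jump p]"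
    using LoopT.prems(2) unfolding compile.simps code_at_append by (simp_all add: code_at_Cons code_at_Nil add_ac)
  have 1: "run P space W cf 1 (cf\<lparr>pc := p + 2\<rparr>)"
    using run_Cond[OF LoopT.prems(4,3) code(1) co(1)] LoopT.hyps(1) by simp
  from LoopT.IH(1)[OF co(2) code(2) _ simulates_pc[OF LoopT.prems(4)]] obtain t2 c2 where
    2: "run P space W (cf\<lparr>pc := p + 2\<rparr>) t2 c2" "simulates c2 s'" "pc c2 = p + 2 + code_length c"
      "t2 + 10 * ticks (R, A, Z, Suc t) \<le> 10 * ticks s'"
    by auto
  have 3: "run P space W c2 1 (c2\<lparr>pc := p\<rparr>)"
    using run_one[of P c2 "Jump p"] code(3) 2 simulates_words by simp
  have "simulates (c2\<lparr>pc := p\<rparr>) s'"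
    using 2(2) simulates_pc by (cases s') blast
  from LoopT.IH(2)[OF LoopT.prems(1,2) _ this] obtain t4 c4 where
    4: "run P space W (c2\<lparr>pc := p\<rparr>) t4 c4" "simulates c4 s''" "pc c4 = p + code_length (Loop b c)"
      "t4 + 10 * ticks s' \<le> 10 * ticks s''"
    by auto
  show ?case
    using run_trans[OF 1 run_trans[OF 2(1) run_trans[OF 3 4(1)]]] 2 4
    by (intro exI[of _ "1 + (t2 + (1 + t4))"] exI[of _ c4]) (auto simp: ticks_def)
next
  case (LoopF b R c A Z t)
  have co: "compilable (Cond b Skip Skip)"
    using LoopF.prems(1) compilable_test by blast+
  have code: "code_at P p [branch b (p + 2)]" "code_at P (Suc p) [Jump (p + 3 + code_length c)]"
    using LoopF.prems(2) unfolding compile.simps code_at_append by (simp_all add: code_at_Cons code_at_Nil add_ac)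
  have 1: "run P space W cf 1 (cf\<lparr>pc := Suc p\<rparr>)"
    using run_Cond[OF LoopF.prems(4,3) code(1) co(1)] LoopF.hyps(1) by simp
  have 2: "run P space W (cf\<lparr>pc := Suc p\<rparr>) 1 (cf\<lparr>pc := p + 3 + code_length c\<rparr>)"
    using run_one[of P "cf\<lparr>pc := Suc p\<rparr>" "Jump (p + 3 + code_length c)"] code(2)
      simulates_words[OF simulates_pc[OF LoopF.prems(4)]] by simp
  show ?case
    using run_trans[OF 1 2] simulates_pc[OF LoopF.prems(4)]
    by (intro exI[of _ "1 + 1"] exI[of _ "cf\<lparr>pc := p + 3 + code_length c\<rparr>"]) (auto simp: ticks_def)
qed

end

section \<open>Rooted trees\<close>

text \<open>Arborescences with root \<open>r\<close>, generated leaf by leaf. The vertex set is an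
  index of its own because a single vertex has no arcs to recover it from.\<close>

inductive out_tree :: "'a \<Rightarrow> ('a \<times> 'a) set \<Rightarrow> 'a set \<Rightarrow> bool" for r where
  root: "out_tree r {} {r}"
| grow: "out_tree r F W \<Longrightarrow> a \<in> W \<Longrightarrow> y \<notin> W \<Longrightarrow> out_tree r (insert (a, y) F) (insert y W)"

definition undirected :: "('a \<times> 'a) set \<Rightarrow> 'a set set" where
  "undirected F = (\<lambda>(u, v). {u, v}) ` F"

lemma undirected_insert [simp]: "undirected (insert (a, y) F) = insert {a, y} (undirected F)"
  by (simp add: undirected_def)

lemma undirected_empty [simp]: "undirected {} = {}"
  by (simp add: undirected_def)

lemma out_tree_finite: "out_tree r F W \<Longrightarrow> finite F \<and> finite W"
  by (induction rule: out_tree.induct) auto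

lemma out_tree_root: "out_tree r F W \<Longrightarrow> r \<in> W"
  by (induction rule: out_tree.induct) auto

lemma out_tree_arcs: "out_tree r F W \<Longrightarrow> F \<subseteq> W \<times> W"
  by (induction rule: out_tree.induct) auto

lemma out_tree_no_root: "out_tree r F W \<Longrightarrow> (a, r) \<notin> F"
  by (induction rule: out_tree.induct) (auto dest: out_tree_root)

lemma out_tree_verts: "out_tree r F W \<Longrightarrow> W = insert r (snd ` F)"
  by (induction rule: out_tree.induct) auto

lemma out_tree_card: "out_tree r F W \<Longrightarrow> card W = Suc (card F)"
proof (induction rule: out_tree.induct)
  case (grow F W a y)
  have "(a, y) \<notin> F"
    using out_tree_arcs[OF grow(1)] grow(3) by blast
  then show ?case
    using grow(3,4) out_tree_finite[OF grow(1)] by simp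
qed simp

lemma out_tree_parent_unique: "out_tree r F W \<Longrightarrow> (a, y) \<in> F \<Longrightarrow> (b, y) \<in> F \<Longrightarrow> a = b"
proof (induction arbitrary: a b y rule: out_tree.induct)
  case (grow F W c z)
  have "(u, z) \<notin> F" for u
    using out_tree_arcs[OF grow(1)] grow(3) by blast
  with grow show ?case by blast
qed simp

text \<open>Every vertex is reached from the root along \<open>F\<close>. This is the means by which
  solutions are later confined to small sets.\<close>

lemma out_tree_closed:
  "out_tree r F W \<Longrightarrow> r \<in> U \<Longrightarrow> (\<And>a y. a \<in> U \<Longrightarrow> (a, y) \<in> F \<Longrightarrow> y \<in> U) \<Longrightarrow> W \<subseteq> U"
  by (induction rule: out_tree.induct) auto

text \<open>The root determines the orientation: if \<open>F'\<close> contained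
  \<open>(y, a)\<close> instead of \<open>(a, y)\<close>, then \<open>a\<close> would be the root
  with a parent, or it would have two parents in \<open>F'\<close>, namely \<open>y\<close> and its
  parent in \<open>F\<close>.\<close>

lemma undirected_inj:
  assumes "out_tree r F W" "out_tree r F' W'" "undirected F \<subseteq> undirected F'"
  shows "F \<subseteq> F'"
  using assms(1,3)
proof (induction)
  case (grow F W a y)
  then have F: "F \<subseteq> F'" by simp
  from grow.prems have "(a, y) \<in> F' \<or> (y, a) \<in> F'"
    by (auto simp: undirected_def doubleton_eq_iff)
  moreover have False if "(y, a) \<in> F'"
  proof (cases "a = r")
    case True
    then show False using that out_tree_no_root[OF assms(2)] by blast
  next
    case False
    then obtain b where b: "(b, a) \<in> F"
      using out_tree_verts[OF grow(1)] grow(2) by auto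
    then have "b = y"
      using F that out_tree_parent_unique[OF assms(2)] by blast
    then show False
      using b out_tree_arcs[OF grow(1)] grow(3) by blast
  qed
  ultimately show ?case using F by blast
qed simp

lemma rtrancl_crossing:
  "(u, v) \<in> rel\<^sup>* \<Longrightarrow> u \<in> W \<Longrightarrow> v \<notin> W \<Longrightarrow> \<exists>a\<in>W. \<exists>y. y \<notin> W \<and> (a, y) \<in> rel"
  by (induction rule: rtrancl_induct) auto

text \<open>While a vertex is missing, connectedness provides an edge leaving the tree, whose far
  end becomes a new leaf.\<close>

lemma out_tree_extend:
  assumes "out_tree r F W" "connected_graph V E" "W \<subseteq> V" "\<Union>E \<subseteq> V" "finite V"
    "card W \<le> j" "j \<le> card V"
  shows "\<exists>F' W'. out_tree r F' W' \<and> F \<subseteq> F' \<and> card W' = j \<and> W' \<subseteq> V \<and> undirected F' \<subseteq> undirected F \<union> E"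
  using assms(6,7)
proof (induction j rule: dec_induct)
  case base
  then show ?case using assms by blast
next
  case (step j)
  then obtain F' W' where h: "out_tree r F' W'" "F \<subseteq> F'" "card W' = j" "W' \<subseteq> V"
    "undirected F' \<subseteq> undirected F \<union> E"
    by auto
  have "W' \<noteq> V" using h step by auto
  then obtain v where v: "v \<in> V" "v \<notin> W'" using h by blast
  have "(r, v) \<in> {(x, y). {x, y} \<in> E}\<^sup>*"
    using assms(2) v out_tree_root[OF h(1)] h(4) unfolding connected_graph_def by blast
  from rtrancl_crossing[OF this out_tree_root[OF h(1)] v(2)] obtain a y where
    ay: "a \<in> W'" "y \<notin> W'" "{a, y} \<in> E" by auto
  have "y \<in> V" using ay assms(4) by blast
  then show ?case
    using out_tree.grow[OF h(1) ay(1,2)] h ay out_tree_finite[OF h(1)]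
    by (intro exI[of _ "insert (a, y) F'"] exI[of _ "insert y W'"]) auto
qed

section \<open>Correspondence between rooted trees and \<open>k\<close>-subtrees\<close>

lemma not_is_cycle_empty: "\<not> is_cycle {} vs"
  by (cases vs) (auto simp: is_cycle_def)

text \<open>On a cycle \<open>y\<close> would have two distinct neighbours, but
  \<open>{a, y}\<close> is the only edge at \<open>y\<close>.\<close>

lemma leaf_not_on_cycle:
  assumes "is_cycle (insert {a, y} T) vs" "y \<notin> \<Union>T" "a \<noteq> y"
  shows "y \<notin> set vs"
proof
  assume "y \<in> set vs"
  then obtain i where i: "i < length vs" "vs ! i = y"
    by (auto simp: in_set_conv_nth)
  let ?l = "length vs"
  have c: "3 \<le> ?l" "distinct vs" "\<And>i. i < ?l \<Longrightarrow> {vs ! i, vs ! (Suc i mod ?l)} \<in> insert {a, y} T"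
    using assms(1) by (auto simp: is_cycle_def)
  \<comment> \<open>Cyclic successor \<open>s\<close> and predecessor \<open>p\<close> of position
    \<open>i\<close>; they differ because a cycle has at least three vertices.\<close>
  define s where "s = (if Suc i = ?l then 0 else Suc i)"
  define p where "p = (if i = 0 then ?l - 1 else i - 1)"
  have s: "s = Suc i mod ?l" "s < ?l" and p: "Suc p mod ?l = i" "p < ?l"
    using i c(1) by (auto simp: s_def p_def)
  have "s \<noteq> p" "s \<noteq> i" "p \<noteq> i"
    using i c(1) by (auto simp: s_def p_def split: if_splits)
  with c(2) s p i have d: "vs ! s \<noteq> vs ! p" "vs ! s \<noteq> y" "vs ! p \<noteq> y"
    by (auto simp: nth_eq_iff_index_eq)
  have "{y, vs ! s} \<in> insert {a, y} T" "{vs ! p, y} \<in> insert {a, y} T"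
    using c(3)[OF i(1)] c(3)[OF p(2)] i(2) s p by auto
  with assms(2) have "{y, vs ! s} = {a, y}" "{vs ! p, y} = {a, y}"
    by blast+
  with d show False
    by (auto simp: doubleton_eq_iff)
qed

lemma out_tree_Union_subset: "out_tree r F W \<Longrightarrow> \<Union>(undirected F) \<subseteq> W"
  using out_tree_arcs by (fastforce simp: undirected_def)

lemma card_undirected: "out_tree r F W \<Longrightarrow> card (undirected F) = card F"
proof (induction rule: out_tree.induct)
  case (grow F W a y)
  have "{a, y} \<notin> undirected F" "(a, y) \<notin> F"
    using out_tree_Union_subset[OF grow(1)] out_tree_arcs[OF grow(1)] grow(3) by auto
  moreover have "finite (undirected F)"
    using out_tree_finite[OF grow(1)] by (simp add: undirected_def)
  ultimately show ?case
    using grow(4) out_tree_finite[OF grow(1)] by simp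
qed simp

lemma acyclic_undirected: "out_tree r F W \<Longrightarrow> acyclic_edges (undirected F)"
proof (induction rule: out_tree.induct)
  case root
  show ?case by (simp add: acyclic_edges_def not_is_cycle_empty)
next
  case (grow F W a y)
  have ne: "a \<noteq> y" using grow(2,3) by blast
  have "\<not> is_cycle (insert {a, y} (undirected F)) vs" for vs
  proof
    assume vs: "is_cycle (insert {a, y} (undirected F)) vs"
    have y: "y \<notin> set vs"
      using leaf_not_on_cycle[OF vs _ ne] out_tree_Union_subset[OF grow(1)] grow(3) by blast
    have "{vs ! i, vs ! (Suc i mod length vs)} \<in> undirected F" if "i < length vs" for i
    proof -
      have "Suc i mod length vs < length vs"
        using that by (cases vs) auto
      then have "vs ! i \<noteq> y" "vs ! (Suc i mod length vs) \<noteq> y"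
        using y that by (auto dest: nth_mem)
      then have "{vs ! i, vs ! (Suc i mod length vs)} \<noteq> {a, y}"
        by (auto simp: doubleton_eq_iff)
      then show ?thesis
        using vs that unfolding is_cycle_def by blast
    qed
    then have "is_cycle (undirected F) vs"
      using vs unfolding is_cycle_def by blast
    with grow(4) show False
      unfolding acyclic_edges_def by blast
  qed
  then show ?case
    by (simp add: acyclic_edges_def)
qed

lemma connected_undirected: "out_tree r F W \<Longrightarrow> connected_graph W (undirected F)"
proof (induction rule: out_tree.induct)
  case root
  show ?case by (simp add: connected_graph_def)
next
  case (grow F W a y)
  let ?r = "{(u, v). {u, v} \<in> undirected F}" and ?r' = "{(u, v). {u, v} \<in> undirected (insert (a, y) F)}"
  have m: "?r\<^sup>* \<subseteq> ?r'\<^sup>*" by (intro rtrancl_mono) auto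
  have a: "(a, y) \<in> ?r'\<^sup>*" "(y, a) \<in> ?r'\<^sup>*"
    by (auto intro!: r_into_rtrancl simp: insert_commute)
  have W: "(u, v) \<in> ?r'\<^sup>*" if "u \<in> W" "v \<in> W" for u v
    using grow(4) that m unfolding connected_graph_def by blast
  have y: "(u, y) \<in> ?r'\<^sup>*" "(y, u) \<in> ?r'\<^sup>*" if "u \<in> W" for u
    using rtrancl_trans[OF W[OF that grow(2)] a(1)] rtrancl_trans[OF a(2) W[OF grow(2) that]] by auto
  show ?case
    unfolding connected_graph_def using W y by blast
qed

text \<open>All vertices but the root have an incoming arc. The root has an outgoing one, since
  otherwise \<open>{r}\<close> would be closed and would be the whole vertex set.\<close>

lemma out_tree_Union:
  assumes "out_tree r F W" "2 \<le> card W"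
  shows "\<Union>(undirected F) = W"
proof
  show "\<Union>(undirected F) \<subseteq> W" by (rule out_tree_Union_subset[OF assms(1)])
  have "F \<noteq> {}" using out_tree_card[OF assms(1)] assms(2) by auto
  have "r \<in> fst ` F"
  proof (rule ccontr)
    assume "r \<notin> fst ` F"
    then have "W \<subseteq> {r}" by (intro out_tree_closed[OF assms(1)]) force+
    then have "card W \<le> 1" using card_mono[of "{r}" W] by simp
    then show False using assms(2) by simp
  qed
  then show "W \<subseteq> \<Union>(undirected F)"
    using out_tree_verts[OF assms(1)] by (auto simp: undirected_def)
qed

lemma out_tree_k_subtree:
  assumes "out_tree r F W" "undirected F \<subseteq> E" "card W = k" "2 \<le> k"
  shows "undirected F \<in> k_subtrees E k"
  using assms card_undirected[OF assms(1)] acyclic_undirected[OF assms(1)] connected_undirected[OF assms(1)]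
    out_tree_Union[OF assms(1)] out_tree_card[OF assms(1)]
  by (simp add: k_subtrees_def)

text \<open>A tree grown inside \<open>T\<close> from \<open>r\<close> until it has \<open>k\<close>
  vertices has \<open>k - 1\<close> edges, which by cardinality are all edges of
  \<open>T\<close>.\<close>

lemma k_subtree_out_tree:
  assumes "T \<in> k_subtrees E k" "r \<in> \<Union>T" "2 \<le> k"
  shows "\<exists>F. out_tree r F (\<Union>T) \<and> undirected F = T"
proof -
  have T: "card T = k - 1" "connected_graph (\<Union>T) T" "card (\<Union>T) = k"
    using assms by (auto simp: k_subtrees_def)
  then have fin: "finite T" "finite (\<Union>T)"
    using assms(3) by (auto intro: card_ge_0_finite)
  from out_tree_extend[OF out_tree.root T(2) _ _ fin(2), of r k] T(3) assms obtain F W where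
    F: "out_tree r F W" "card W = k" "W \<subseteq> \<Union>T" "undirected F \<subseteq> T"
    by auto
  have "W = \<Union>T" using F T fin by (metis card_subset_eq)
  moreover have "undirected F = T"
    using F T fin out_tree_card[OF F(1)] card_undirected[OF F(1)]
    by (intro card_subset_eq) auto
  ultimately show ?thesis using F by blast
qed

lemma edges_le_k_subtrees:
  assumes "simple_graph V E" "connected_graph V E" "2 \<le> k" "k \<le> card V"
  shows "card E \<le> card (k_subtrees E k) * (k - 1)" "finite (k_subtrees E k)"
proof -
  have fin: "finite V" "\<Union>E \<subseteq> V" using assms by (auto simp: simple_graph_def)
  then have "finite E" by (metis finite_UnionD finite_subset)
  then show fs: "finite (k_subtrees E k)"
    by (intro finite_subset[of "k_subtrees E k" "Pow E"]) (auto simp: k_subtrees_def)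
  have "E \<subseteq> \<Union>(k_subtrees E k)"
  proof
    fix e assume e: "e \<in> E"
    then have "card e = 2" "e \<subseteq> V"
      using assms(1) by (auto simp: simple_graph_def)
    then obtain u v where uv: "e = {u, v}" "u \<noteq> v" "u \<in> V" "v \<in> V"
      unfolding card_2_iff by blast
    \<comment> \<open>The edge itself is a tree on two vertices and can be grown to \<open>k\<close>
      vertices, so the \<open>k\<close>-subtrees cover \<open>E\<close>.\<close>
    have "out_tree u {(u, v)} {v, u}"
      using out_tree.grow[OF out_tree.root[of u], of u v] uv by auto
    from out_tree_extend[OF this assms(2) _ fin(2,1), of k] uv assms(3,4) obtain F W where
      F: "out_tree u F W" "{(u, v)} \<subseteq> F" "card W = k" "undirected F \<subseteq> insert e E"
      by auto
    have "undirected F \<in> k_subtrees E k"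
      using out_tree_k_subtree[OF F(1) _ F(3) assms(3)] F(4) e by blast
    moreover have "e \<in> undirected F"
      using F(2) uv by (force simp: undirected_def)
    ultimately show "e \<in> \<Union>(k_subtrees E k)" by blast
  qed
  then have "card E \<le> card (\<Union>(k_subtrees E k))"
    by (intro card_mono finite_subset[OF _ \<open>finite E\<close>]) (auto simp: k_subtrees_def)
  also have "\<dots> \<le> (\<Sum>T\<in>k_subtrees E k. card T)"
    by (rule card_Union_le_sum_card)
  also have "\<dots> = card (k_subtrees E k) * (k - 1)"
    by (simp add: k_subtrees_def)
  finally show "card E \<le> card (k_subtrees E k) * (k - 1)" .
qed


section \<open>Solutions extending a partial tree\<close>

text \<open>\<open>L\<close> gives directed out-lists, so that \<open>(a, y)\<close> can be
  forbidden while \<open>(y, a)\<close> stays available. \<open>F0\<close> is the arc set of the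
  partial tree.\<close>

definition solutions :: "('a \<Rightarrow> 'a set) \<Rightarrow> 'a \<Rightarrow> nat \<Rightarrow> ('a \<times> 'a) set \<Rightarrow> ('a \<times> 'a) set set" where
  "solutions L r k F0 = {F. \<exists>W. out_tree r F W \<and> card W = k \<and> F0 \<subseteq> F \<and> (\<forall>(a, y)\<in>F. y \<in> L a)}"

text \<open>Says that at least \<open>k\<close> vertices are reachable from \<open>P\<close>,
  phrased through finite closed supersets, which is the form in which it is both derived and
  used.\<close>

definition feasible :: "('a \<Rightarrow> 'a set) \<Rightarrow> 'a set \<Rightarrow> nat \<Rightarrow> bool" where
  "feasible L P k \<longleftrightarrow> (\<forall>U. finite U \<longrightarrow> P \<subseteq> U \<longrightarrow> (\<forall>w\<in>U. L w \<subseteq> U) \<longrightarrow> k \<le> card U)"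

lemma feasible_mono: "feasible L P k \<Longrightarrow> P \<subseteq> P' \<Longrightarrow> feasible L P' k"
  unfolding feasible_def by blast

lemma feasible_solution:
  assumes "F \<in> solutions L r k F0" "r \<in> P"
  shows "feasible L P k"
  unfolding feasible_def
proof (intro allI impI)
  fix U assume U: "finite U" "P \<subseteq> U" "\<forall>w\<in>U. L w \<subseteq> U"
  from assms obtain W where W: "out_tree r F W" "card W = k" "\<forall>(a, y)\<in>F. y \<in> L a"
    by (auto simp: solutions_def)
  have "W \<subseteq> U" by (rule out_tree_closed[OF W(1)]) (use U W assms(2) in blast)+
  with W(2) U(1) show "k \<le> card U" by (metis card_mono)
qed

lemma finite_solutions:
  assumes "r \<in> V" "finite V" "\<And>u. u \<in> V \<Longrightarrow> L u \<subseteq> V"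
  shows "finite (solutions L r k F0)"
proof (rule finite_subset)
  show "solutions L r k F0 \<subseteq> Pow (V \<times> V)"
  proof
    fix F assume "F \<in> solutions L r k F0"
    then obtain W where W: "out_tree r F W" "\<forall>(a, y)\<in>F. y \<in> L a"
      by (auto simp: solutions_def)
    have "W \<subseteq> V" by (rule out_tree_closed[OF W(1)]) (use W assms in blast)+
    with out_tree_arcs[OF W(1)] show "F \<in> Pow (V \<times> V)" by blast
  qed
  show "finite (Pow (V \<times> V))" using assms(2) by simp
qed

lemma solutions_include:
  "{F \<in> solutions L r k F0. (a, y) \<in> F} = solutions L r k (insert (a, y) F0)"
  by (auto simp: solutions_def)

text \<open>Forbidding an arc amounts to deleting its head from the list of its tail, so the second
  branch is again a set of solutions for the same partial tree.\<close>

lemma solutions_exclude: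
  assumes "(a, y) \<notin> F0" "y \<in> L a"
  shows "{F \<in> solutions L r k F0. (a, y) \<notin> F} = solutions (L(a := L a - {y})) r k F0"
proof -
  have "(\<forall>x\<in>F. snd x \<in> (L(a := L a - {y})) (fst x)) \<longleftrightarrow> (\<forall>x\<in>F. snd x \<in> L (fst x)) \<and> (a, y) \<notin> F" for F
    by (auto split: if_splits)
  then show ?thesis
    unfolding solutions_def split_beta by blast
qed

text \<open>Orienting a \<open>k\<close>-subtree away from \<open>r\<close> inverts
  \<open>undirected\<close>. With the lists of the subgraph induced on \<open>U\<close>, the arcs
  stay inside \<open>U\<close> by closure from the root.\<close>

lemma undirected_solutions:
  assumes "2 \<le> k" "r \<in> U" "\<And>u. u \<in> U \<Longrightarrow> L u = {v \<in> U. {u, v} \<in> E}"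
  shows "undirected ` solutions L r k {} = {T \<in> k_subtrees E k. r \<in> \<Union>T \<and> \<Union>T \<subseteq> U}"
    and "inj_on undirected (solutions L r k {})"
proof -
  show "inj_on undirected (solutions L r k {})"
  proof (rule inj_onI)
    fix F F' assume "F \<in> solutions L r k {}" "F' \<in> solutions L r k {}" and e: "undirected F = undirected F'"
    then obtain W W' where "out_tree r F W" "out_tree r F' W'"
      by (auto simp: solutions_def)
    then show "F = F'"
      using undirected_inj e by (metis order_refl subset_antisym)
  qed
  show "undirected ` solutions L r k {} = {T \<in> k_subtrees E k. r \<in> \<Union>T \<and> \<Union>T \<subseteq> U}"
  proof (intro equalityI subsetI)
    fix T assume "T \<in> undirected ` solutions L r k {}"
    then obtain F W where F: "T = undirected F" "out_tree r F W" "card W = k" "\<forall>(a, y)\<in>F. y \<in> L a"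
      by (auto simp: solutions_def)
    have W: "W \<subseteq> U" by (rule out_tree_closed[OF F(2)]) (use F assms in blast)+
    have UT: "\<Union>T = W" using out_tree_Union[OF F(2)] F assms by simp
    have "undirected F \<subseteq> E"
      using F(4) assms(3) W out_tree_arcs[OF F(2)] by (fastforce simp: undirected_def)
    with UT W F out_tree_k_subtree[OF F(2)] assms(1) out_tree_root[OF F(2)]
    show "T \<in> {T \<in> k_subtrees E k. r \<in> \<Union>T \<and> \<Union>T \<subseteq> U}"
      by (simp del: Union_iff)
  next
    fix T assume T: "T \<in> {T \<in> k_subtrees E k. r \<in> \<Union>T \<and> \<Union>T \<subseteq> U}"
    then obtain F where F: "out_tree r F (\<Union>T)" "undirected F = T"
      using k_subtree_out_tree[of T E k r] assms by auto
    have "y \<in> L a" if "(a, y) \<in> F" for a y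
    proof -
      have "{a, y} \<in> T" using that F(2) by (force simp: undirected_def)
      then have "{a, y} \<in> E" using T by (auto simp: k_subtrees_def)
      then show ?thesis using assms(3) out_tree_arcs[OF F(1)] that T by blast
    qed
    then have "F \<in> solutions L r k {}"
      using F T by (auto simp: solutions_def k_subtrees_def)
    with F show "T \<in> undirected ` solutions L r k {}" by blast
  qed
qed


section \<open>Depth-first search trees\<close>

text \<open>The list of \<open>finish_order\<close> is the reverse finishing order of a search that starts from the
  contracted set \<open>P\<close>. In the split of the finished vertices after \<open>z\<close>, the part \<open>Z\<close> consists of
  descendants of \<open>z\<close>, as do the vertices \<open>D\<close>, and \<open>Q\<close> of the vertices that were finished before
  \<open>z\<close> was discovered.\<close>

definition descendants_first ::
  "('a \<Rightarrow> 'a set) \<Rightarrow> ('a \<Rightarrow> 'a) \<Rightarrow> 'a set \<Rightarrow> 'a \<Rightarrow> 'a set \<Rightarrow> 'a list \<Rightarrow> bool" where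
  "descendants_first L par P z D zs \<longleftrightarrow>
     (\<exists>Z Q. zs = Z @ Q \<and> (\<forall>w\<in>set Q. L w \<subseteq> P \<union> set Q) \<and>
       (\<forall>y\<in>D \<union> set Z. par y \<in> insert z (D \<union> set Z)))"

fun finish_order :: "('a \<Rightarrow> 'a set) \<Rightarrow> ('a \<Rightarrow> 'a) \<Rightarrow> 'a set \<Rightarrow> 'a list \<Rightarrow> bool" where
  "finish_order L par P [] \<longleftrightarrow> True"
| "finish_order L par P (z # zs) \<longleftrightarrow> par z \<in> P \<and> z \<in> L (par z) \<and>
     descendants_first L par P z {} zs \<and> finish_order L par (insert z P) zs"

definition parent_arcs :: "('a \<Rightarrow> 'a) \<Rightarrow> 'a set \<Rightarrow> ('a \<times> 'a) set" where
  "parent_arcs par P = (\<lambda>x. (par x, x)) ` P"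

text \<open>If the processed vertices \<open>P\<close> have no arcs leaving \<open>P\<close> except tree arcs, then without the
  arc into \<open>z\<close> only \<open>P \<union> Q\<close> is reachable, which is too small.\<close>

lemma tree_arc_mandatory:
  assumes "finish_order L par P (z # zs)" "r \<in> P" "finite P" "card P + length zs < k"
    "\<And>a y. a \<in> P \<Longrightarrow> y \<in> L a \<Longrightarrow> y \<notin> P \<Longrightarrow> y \<in> set (z # zs) \<and> par y = a"
    "F \<in> solutions L r k F0" "z \<notin> P" "set zs \<inter> P = {}"
  shows "(par z, z) \<in> F"
proof (rule ccontr)
  assume nz: "(par z, z) \<notin> F"
  from assms(1) obtain Z Q where zq: "zs = Z @ Q" "\<forall>w\<in>set Q. L w \<subseteq> P \<union> set Q"
    "\<forall>y\<in>set Z. par y \<in> insert z (set Z)"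
    by (auto simp: descendants_first_def)
  from assms(6) obtain W where W: "out_tree r F W" "card W = k" "\<forall>(a, y)\<in>F. y \<in> L a"
    by (auto simp: solutions_def)
  have "W \<subseteq> P \<union> set Q"
  proof (rule out_tree_closed[OF W(1)])
    fix a y assume a: "a \<in> P \<union> set Q" "(a, y) \<in> F"
    then have y: "y \<in> L a" using W by blast
    show "y \<in> P \<union> set Q"
    proof (cases "a \<in> P \<and> y \<notin> P")
      case True
      with assms(5) y have "y \<in> set (z # zs)" "par y = a" by auto
      moreover have "y \<noteq> z" using nz a calculation by auto
      \<comment> \<open>A vertex of \<open>Z\<close> has its parent in
        \<open>insert z (set Z)\<close>, which is disjoint from \<open>P\<close>, whereas the parent
        of \<open>y\<close> is \<open>a\<close>, a member of \<open>P\<close>.\<close>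
      moreover have "y \<notin> set Z" using zq(1,3) assms(7,8) True calculation by auto
      ultimately show ?thesis using zq by auto
    qed (use zq(2) a y in auto)
  qed (use assms in auto)
  then have "k \<le> card (P \<union> set Q)"
    using W assms(3) by (metis card_mono finite_UnI finite_set)
  also have "\<dots> \<le> card P + length Q"
    using card_Un_le[of P "set Q"] card_length[of Q] by linarith
  finally show False using assms(4) zq by simp
qed

section \<open>Partial trees given by a vertex order and parents\<close>

lemma solutions_mandatory:
  "(\<And>F. F \<in> solutions L r k F0 \<Longrightarrow> f \<in> F) \<Longrightarrow> solutions L r k (insert f F0) = solutions L r k F0"
  unfolding solutions_def by blast

text \<open>The head of the list is the root and has no parent arc, hence \<open>tl\<close>. A list
  together with a parent array is the form in which the program stores the tree.\<close>

definition tree_arcs :: "('a \<Rightarrow> 'a) \<Rightarrow> 'a list \<Rightarrow> ('a \<times> 'a) set" where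
  "tree_arcs par xs = parent_arcs par (set (tl xs))"

lemma tree_arcs_snoc: "xs \<noteq> [] \<Longrightarrow> tree_arcs par (xs @ [y]) = insert (par y, y) (tree_arcs par xs)"
  by (simp add: tree_arcs_def parent_arcs_def)

lemma tree_arcs_cong: "(\<And>x. x \<in> set xs \<Longrightarrow> par x = par' x) \<Longrightarrow> tree_arcs par xs = tree_arcs par' xs"
  unfolding tree_arcs_def parent_arcs_def by (cases xs) (auto simp: image_iff)

definition partial_tree :: "('a \<Rightarrow> 'a set) \<Rightarrow> ('a \<Rightarrow> 'a) \<Rightarrow> 'a \<Rightarrow> 'a list \<Rightarrow> bool" where
  "partial_tree L par r xs \<longleftrightarrow> xs \<noteq> [] \<and> hd xs = r \<and> distinct xs \<and>
     out_tree r (tree_arcs par xs) (set xs) \<and> (\<forall>(a, y)\<in>tree_arcs par xs. y \<in> L a)"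

lemma partial_tree_snoc:
  assumes "partial_tree L par r xs" "par y \<in> set xs" "y \<notin> set xs" "y \<in> L (par y)"
  shows "partial_tree L par r (xs @ [y])"
  using assms out_tree.grow[of r "tree_arcs par xs" "set xs" "par y" y]
  by (auto simp: partial_tree_def tree_arcs_snoc)

lemma partial_tree_cong:
  "(\<And>x. x \<in> set xs \<Longrightarrow> par x = par' x) \<Longrightarrow> partial_tree L par r xs \<longleftrightarrow> partial_tree L par' r xs"
  unfolding partial_tree_def using tree_arcs_cong[of xs par par'] by simp

text \<open>\<open>finish_order\<close> places the parent of each vertex before the vertex, so the
  order can be cut anywhere and still gives a tree.\<close>

lemma partial_tree_take:
  assumes "partial_tree L par r xs" "finish_order L par (set xs) zs" "distinct (xs @ zs)"
  shows "partial_tree L par r (xs @ take j zs)"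
  using assms
proof (induction zs arbitrary: xs j)
  case (Cons z zs)
  have "partial_tree L par r (xs @ [z])"
    using Cons.prems by (intro partial_tree_snoc) auto
  from Cons.IH[OF this] Cons.prems show ?case by (cases j) auto
qed simp

lemma partial_tree_solution:
  assumes "partial_tree L par r (xs @ zs)" "length (xs @ zs) = k" "xs \<noteq> []"
  shows "tree_arcs par (xs @ zs) \<in> solutions L r k (tree_arcs par xs)"
  using assms distinct_card[of "xs @ zs"]
  by (auto simp: partial_tree_def solutions_def tree_arcs_def parent_arcs_def intro!: exI[of _ "set (xs @ zs)"])

text \<open>Every solution has \<open>k - 1\<close> arcs, and these are already used up by the
  partial tree.\<close>

lemma solutions_complete:
  assumes "partial_tree L par r xs" "length xs = k"
  shows "solutions L r k (tree_arcs par xs) = {tree_arcs par xs}"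
proof -
  have t: "out_tree r (tree_arcs par xs) (set xs)" "card (set xs) = k"
    using assms by (auto simp: partial_tree_def distinct_card)
  have "F = tree_arcs par xs" if F: "F \<in> solutions L r k (tree_arcs par xs)" for F
  proof -
    obtain W where W: "out_tree r F W" "card W = k" "tree_arcs par xs \<subseteq> F"
      using F by (auto simp: solutions_def)
    have "card F = card (tree_arcs par xs)"
      using out_tree_card[OF W(1)] out_tree_card[OF t(1)] t(2) W(2) by simp
    with W(3) out_tree_finite[OF W(1)] show ?thesis
      using card_subset_eq[of F "tree_arcs par xs"] by simp
  qed
  then show ?thesis
    using partial_tree_solution[of L par r xs "[]"] assms by (auto simp: partial_tree_def)
qed

text \<open>A tree containing \<open>xs\<close> with fewer than \<open>k\<close> vertices cannot be
  closed under \<open>L\<close>, so some arc leaves it and a leaf can be added. The induction runs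
  over the target size, since feasibility for a size implies it for all smaller ones.\<close>

lemma feasible_nonempty:
  assumes "partial_tree L par r xs" "feasible L (set xs) k" "length xs \<le> k"
  shows "solutions L r k (tree_arcs par xs) \<noteq> {}"
proof -
  have t: "out_tree r (tree_arcs par xs) (set xs)" "card (set xs) = length xs"
    "\<forall>(a, y)\<in>tree_arcs par xs. y \<in> L a"
    using assms by (auto simp: partial_tree_def distinct_card)
  have "\<exists>F W. out_tree r F W \<and> card W = k \<and> tree_arcs par xs \<subseteq> F \<and> set xs \<subseteq> W \<and> (\<forall>(a, y)\<in>F. y \<in> L a)"
    if "length xs \<le> k" "feasible L (set xs) k" for k
    using that
  proof (induction k rule: dec_induct)
    case base
    then show ?case using t by blast
  next
    case (step k)
    from step.prems have "feasible L (set xs) k"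
      unfolding feasible_def by (auto dest: Suc_leD)
    with step.IH obtain F W where F: "out_tree r F W" "card W = k" "tree_arcs par xs \<subseteq> F"
      "set xs \<subseteq> W" "\<forall>(a, y)\<in>F. y \<in> L a"
      by blast
    have "\<exists>a\<in>W. \<not> L a \<subseteq> W"
      using step.prems F(2,4) out_tree_finite[OF F(1)] unfolding feasible_def by force
    then obtain a y where ay: "a \<in> W" "y \<in> L a" "y \<notin> W" by blast
    then show ?case
      using out_tree.grow[OF F(1) ay(1,3)] F out_tree_finite[OF F(1)]
      by (intro exI[of _ "insert (a, y) F"] exI[of _ "insert y W"]) auto
  qed
  from this[OF assms(3,2)] show ?thesis
    unfolding solutions_def by blast
qed

text \<open>Two counters are needed because the scan restarts at the root: \<open>i\<close> vertices
  have been examined so far, while the partial tree consists of the first \<open>m\<close>, among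
  them those it had from the beginning.\<close>

definition scanned :: "('a \<Rightarrow> 'a set) \<Rightarrow> ('a \<Rightarrow> 'a) \<Rightarrow> 'a list \<Rightarrow> nat \<Rightarrow> nat \<Rightarrow> bool" where
  "scanned L par xs i m \<longleftrightarrow>
     (\<forall>j<i. \<forall>y\<in>L (xs ! j). y \<notin> set (take m xs) \<longrightarrow> y \<in> set xs \<and> par y = xs ! j)"

lemma scanned_mono: "scanned L par xs i m \<Longrightarrow> m \<le> m' \<Longrightarrow> scanned L par xs i m'"
  unfolding scanned_def using set_take_subset_set_take[of m m' xs] by blast

text \<open>Once the first \<open>m\<close> vertices are scanned, \<open>tree_arc_mandatory\<close>
  applies with them as \<open>P\<close>, so the next vertex of the search order joins the partial
  tree without losing a solution.\<close>

lemma forced_vertex: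
  assumes "finish_order L par (set (take m xs)) (drop m xs)" "scanned L par xs m m"
    "0 < m" "m < length xs" "length xs = k" "distinct xs" "hd xs = r"
  shows "solutions L r k (tree_arcs par (take (Suc m) xs)) = solutions L r k (tree_arcs par (take m xs))"
    and "finish_order L par (set (take (Suc m) xs)) (drop (Suc m) xs)"
proof -
  let ?P = "set (take m xs)" and ?z = "xs ! m" and ?zs = "drop (Suc m) xs"
  have dz: "drop m xs = ?z # ?zs" and tk: "take (Suc m) xs = take m xs @ [?z]"
    using assms(4) by (simp_all add: Cons_nth_drop_Suc take_Suc_conv_app_nth)
  have dj: "distinct (take m xs @ ?z # ?zs)"
    unfolding dz[symmetric] using assms(6) by simp
  have sx: "set xs = ?P \<union> set (?z # ?zs)"
    unfolding dz[symmetric] by (metis append_take_drop_id set_append)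
  have r: "r \<in> ?P"
    using assms(3,4,7) by (cases xs; cases m) auto
  have "(par ?z, ?z) \<in> F" if "F \<in> solutions L r k (tree_arcs par (take m xs))" for F
  proof (rule tree_arc_mandatory[OF assms(1)[unfolded dz] r _ _ _ that])
    \<comment> \<open>At most \<open>m\<close> vertices before and exactly \<open>k - m - 1\<close>
      after \<open>?z\<close>, which itself is not counted.\<close>
    show "card ?P + length ?zs < k"
      using assms(4,5) card_length[of "take m xs"] by simp
    show "y \<in> set (?z # ?zs) \<and> par y = a" if ay: "a \<in> ?P" "y \<in> L a" "y \<notin> ?P" for a y
    proof -
      obtain j where "j < m" "a = xs ! j"
        using ay(1) by (auto simp: in_set_conv_nth)
      then show ?thesis
        using assms(2) ay sx unfolding scanned_def by auto
    qed
  qed (use dj in auto)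
  from solutions_mandatory[OF this] show "solutions L r k (tree_arcs par (take (Suc m) xs)) =
      solutions L r k (tree_arcs par (take m xs))"
    unfolding tk using assms(3,4) by (subst tree_arcs_snoc) auto
  show "finish_order L par (set (take (Suc m) xs)) (drop (Suc m) xs)"
    using assms(1) unfolding dz tk by simp
qed

text \<open>Feasibility passes to the branch with the arc because the partial tree grows, and to the
  branch without it because the complete search tree avoids the arc and is still a solution
  there.\<close>

lemma branch_arc:
  assumes "partial_tree L par r xs" "length xs = k" "0 < m" "m < k" "i < m"
    "y \<in> L (xs ! i)" "y \<notin> set (take m xs)" "\<not> (y \<in> set xs \<and> par y = xs ! i)"
    "feasible L (set (take m xs)) k" "partial_tree L par r (take m xs)"
    "finite (solutions L r k (tree_arcs par (take m xs)))"
  defines "a \<equiv> xs ! i" and "ys \<equiv> take m xs"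
  defines "L' \<equiv> L(a := L a - {y})" and "par' \<equiv> par(y := a)"
  shows "partial_tree L par' r (ys @ [y])" "feasible L (set (ys @ [y])) k"
    "partial_tree L' par r ys" "feasible L' (set ys) k"
    "solutions L r k (tree_arcs par ys) =
       solutions L r k (tree_arcs par' (ys @ [y])) \<union> solutions L' r k (tree_arcs par ys)"
    "solutions L r k (tree_arcs par' (ys @ [y])) \<inter> solutions L' r k (tree_arcs par ys) = {}"
    "solutions L r k (tree_arcs par' (ys @ [y])) \<noteq> {}" "solutions L' r k (tree_arcs par ys) \<noteq> {}"
proof -
  have ne: "ys \<noteq> []" using assms(2,3,4) by (auto simp: ys_def)
  have a: "a \<in> set ys"
    using assms(2,4,5) nth_mem[of i "take m xs"] by (simp add: a_def ys_def)
  have y: "y \<notin> set ys" using assms(7) by (simp add: ys_def)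
  have ya: "y \<in> L a" using assms(6) by (simp add: a_def)
  have ta: "tree_arcs par ys \<subseteq> set ys \<times> set ys"
    using assms(10) out_tree_arcs[of r "tree_arcs par ys" "set ys"] unfolding partial_tree_def ys_def by simp
  \<comment> \<open>\<open>y\<close> may belong to the search tree under another parent, but it lies
    outside \<open>ys\<close>, so overwriting its parent leaves the partial tree intact.\<close>
  have pe: "par x = par' x" if "x \<in> set ys" for x
    using y that by (cases "x = y") (simp_all add: par'_def)
  have pt: "partial_tree L par' r ys"
    using assms(10) partial_tree_cong[of ys par par' L r] pe unfolding ys_def by simp
  show p1: "partial_tree L par' r (ys @ [y])"
    by (rule partial_tree_snoc[OF pt]) (simp_all add: par'_def a y ya)
  show f1: "feasible L (set (ys @ [y])) k"
    using assms(9) unfolding ys_def by (rule feasible_mono) auto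
  have t': "tree_arcs par' (ys @ [y]) = insert (a, y) (tree_arcs par ys)"
    using tree_arcs_snoc[OF ne, of par' y] tree_arcs_cong[of ys par par'] pe by (simp add: par'_def)
  have nin: "(a, y) \<notin> tree_arcs par ys" using ta y by blast
  have "z \<in> L' b" if bz: "(b, z) \<in> tree_arcs par ys" for b z
  proof -
    have "z \<in> L b"
      using assms(10) bz unfolding partial_tree_def ys_def by blast
    then show ?thesis
      using bz nin unfolding L'_def by (cases "b = a") auto
  qed
  then show p2: "partial_tree L' par r ys"
    using assms(10) unfolding partial_tree_def ys_def by blast
  have excl: "{F \<in> solutions L r k (tree_arcs par ys). (a, y) \<notin> F} = solutions L' r k (tree_arcs par ys)"
    using solutions_exclude[of a y "tree_arcs par ys" L r k] nin ya unfolding L'_def by simp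
  have "y \<in> set xs \<and> par y = a" if "(a, y) \<in> tree_arcs par xs"
    using that unfolding tree_arcs_def parent_arcs_def by (cases xs) auto
  then have "(a, y) \<notin> tree_arcs par xs"
    using assms(8) unfolding a_def by blast
  moreover have "tree_arcs par xs \<in> solutions L r k (tree_arcs par ys)"
    using partial_tree_solution[of L par r "take m xs" "drop m xs" k] assms(1,2) ne
    unfolding ys_def append_take_drop_id by blast
  ultimately have sol: "tree_arcs par xs \<in> solutions L' r k (tree_arcs par ys)"
    using excl by blast
  show "solutions L' r k (tree_arcs par ys) \<noteq> {}"
    using sol by blast
  have "r \<in> set ys" using p2 unfolding partial_tree_def by (metis hd_in_set)
  from feasible_solution[OF sol this] show "feasible L' (set ys) k" .
  show "solutions L r k (tree_arcs par ys) =
       solutions L r k (tree_arcs par' (ys @ [y])) \<union> solutions L' r k (tree_arcs par ys)"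
    "solutions L r k (tree_arcs par' (ys @ [y])) \<inter> solutions L' r k (tree_arcs par ys) = {}"
    unfolding t' excl[symmetric] solutions_include[symmetric] by auto
  show "solutions L r k (tree_arcs par' (ys @ [y])) \<noteq> {}"
    by (rule feasible_nonempty[OF p1 f1]) (use assms(2,4) in \<open>simp add: ys_def\<close>)
qed

text \<open>Generalizes \<open>finish_order\<close> to a search in progress: the stack is listed
  from bottom to top, and the stack vertices above \<open>z\<close> count among its descendants
  through the argument \<open>D\<close>. With an empty stack only \<open>finish_order\<close>
  remains.\<close>

fun stack_order :: "('a \<Rightarrow> 'a set) \<Rightarrow> ('a \<Rightarrow> 'a) \<Rightarrow> 'a set \<Rightarrow> 'a list \<Rightarrow> 'a list \<Rightarrow> bool" where
  "stack_order L par P [] fs \<longleftrightarrow> finish_order L par P fs"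
| "stack_order L par P (z # st) fs \<longleftrightarrow> par z \<in> P \<and> z \<in> L (par z) \<and>
     descendants_first L par P z (set st) fs \<and> stack_order L par (insert z P) st fs"

lemma finish_order_mono: "finish_order L par P zs \<Longrightarrow> P \<subseteq> P' \<Longrightarrow> finish_order L par P' zs"
proof (induction zs arbitrary: P P')
  case (Cons z zs)
  have "descendants_first L par P' z {} zs"
    using Cons.prems unfolding finish_order.simps descendants_first_def by blast
  then show ?case
    using Cons.IH[of "insert z P" "insert z P'"] Cons.prems by auto
qed simp

lemma finish_order_cong:
  "(\<And>z. z \<in> set zs \<Longrightarrow> par z = par' z) \<Longrightarrow> finish_order L par P zs \<longleftrightarrow> finish_order L par' P zs"
proof (induction zs arbitrary: P)
  case (Cons z zs)
  have "descendants_first L par P z {} zs \<longleftrightarrow> descendants_first L par' P z {} zs"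
    unfolding descendants_first_def using Cons.prems by (intro ex_cong1) auto
  moreover have "finish_order L par (insert z P) zs \<longleftrightarrow> finish_order L par' (insert z P) zs"
    using Cons by simp
  ultimately show ?case
    using Cons.prems[of z] by (simp only: finish_order.simps list.set_intros)
qed simp

text \<open>At its discovery \<open>y\<close> has no finished descendants, so its split is
  \<open>Z = []\<close> with all finished vertices in \<open>Q\<close>; by the second premise their
  arcs lead to visited vertices only. For the vertices below it on the stack, \<open>y\<close> joins
  \<open>D\<close>.\<close>

lemma stack_order_push:
  assumes "stack_order L par P st fs" "\<forall>w\<in>set fs. L w \<subseteq> P \<union> set st \<union> set fs"
    "x \<in> P \<union> set st" "st \<noteq> [] \<Longrightarrow> x = last st" "y \<notin> P \<union> set st \<union> set fs" "y \<in> L x"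
  shows "stack_order L (par(y := x)) P (st @ [y]) fs"
  using assms
proof (induction st arbitrary: P)
  case Nil
  have "finish_order L par (insert y P) fs"
    using Nil(1) finish_order_mono[of L par P fs "insert y P"] by auto
  moreover have "\<And>z. z \<in> set fs \<Longrightarrow> par z = (par(y := x)) z"
    using Nil(5) by auto
  ultimately have "finish_order L (par(y := x)) (insert y P) fs"
    using finish_order_cong[of fs par "par(y := x)" L] by blast
  moreover have "descendants_first L (par(y := x)) P y {} fs"
    using Nil(2) by (auto simp: descendants_first_def intro: exI[of _ "[]"])
  ultimately show ?case
    unfolding append.simps stack_order.simps list.set using Nil by (intro conjI) simp_all
next
  case (Cons z st)
  have x: "x \<in> insert z (set st)"
    using Cons.prems(4) by auto
  from Cons.prems(1) obtain Z Q where zq: "fs = Z @ Q" "\<forall>w\<in>set Q. L w \<subseteq> P \<union> set Q"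
    "\<forall>y\<in>set st \<union> set Z. par y \<in> insert z (set st \<union> set Z)"
    by (auto simp: descendants_first_def)
  have "descendants_first L (par(y := x)) P z (set (st @ [y])) fs"
    unfolding descendants_first_def
  proof (intro exI conjI)
    show "\<forall>y'\<in>set (st @ [y]) \<union> set Z. (par(y := x)) y' \<in> insert z (set (st @ [y]) \<union> set Z)"
      using zq(3) x by auto
  qed (use zq in auto)
  moreover have "stack_order L (par(y := x)) (insert z P) (st @ [y]) fs"
    using Cons.prems x by (intro Cons.IH) (auto split: if_splits)
  ultimately show ?case
    unfolding append.simps stack_order.simps using Cons.prems(1,5) by (intro conjI) auto
qed

text \<open>Finishing \<open>x\<close> moves it from \<open>D\<close> to the front of
  \<open>Z\<close> for all vertices below it, with \<open>Q\<close> unchanged.\<close>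

lemma stack_order_pop: "stack_order L par P (st @ [x]) fs \<Longrightarrow> stack_order L par P st (x # fs)"
proof (induction st arbitrary: P)
  case (Cons z st)
  from Cons.prems obtain Z Q where zq: "fs = Z @ Q" "\<forall>w\<in>set Q. L w \<subseteq> P \<union> set Q"
    "\<forall>y\<in>set (st @ [x]) \<union> set Z. par y \<in> insert z (set (st @ [x]) \<union> set Z)"
    by (auto simp: descendants_first_def)
  have "descendants_first L par P z (set st) (x # fs)"
    unfolding descendants_first_def
  proof (intro exI conjI)
    show "x # fs = (x # Z) @ Q" using zq by simp
    show "\<forall>y\<in>set st \<union> set (x # Z). par y \<in> insert z (set st \<union> set (x # Z))"
      using zq(3) by auto
  qed (use zq in auto)
  then show ?case
    using Cons by simp
qed simp

text \<open>The second arguments of the relation range over \<open>xs\<close> only, so changing the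
  scan position of the current vertex \<open>x\<close> does not disturb the chain of stack
  vertices.\<close>

lemma successively_cong_tail:
  "(\<And>y p. p \<in> set xs \<Longrightarrow> P y p \<longleftrightarrow> Q y p) \<Longrightarrow> successively P (x # xs) \<longleftrightarrow> successively Q (x # xs)"
  by (induction xs arbitrary: x) auto

text \<open>\<open>cap\<close> bounds the arcs among visited vertices. It is \<open>k^2\<close> for
  the searches of the enumeration and the number of all arcs for the search that orders the roots,
  so one analysis serves both.\<close>

locale dfs =
  fixes L :: "'a \<Rightarrow> 'a list" and V :: "'a set" and K cap :: nat and S :: "'a list" and par0 :: "'a \<Rightarrow> 'a"
  assumes V: "finite V" "set S \<subseteq> V" "\<And>u. u \<in> V \<Longrightarrow> set (L u) \<subseteq> V"
    and distinct: "distinct S" "\<And>u. u \<in> V \<Longrightarrow> distinct (L u)"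
    and length_S: "length S \<le> K"
    and cap: "\<And>U. U \<subseteq> V \<Longrightarrow> card U \<le> K \<Longrightarrow> card (SIGMA u:U. set (L u) \<inter> U) \<le> cap"
begin

text \<open>The search has exhausted the first \<open>i\<close> vertices of \<open>S\<close> and is at \<open>S ! i\<close>; the stack
  \<open>st\<close> has the current vertex in front, \<open>fs\<close> lists the finished vertices, latest first, and the first
  \<open>c u\<close> neighbours of each \<open>u\<close> have been scanned. Once \<open>K\<close> vertices are visited, stack vertices
  may be finished without having been scanned completely.\<close>

definition inv where
  "inv i st fs par c \<longleftrightarrow> distinct (S @ st @ fs) \<and> length (S @ st @ fs) \<le> K \<and> set (S @ st @ fs) \<subseteq> V \<and>
     i \<le> length S \<and> (i = length S \<longrightarrow> st = []) \<and>
     stack_order (\<lambda>u. set (L u)) par (set S) (rev st) fs \<and>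
     (\<forall>u. c u \<le> length (L u) \<and> set (take (c u) (L u)) \<subseteq> set (S @ st @ fs)) \<and>
     (\<forall>u. u \<notin> set (S @ st @ fs) \<longrightarrow> c u = 0) \<and>
     (\<forall>j. i < j \<longrightarrow> j < length S \<longrightarrow> c (S ! j) = 0) \<and>
     (i < length S \<longrightarrow>
        successively (\<lambda>y p. par y = p \<and> 0 < c p \<and> L p ! (c p - 1) = y) (st @ [S ! i])) \<and>
     (length (S @ st @ fs) < K \<longrightarrow> (\<forall>w\<in>set fs \<union> set (take i S). c w = length (L w))) \<and>
     (\<forall>u\<in>set S. par u = par0 u)"

lemma invI:
  assumes "distinct (S @ st @ fs)" "length (S @ st @ fs) \<le> K" "set (S @ st @ fs) \<subseteq> V"
     "i \<le> length S" "i = length S \<Longrightarrow> st = []"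
     "stack_order (\<lambda>u. set (L u)) par (set S) (rev st) fs"
     "\<And>u. c u \<le> length (L u)" "\<And>u. set (take (c u) (L u)) \<subseteq> set (S @ st @ fs)"
     "\<And>u. u \<notin> set (S @ st @ fs) \<Longrightarrow> c u = 0"
     "\<And>j. i < j \<Longrightarrow> j < length S \<Longrightarrow> c (S ! j) = 0"
     "i < length S \<Longrightarrow>
        successively (\<lambda>y p. par y = p \<and> 0 < c p \<and> L p ! (c p - 1) = y) (st @ [S ! i])"
     "\<And>w. length (S @ st @ fs) < K \<Longrightarrow> w \<in> set fs \<union> set (take i S) \<Longrightarrow> c w = length (L w)"
     "\<And>u. u \<in> set S \<Longrightarrow> par u = par0 u"
  shows "inv i st fs par c"
  unfolding inv_def using assms by blast

lemma invD:
  assumes "inv i st fs par c"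
  shows "distinct (S @ st @ fs)" "length (S @ st @ fs) \<le> K" "set (S @ st @ fs) \<subseteq> V"
     "i \<le> length S" "i = length S \<Longrightarrow> st = []"
     "stack_order (\<lambda>u. set (L u)) par (set S) (rev st) fs"
     "c u \<le> length (L u)" "set (take (c u) (L u)) \<subseteq> set (S @ st @ fs)"
     "u \<notin> set (S @ st @ fs) \<Longrightarrow> c u = 0"
     "i < j \<Longrightarrow> j < length S \<Longrightarrow> c (S ! j) = 0"
     "i < length S \<Longrightarrow>
        successively (\<lambda>y p. par y = p \<and> 0 < c p \<and> L p ! (c p - 1) = y) (st @ [S ! i])"
     "length (S @ st @ fs) < K \<Longrightarrow> w \<in> set fs \<union> set (take i S) \<Longrightarrow> c w = length (L w)"
     "u \<in> set S \<Longrightarrow> par u = par0 u"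
  using assms unfolding inv_def by blast+

text \<open>Drops in every iteration: scanning an arc takes one unit from the last summand, a
  discovery in addition trades two units for one on the stack, finishing a vertex or advancing in
  \<open>S\<close> takes one. It starts at no more than \<open>3 * K + cap\<close>.\<close>

definition potential where
  "potential i st fs c = 2 * (K - length (S @ st @ fs)) + length st + (length S - i) +
     (cap - sum c (set (S @ st @ fs)))"

lemma inv_init: "S \<noteq> [] \<Longrightarrow> inv 0 [] [] par0 (\<lambda>_. 0)"
  using V distinct length_S by (simp add: inv_def)

text \<open>The scanned part of each list is duplicate-free and leads to visited vertices, so
  \<open>c\<close> counts distinct arcs among them. Thus the last subtraction in
  \<open>potential\<close> is not truncated.\<close>

lemma sum_le_cap:
  assumes "inv i st fs par c"
  shows "sum c (set (S @ st @ fs)) \<le> cap"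
proof -
  let ?U = "set (S @ st @ fs)"
  have d: "distinct (S @ st @ fs)" and l: "length (S @ st @ fs) \<le> K" and UV: "?U \<subseteq> V"
    and c: "\<And>u. c u \<le> length (L u) \<and> set (take (c u) (L u)) \<subseteq> ?U"
    using assms unfolding inv_def by blast+
  have "sum c ?U = (\<Sum>u\<in>?U. card (set (take (c u) (L u))))"
  proof (rule sum.cong)
    fix u assume "u \<in> ?U"
    then have "distinct (take (c u) (L u))"
      using distinct(2) UV by (intro distinct_take) blast
    from distinct_card[OF this] c[of u] show "c u = card (set (take (c u) (L u)))"
      by simp
  qed simp
  also have "\<dots> = card (SIGMA u:?U. set (take (c u) (L u)))"
    by (intro card_SigmaI[symmetric]) auto
  also have "\<dots> \<le> card (SIGMA u:?U. set (L u) \<inter> ?U)"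
    using c by (intro card_mono Sigma_mono) (auto dest: in_set_takeD)
  also have "\<dots> \<le> cap"
    using cap[OF UV] d l by (metis distinct_card)
  finally show ?thesis .
qed

lemma inv_top:
  assumes "inv i st fs par c" "i < length S"
  shows "hd (st @ [S ! i]) \<in> set (S @ st)" "hd (st @ [S ! i]) \<in> V"
    "hd (st @ [S ! i]) \<notin> set fs \<union> set (take i S)"
    "i < j \<Longrightarrow> j < length S \<Longrightarrow> S ! j \<noteq> hd (st @ [S ! i])"
    "st = y # st' \<Longrightarrow> p \<in> set (st' @ [S ! i]) \<Longrightarrow> p \<noteq> y"
proof -
  note d = invD(1)[OF assms(1)]
  have i: "S ! i \<in> set S" "S ! i \<notin> set (take i S)"
    using assms(2) d by (auto simp: in_set_conv_nth nth_eq_iff_index_eq)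
  show "hd (st @ [S ! i]) \<in> set (S @ st)"
    using i by (cases st) auto
  with invD(3)[OF assms(1)] show "hd (st @ [S ! i]) \<in> V" by auto
  show "hd (st @ [S ! i]) \<notin> set fs \<union> set (take i S)"
    using i d by (cases st) (auto dest: in_set_takeD)
  show "S ! j \<noteq> hd (st @ [S ! i])" if "i < j" "j < length S"
  proof -
    have "S ! j \<in> set S" "S ! j \<noteq> S ! i"
      using that d assms(2) by (auto simp: nth_eq_iff_index_eq)
    then show ?thesis using d by (cases st) auto
  qed
  show "st = y # st' \<Longrightarrow> p \<in> set (st' @ [S ! i]) \<Longrightarrow> p \<noteq> y"
    using d i by auto
qed

lemma inv_scan:
  assumes inv: "inv i st fs par c" and i: "i < length S" and x: "x = hd (st @ [S ! i])"
    and c: "c x < length (L x)" "L x ! c x \<in> set (S @ st @ fs)"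
  defines "c' \<equiv> c(x := Suc (c x))"
  shows "inv i st fs par c'" "potential i st fs c' < potential i st fs c"
proof -
  note d = invD[OF inv] and t = inv_top[OF inv i, folded x]
  have tk: "take (Suc (c x)) (L x) = take (c x) (L x) @ [L x ! c x]"
    using c(1) by (rule take_Suc_conv_app_nth)
  show inv': "inv i st fs par c'"
  proof (rule invI)
    show "c' u \<le> length (L u)" for u
      using d(7) c(1) by (auto simp: c'_def)
    show "set (take (c' u) (L u)) \<subseteq> set (S @ st @ fs)" for u
      using d(8)[of u] c(2) tk by (auto simp: c'_def)
    show "c' u = 0" if "u \<notin> set (S @ st @ fs)" for u
      using d(9)[OF that] t(1) that by (auto simp: c'_def)
    show "c' (S ! j) = 0" if "i < j" "j < length S" for j
      using d(10)[OF that] t(4)[OF that] by (auto simp: c'_def)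
    show "successively (\<lambda>y p. par y = p \<and> 0 < c' p \<and> L p ! (c' p - 1) = y) (st @ [S ! i])"
    proof (cases st)
      case (Cons y st')
      have "y = x" using x Cons by simp
      then show ?thesis
        using d(11)[OF i] t(5)[OF Cons] unfolding Cons append.simps
        by (subst successively_cong_tail) (auto simp: c'_def)
    qed simp
    show "c' w = length (L w)" if "length (S @ st @ fs) < K" "w \<in> set fs \<union> set (take i S)" for w
      using d(12)[OF that] t(3) that(2) by (auto simp: c'_def)
  qed (use d in blast)+
  have "sum c' (set (S @ st @ fs)) = Suc (sum c (set (S @ st @ fs)))"
  proof -
    have x: "x \<in> set (S @ st @ fs)" using t(1) by auto
    show ?thesis
      unfolding sum.remove[OF finite_set x] by (simp add: c'_def)
  qed
  then show "potential i st fs c' < potential i st fs c"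
    using sum_le_cap[OF inv'] unfolding potential_def by simp
qed

lemma inv_discover:
  assumes inv: "inv i st fs par c" and i: "i < length S" and x: "x = hd (st @ [S ! i])"
    and c: "c x < length (L x)" "y = L x ! c x" "y \<notin> set (S @ st @ fs)"
    and less: "length (S @ st @ fs) < K"
  defines "c' \<equiv> c(x := Suc (c x))"
  shows "inv i (y # st) fs (par(y := x)) c'" "potential i (y # st) fs c' < potential i st fs c"
proof -
  note d = invD[OF inv] and t = inv_top[OF inv i, folded x]
  have tk: "take (Suc (c x)) (L x) = take (c x) (L x) @ [L x ! c x]"
    using c(1) by (rule take_Suc_conv_app_nth)
  have yL: "y \<in> set (L x)" using c by simp
  have xy: "x \<noteq> y" using t(1) c(3) by auto
  show inv': "inv i (y # st) fs (par(y := x)) c'"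
  proof (rule invI)
    show "distinct (S @ (y # st) @ fs)" using d(1) c(3) by auto
    show "length (S @ (y # st) @ fs) \<le> K" using less by simp
    show "set (S @ (y # st) @ fs) \<subseteq> V" using d(3) yL V(3)[OF t(2)] by auto
    show "i = length S \<Longrightarrow> y # st = []" using i by simp
    \<comment> \<open>As fewer than \<open>K\<close> vertices are visited, the finished ones have
      been scanned completely.\<close>
    have "\<forall>w\<in>set fs. set (L w) \<subseteq> set S \<union> set (rev st) \<union> set fs"
    proof
      fix w assume "w \<in> set fs"
      then have "take (c w) (L w) = L w" using d(12)[OF less, of w] by simp
      with d(8)[of w] show "set (L w) \<subseteq> set S \<union> set (rev st) \<union> set fs" by auto
    qed
    moreover have "rev st \<noteq> [] \<Longrightarrow> x = last (rev st)"
      using x by (cases st) auto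
    ultimately have "stack_order (\<lambda>u. set (L u)) (par(y := x)) (set S) (rev st @ [y]) fs"
      using d(6) t(1) c(3) yL by (intro stack_order_push) auto
    then show "stack_order (\<lambda>u. set (L u)) (par(y := x)) (set S) (rev (y # st)) fs"
      by simp
    show "c' u \<le> length (L u)" for u
      using d(7) c(1) by (auto simp: c'_def)
    show "set (take (c' u) (L u)) \<subseteq> set (S @ (y # st) @ fs)" for u
      using d(8)[of u] c(2) tk by (auto simp: c'_def)
    show "c' u = 0" if "u \<notin> set (S @ (y # st) @ fs)" for u
      using d(9)[of u] t(1) that by (auto simp: c'_def)
    show "c' (S ! j) = 0" if "i < j" "j < length S" for j
      using d(10)[OF that] t(4)[OF that] by (auto simp: c'_def)
    have s: "successively (\<lambda>z p. (par(y := x)) z = p \<and> 0 < c' p \<and> L p ! (c' p - 1) = z) (st @ [S ! i])"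
    proof -
      have "successively (\<lambda>z p. par z = p \<and> 0 < c' p \<and> L p ! (c' p - 1) = z) (st @ [S ! i])"
      proof (cases st)
        case (Cons z st')
        have "z = x" using x Cons by simp
        then show ?thesis
          using d(11)[OF i] t(5)[OF Cons] unfolding Cons append.simps
          by (subst successively_cong_tail) (auto simp: c'_def)
      qed simp
      then show ?thesis
        by (rule successively_mono) (use c(3) i in auto)
    qed
    show "successively (\<lambda>z p. (par(y := x)) z = p \<and> 0 < c' p \<and> L p ! (c' p - 1) = z) ((y # st) @ [S ! i])"
      unfolding append.simps successively_Cons using s x c(2) by (auto simp: c'_def)
    show "c' w = length (L w)" if "length (S @ (y # st) @ fs) < K" "w \<in> set fs \<union> set (take i S)" for w
      using d(12)[OF less that(2)] t(3) that(2) by (auto simp: c'_def)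
    show "(par(y := x)) u = par0 u" if "u \<in> set S" for u
      using d(13)[OF that] c(3) that by auto
  qed (use d in blast)+
  have "sum c' (set (S @ (y # st) @ fs)) = Suc (sum c (set (S @ st @ fs)))"
  proof -
    have xs: "x \<in> set (S @ st @ fs)" using t(1) by auto
    have "set (S @ (y # st) @ fs) = insert y (set (S @ st @ fs))" by auto
    moreover have "c' y = 0" using d(9)[OF c(3)] xy by (simp add: c'_def)
    ultimately have "sum c' (set (S @ (y # st) @ fs)) = sum c' (set (S @ st @ fs))"
      using c(3) by (simp del: set_append)
    also have "\<dots> = Suc (sum c (set (S @ st @ fs)))"
      unfolding sum.remove[OF finite_set xs] by (simp add: c'_def)
    finally show ?thesis .
  qed
  then show "potential i (y # st) fs c' < potential i st fs c"
    using sum_le_cap[OF inv'] less unfolding potential_def by simp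
qed

lemma inv_finish:
  assumes inv: "inv i (x # st) fs par c" and i: "i < length S"
    and c: "length (S @ (x # st) @ fs) = K \<or> c x = length (L x)"
  shows "inv i st (x # fs) par c" "potential i st (x # fs) c < potential i (x # st) fs c"
proof -
  note d = invD[OF inv]
  have e: "set (S @ st @ x # fs) = set (S @ (x # st) @ fs)" by auto
  show "inv i st (x # fs) par c"
  proof (rule invI)
    show "stack_order (\<lambda>u. set (L u)) par (set S) (rev st) (x # fs)"
      using d(6) by (auto intro: stack_order_pop)
    show "successively (\<lambda>y p. par y = p \<and> 0 < c p \<and> L p ! (c p - 1) = y) (st @ [S ! i])"
      using d(11)[OF i] by (simp add: successively_Cons)
    show "c w = length (L w)" if "length (S @ st @ x # fs) < K" "w \<in> set (x # fs) \<union> set (take i S)" for w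
      using d(12)[of w] c that by auto
    show "distinct (S @ st @ x # fs)" "length (S @ st @ x # fs) \<le> K"
      using d(1,2) by auto
  qed (use d i e in auto)
  show "potential i st (x # fs) c < potential i (x # st) fs c"
    unfolding potential_def e by simp
qed

lemma inv_next:
  assumes inv: "inv i [] fs par c" and i: "i < length S"
    and c: "length (S @ fs) = K \<or> c (S ! i) = length (L (S ! i))"
  shows "inv (Suc i) [] fs par c" "potential (Suc i) [] fs c < potential i [] fs c"
proof -
  note d = invD[OF inv]
  show "inv (Suc i) [] fs par c"
  proof (rule invI)
    show "c w = length (L w)" if "length (S @ [] @ fs) < K" "w \<in> set fs \<union> set (take (Suc i) S)" for w
      using d(12)[of w] c that i by (auto simp: take_Suc_conv_app_nth)
  qed (use d i in auto)
  show "potential (Suc i) [] fs c < potential i [] fs c"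
    unfolding potential_def using i by simp
qed

text \<open>If the search ended with fewer than \<open>K\<close> vertices, all of them would have
  been scanned completely; the visited set would then be closed and too small for
  \<open>feasible\<close>.\<close>

lemma inv_complete:
  assumes inv: "inv (length S) st fs par c" and "feasible (\<lambda>u. set (L u)) (set S) K"
  shows "st = []" "length (S @ fs) = K" "finish_order (\<lambda>u. set (L u)) par (set S) fs"
proof -
  note d = invD[OF inv]
  show st: "st = []" using d(5) by simp
  show "finish_order (\<lambda>u. set (L u)) par (set S) fs" using d(6) st by simp
  show "length (S @ fs) = K"
  proof (rule ccontr)
    assume "length (S @ fs) \<noteq> K"
    then have less: "length (S @ st @ fs) < K" using d(2) st by simp
    have "\<forall>w\<in>set (S @ fs). set (L w) \<subseteq> set (S @ fs)"
    proof
      fix w assume "w \<in> set (S @ fs)"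
      then have "c w = length (L w)" using d(12)[OF less, of w] by auto
      with d(8)[of w] st show "set (L w) \<subseteq> set (S @ fs)" by simp
    qed
    then have "K \<le> card (set (S @ fs))"
      using assms(2) unfolding feasible_def by simp
    then show False using less st d(1) distinct_card[of "S @ fs"] by simp
  qed
qed

end

section \<open>The program\<close>

text \<open>Registers: 0 holds \<open>n\<close>, 1 holds \<open>k\<close>, 2 to 4 hold the constants 0, 1, 2, and 18 the number of
  vertices a search has to visit. Arrays: 0 and 1 are the successor and predecessor links of the
  circular adjacency lists, in which \<open>n\<close> serves as the sentinel; 2 holds visit marks (2 for vertices of the
  partial tree, 1 for other visited ones), 3 parents, 4 the vertex order, whose first \<open>R[15]\<close> entries
  are the partial tree, 5 the order of the roots, and 6 to 8 the backtracking stack.\<close>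

definition build_lists :: com where
  "build_lists = Cst 5 0 ;; Loop (Lt 5 0)
     (LdIn 6 5 ;; Mov 9 5 ;; Inc 9 ;; LdIn 7 9 ;; Mov 9 0 ;;
      Loop (Lt 6 7) (LdIn 8 6 ;; St 0 5 9 8 ;; St 1 5 8 9 ;; Mov 9 8 ;; Inc 6) ;;
      St 0 5 9 0 ;; St 1 5 0 9 ;; Inc 5)"

definition mark :: com where
  "mark = Cst 12 0 ;; Loop (Lt 12 15) (Ld 10 4 12 2 ;; St 2 10 2 4 ;; Inc 12)"

text \<open>Mark 2 on the current vertex means that the stack is empty. The stack itself is implicit
  in the parents. Finished vertices are written downwards from position \<open>R[18]\<close>, so
  that they appear behind the partial tree with the latest first.\<close>

definition finish :: com where
  "finish = Ld 16 2 10 2 ;; Cond (Eq 16 4)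
     (Inc 12 ;; Cond (Lt 12 15) (Ld 10 4 12 2 ;; Ld 11 0 10 0) Skip)
     (Dec 13 ;; St 4 13 2 10 ;; Ld 17 3 10 2 ;; Ld 11 0 17 10 ;; Mov 10 17)"

definition advance :: com where
  "advance = Ld 16 2 11 2 ;; Cond (Eq 16 2)
     (St 2 11 2 3 ;; St 3 11 2 10 ;; Inc 14 ;; Mov 10 11 ;; Ld 11 0 10 0)
     (Ld 11 0 10 11)"

text \<open>When the required number of vertices is reached, only \<open>finish\<close> is executed,
  which unwinds the stack.\<close>

definition search :: com where
  "search = mark ;; Mov 14 15 ;; Mov 13 18 ;; Cst 12 0 ;; Ld 10 4 2 2 ;; Ld 11 0 10 0 ;;
     Loop (Lt 12 15) (Cond (Lt 14 18) (Cond (Lt 11 0) advance finish) finish)"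

definition next_arc :: com where
  "next_arc = Ld 11 0 10 11"

text \<open>Moving the sentinel to register 11 and zero to register 19 ends both loops of
  \<open>scan\<close>.\<close>

definition found :: com where
  "found = Cst 20 1 ;; Mov 21 10 ;; Mov 22 11 ;; Mov 19 2 ;; Mov 11 0"

text \<open>A head that the search reached through another parent yields a branching arc just like
  an unvisited head.\<close>

definition test_arc :: com where
  "test_arc = Ld 16 2 11 2 ;; Cond (Eq 16 4) next_arc
     (Cond (Eq 16 3) (Ld 17 3 11 2 ;; Cond (Eq 17 10) next_arc found) found)"

definition scan :: com where
  "scan = Cst 20 0 ;; Cst 12 0 ;; Mov 19 1 ;; Loop (Lt 12 19)
     (Ld 10 4 12 2 ;; Cond (Lt 12 15) Skip (St 2 10 2 4 ;; Inc 15) ;;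
      Cond (Lt 15 1) (Ld 11 0 10 0 ;; Loop (Lt 11 0) test_arc) Skip ;; Inc 12)"

definition clear :: com where
  "clear = Cst 12 0 ;; Loop (Lt 12 18) (Ld 10 4 12 2 ;; St 2 10 2 2 ;; Inc 12)"

definition print_tree :: com where
  "print_tree = Cst 12 1 ;;
     Loop (Lt 12 1) (Ld 10 4 12 2 ;; Ld 17 3 10 2 ;; Emit 17 ;; Emit 10 ;; Inc 12)"

definition remove :: com where
  "remove = Ld 30 1 21 22 ;; Ld 31 0 21 22 ;; St 0 21 30 31 ;; St 1 21 31 30"

text \<open>Removal leaves the links stored at the removed entry intact, and they tell where to
  reinsert it (dancing links). This requires that removals are undone in reverse order.\<close>

definition restore :: com where
  "restore = Ld 30 1 21 22 ;; Ld 31 0 21 22 ;; St 0 21 30 22 ;; St 1 21 31 22"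

definition node :: com where
  "node = search ;; scan ;; clear ;; Cond (Eq 20 3)
     (St 6 23 2 15 ;; St 7 23 2 21 ;; St 8 23 2 22 ;; Inc 23 ;;
      St 4 15 2 22 ;; St 3 22 2 21 ;; Inc 15)
     (print_tree ;; Cst 24 0)"

text \<open>The entry in array 6 is the length of the partial tree while the branch with the arc is
  explored, and 0 during the branch without it; the length itself is never 0.\<close>

definition backtrack :: com where
  "backtrack = Cond (Eq 23 2) (Cst 25 0)
     (Dec 23 ;; Ld 16 6 23 2 ;; Ld 21 7 23 2 ;; Ld 22 8 23 2 ;;
      Cond (Eq 16 2) restore (St 6 23 2 2 ;; Inc 23 ;; Mov 15 16 ;; remove ;; Cst 24 1))"

text \<open>Register 24 selects between entering a node and backtracking; register 25 stays 1 until
  the stack is exhausted.\<close>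

definition enumerate_root :: com where
  "enumerate_root = Cst 23 0 ;; Cst 24 1 ;; Cst 25 1 ;;
     Loop (Lt 2 25) (Cond (Eq 24 3) node backtrack)"

text \<open>Only the arcs into the root are removed. Its own list is traversed meanwhile, and
  without incoming arcs the root is out of reach of later searches.\<close>

definition delete_root :: com where
  "delete_root = Ld 22 5 26 2 ;; Ld 21 0 22 0 ;; Loop (Lt 21 0) (remove ;; Ld 21 0 22 21)"

definition order_roots :: com where
  "order_roots = Mov 18 0 ;; St 4 2 2 2 ;; Cst 15 1 ;; search ;;
     (Cst 12 0 ;; Loop (Lt 12 0) (Ld 10 4 12 2 ;; St 5 12 2 10 ;; Inc 12)) ;; clear"

text \<open>Register 27 is \<open>k - 1\<close>: when only that many vertices are left, no
  \<open>k\<close>-subtree fits among them.\<close>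

definition all_roots :: com where
  "all_roots = Mov 18 1 ;; Mov 27 1 ;; Dec 27 ;; Mov 26 0 ;; Loop (Lt 27 26)
     (Dec 26 ;; Ld 10 5 26 2 ;; St 4 2 2 10 ;; Cst 15 1 ;; enumerate_root ;; delete_root)"

definition list_subtrees :: com where
  "list_subtrees = Cst 3 1 ;; Cst 4 2 ;; build_lists ;; order_roots ;; all_roots"


section \<open>Linked adjacency lists\<close>

fun linked :: "nat \<Rightarrow> arrays \<Rightarrow> nat \<Rightarrow> nat \<Rightarrow> nat list \<Rightarrow> bool" where
  "linked n A u p [] \<longleftrightarrow> A (0, u, p) = n \<and> A (1, u, n) = p"
| "linked n A u p (x # xs) \<longleftrightarrow> A (0, u, p) = x \<and> A (1, u, x) = p \<and> linked n A u x xs"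

lemma linked_first: "linked n A u p xs \<Longrightarrow> A (0, u, p) = (xs @ [n]) ! 0"
  by (cases xs) auto

lemma linked_next: "linked n A u p xs \<Longrightarrow> i < length xs \<Longrightarrow> A (0, u, xs ! i) = (xs @ [n]) ! Suc i"
  by (induction xs arbitrary: p i) (auto simp: nth_Cons' linked_first)

lemma linked_cong:
  "(\<And>v. v \<in> insert p (set xs) \<Longrightarrow> A (0, u, v) = A' (0, u, v)) \<Longrightarrow>
   (\<And>v. v \<in> insert n (set xs) \<Longrightarrow> A (1, u, v) = A' (1, u, v)) \<Longrightarrow>
   linked n A u p xs \<longleftrightarrow> linked n A' u p xs"
  by (induction xs arbitrary: p) auto

text \<open>Addresses of list cells are spread over all vertex pairs, but only those of edges and of
  the sentinel are ever touched. Space counts touched cells, so it stays linear in the number of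
  edges.\<close>

definition cells :: "nat \<Rightarrow> nat \<Rightarrow> nat set set \<Rightarrow> (nat \<times> nat \<times> nat) set" where
  "cells n D E = {(j, u, v). j < 2 \<and> u < n \<and> (v = n \<or> {u, v} \<in> E) \<or>
     2 \<le> j \<and> j \<le> 5 \<and> u < n \<and> v = 0 \<or> 6 \<le> j \<and> j \<le> 8 \<and> u \<le> D \<and> v = 0}"

lemma mem_cells:
  "(j, u, v) \<in> cells n D E \<longleftrightarrow> j < 2 \<and> u < n \<and> (v = n \<or> {u, v} \<in> E) \<or>
     2 \<le> j \<and> j \<le> 5 \<and> u < n \<and> v = 0 \<or> 6 \<le> j \<and> j \<le> 8 \<and> u \<le> D \<and> v = 0"
  by (simp add: cells_def)

locale enumeration = machine inp N "cells n D E" B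
  for inp N n D E B +
  assumes edges: "\<And>u v. {u, v} \<in> E \<Longrightarrow> u < n \<and> v < n \<and> u \<noteq> v"
    and B: "n + D + 5 < B"
begin

definition constants :: "(nat \<Rightarrow> nat) \<Rightarrow> bool" where
  "constants R \<longleftrightarrow> R 0 = n \<and> R 2 = 0 \<and> R 3 = 1 \<and> R 4 = 2"

lemma constantsD: "constants R \<Longrightarrow> R 0 = n \<and> R 2 = 0 \<and> R 3 = 1 \<and> R 4 = 2"
  by (simp add: constants_def)

definition represents :: "arrays \<Rightarrow> (nat \<Rightarrow> nat list) \<Rightarrow> bool" where
  "represents A L \<longleftrightarrow> (\<forall>u<n. linked n A u n (L u) \<and> distinct (L u) \<and> set (L u) \<subseteq> {v. {u, v} \<in> E})"

abbreviation parent :: "arrays \<Rightarrow> nat \<Rightarrow> nat" where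
  "parent A u \<equiv> A (3, u, 0)"

lemma unchangedD:
  assumes "unchanged c R A Z R' A' Z'"
  shows "r \<notin> writes c \<Longrightarrow> R' r = R r" "j \<notin> stores c \<Longrightarrow> A' (j, u, v) = A (j, u, v)"
    "\<not> emits c \<Longrightarrow> Z' = Z"
  using assms by (auto simp: unchanged_def)

lemma represents_cong:
  assumes "\<And>u v. A' (0, u, v) = A (0, u, v)" "\<And>u v. A' (Suc 0, u, v) = A (Suc 0, u, v)"
  shows "represents A' L \<longleftrightarrow> represents A L"
proof -
  have "linked n A' u n xs \<longleftrightarrow> linked n A u n xs" for u xs
    using assms by (intro linked_cong) simp_all
  then show ?thesis by (simp add: represents_def)
qed

text \<open>List pointers are described by positions in \<open>L u @ [n]\<close>, so that the end of
  a list and the sentinel need no separate treatment.\<close>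

lemma representsD:
  assumes "represents A L" "u < n"
  shows "linked n A u n (L u)" "distinct (L u)" "v \<in> set (L u) \<Longrightarrow> {u, v} \<in> E"
    "v \<in> set (L u) \<Longrightarrow> v < n" "i < length (L u) \<Longrightarrow> L u ! i < n"
    "A (0, u, n) = (L u @ [n]) ! 0"
    "i < length (L u) \<Longrightarrow> A (0, u, L u ! i) = (L u @ [n]) ! Suc i"
    "i < length (L u) \<Longrightarrow> {u, L u ! i} \<in> E"
proof -
  show l: "linked n A u n (L u)" and "distinct (L u)"
    using assms by (auto simp: represents_def)
  have e: "{u, v} \<in> E" if "v \<in> set (L u)" for v
    using assms that by (auto simp: represents_def)
  then show "v \<in> set (L u) \<Longrightarrow> {u, v} \<in> E" by simp
  show "v \<in> set (L u) \<Longrightarrow> v < n" using e edges by blast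
  show "i < length (L u) \<Longrightarrow> L u ! i < n" using e edges nth_mem by blast
  show "i < length (L u) \<Longrightarrow> {u, L u ! i} \<in> E" using e by simp
  show "A (0, u, n) = (L u @ [n]) ! 0" "i < length (L u) \<Longrightarrow> A (0, u, L u ! i) = (L u @ [n]) ! Suc i"
    using linked_first[OF l] linked_next[OF l] by auto
qed

section \<open>The depth-first search on the machine\<close>

lemma wp_mark:
  assumes "constants R" "R 15 = length S" "\<forall>i<length S. A (4, i, 0) = S ! i" "set S \<subseteq> {..<n}"
    "distinct S" "\<forall>v<n. A (2, v, 0) = 0"
  shows "wp mark (\<lambda>R' A' Z' t'. (\<forall>v<n. A' (2, v, 0) = (if v \<in> set S then 2 else 0)) \<and>
     t' \<le> t + 4 * length S + 2) R A Z t"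
proof -
  have len: "length S \<le> n"
    using card_mono[OF _ assms(4)] distinct_card[OF assms(5)] by simp
  let ?I = "\<lambda>p R A Z t'. \<exists>i\<le>length S. p = length S - i \<and> R 12 = i \<and> t' + 4 * p \<le> t + 4 * length S + 1 \<and>
    (\<forall>v<n. A (2, v, 0) = (if v \<in> set (take i S) then 2 else 0))"
  show ?thesis
    unfolding mark_def wp_simps
  proof (rule conjI, use B in simp, rule wp_Loop[where I = ?I and i = "length S"])
    show "?I (length S) (R(12 := 0)) A Z (Suc t)"
      using assms by simp
  next
    fix p R' A' Z' t'
    assume I: "?I p R' A' Z' t'" and h: "holds (Lt 12 15) R'"
      and U: "unchanged (Ld 10 4 12 2 ;; St 2 10 2 4 ;; Inc 12) (R(12 := 0)) A Z R' A' Z'"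
    note U = unchangedD[OF U, simplified]
    have R: "R' 0 = n" "R' 2 = 0" "R' 4 = 2" "R' 15 = length S"
      using U(1) assms(1,2) by (auto simp: constants_def)
    from I h R obtain i where i: "R' 12 = i" "p = length S - i" "i < length S"
      "t' + 4 * p \<le> t + 4 * length S + 1"
      "\<And>v. v < n \<Longrightarrow> A' (2, v, 0) = (if v \<in> set (take i S) then 2 else 0)"
      by auto
    have A: "A' (4, i, 0) = S ! i"
      using U(2) assms(3) i by simp
    have "S ! i < n" using subsetD[OF assms(4) nth_mem[OF i(3)]] by simp
    moreover have "?I (length S - Suc i) (R'(10 := S ! i, 12 := Suc i)) (A'((2, S ! i, 0) := 2)) Z' (t' + 4)"
      using i by (auto simp: take_Suc_conv_app_nth)
    ultimately show "wp (Ld 10 4 12 2 ;; St 2 10 2 4 ;; Inc 12) (\<lambda>R A Z t. \<exists>j<p. ?I j R A Z t) R' A' Z' (Suc t')"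
      using i(2,3) len B by (simp add: R i(1) A mem_cells)
  next
    fix p R' A' Z' t'
    assume I: "?I p R' A' Z' t'" and h: "\<not> holds (Lt 12 15) R'"
      and U: "unchanged (Ld 10 4 12 2 ;; St 2 10 2 4 ;; Inc 12) (R(12 := 0)) A Z R' A' Z'"
    have "R' 15 = length S" using unchangedD(1)[OF U] assms(2) by simp
    then show "(\<forall>v<n. A' (2, v, 0) = (if v \<in> set S then 2 else 0)) \<and> Suc t' \<le> t + 4 * length S + 2"
      using I h by auto
  qed
qed

text \<open>The counters \<open>c\<close> exist in the proof only: the machine keeps the list
  pointer of the current vertex and recovers the others when it returns to them.\<close>

definition searching where
  "searching L S K i st fs c R A \<longleftrightarrow> R 12 = i \<and> R 14 = length (S @ st @ fs) \<and> R 13 = K - length fs \<and>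
     (\<forall>j<length S. A (4, j, 0) = S ! j) \<and> (\<forall>j<length fs. A (4, K - length fs + j, 0) = fs ! j) \<and>
     (\<forall>v<n. A (2, v, 0) = (if v \<in> set S then 2 else if v \<in> set st \<union> set fs then 1 else 0)) \<and>
     (i < length S \<longrightarrow> R 10 = hd (st @ [S ! i]) \<and> R 11 = (L (R 10) @ [n]) ! c (R 10))"

lemma wp_finish:
  assumes "dfs L {..<n} K cap S" "dfs.inv L {..<n} K S par0 i st fs (parent A) c" "i < length S"
    "searching L S K i st fs c R A" "represents A L" "constants R" "R 15 = length S" "K \<le> n"
    "length (S @ st @ fs) = K \<or> c (R 10) = length (L (R 10))"
  shows "wp finish (\<lambda>R' A' Z' t'. t' \<le> t + 7 \<and> (\<exists>i' st' fs'. 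
     dfs.inv L {..<n} K S par0 i' st' fs' (parent A') c \<and> searching L S K i' st' fs' c R' A' \<and>
     dfs.potential K cap S i' st' fs' c < dfs.potential K cap S i st fs c)) R A Z t"
proof -
  interpret d: dfs L "{..<n}" K cap S par0 by fact
  note D = d.invD[OF assms(2)] and S = assms(4)[unfolded searching_def] and C = constantsD[OF assms(6)]
  define x where "x = R 10"
  have x: "x = hd (st @ [S ! i])" "R 10 = x" "R 12 = i" "R 13 = K - length fs" "x < n"
    using S assms(3) d.inv_top(2)[OF assms(2,3)] by (auto simp: x_def)
  have vis: "\<And>v. v < n \<Longrightarrow> A (2, v, 0) = (if v \<in> set S then 2 else if v \<in> set st \<union> set fs then 1 else 0)"
    and o: "\<And>j. j < length S \<Longrightarrow> A (4, j, 0) = S ! j" and f: "\<And>j. j < length fs \<Longrightarrow> A (4, K - length fs + j, 0) = fs ! j"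
    using S by blast+
  have len: "length S + length st + length fs \<le> K" using D(2) by simp
  show ?thesis
  proof (cases st)
    case Nil
    have "S ! i \<in> set S" using assms(3) by simp
    then have v: "A (2, x, 0) = 2" using vis x Nil by simp
    have inv: "d.inv (Suc i) [] fs (parent A) c" "d.potential (Suc i) [] fs c < d.potential i [] fs c"
      using d.inv_next[of i fs "parent A" c] assms(2,3,9) Nil x by auto
    have nx: "S ! Suc i < n" "c (S ! Suc i) = 0" "A (0, S ! Suc i, n) = (L (S ! Suc i) @ [n]) ! 0"
      if "Suc i < length S"
    proof -
      show "S ! Suc i < n" using subsetD[OF d.V(2) nth_mem[OF that]] by simp
      then show "A (0, S ! Suc i, n) = (L (S ! Suc i) @ [n]) ! 0" by (rule representsD(6)[OF assms(5)])
    qed (use D(10) that in simp)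
    let ?R = "R(16 := 2, 12 := Suc i)"
    let ?R' = "?R(10 := S ! Suc i, 11 := (L (S ! Suc i) @ [n]) ! 0)"
    have "searching L S K (Suc i) [] fs c (if Suc i < length S then ?R' else ?R) A"
      unfolding searching_def using S nx Nil by auto
    moreover have "length S < B" "length S \<le> n" "Suc i < length S \<Longrightarrow> Suc i < n"
      using len assms(8) B by auto
    moreover have "d.potential (Suc i) [] fs c < d.potential i st fs c"
      using inv(2) Nil by simp
    ultimately have ex: "\<exists>i' st' fs'. d.inv i' st' fs' (parent A) c \<and>
      searching L S K i' st' fs' c (if Suc i < length S then ?R' else ?R) A \<and>
      d.potential i' st' fs' c < d.potential i st fs c" and b: "Suc i < B" "Suc i < length S \<Longrightarrow> Suc i < n"
      using inv(1) assms(3) by (blast, auto)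
    show ?thesis
    proof (cases "Suc i < length S")
      case True
      from ex True b show ?thesis
        unfolding finish_def by (simp add: C x(2-5) v assms(7) mem_cells nx o)
    next
      case False
      have "\<exists>i' st' fs'. d.inv i' st' fs' (parent A) c \<and> searching L S K i' st' fs' c ?R A \<and>
        d.potential i' st' fs' c < d.potential i st fs c"
        using ex unfolding if_not_P[OF False] .
      with False b(1) show ?thesis
        unfolding finish_def by (simp add: C x(2-5) v assms(7) mem_cells)
    qed
  next
    case (Cons y st')
    define p where "p = hd (st' @ [S ! i])"
    have xy: "y = x" using x Cons by simp
    have xs: "x \<in> set st" "x \<notin> set S" using Cons xy D(1) by auto
    then have v: "A (2, x, 0) = 1" using vis x by simp
    have inv: "d.inv i st' (x # fs) (parent A) c" "d.potential i st' (x # fs) c < d.potential i st fs c"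
    proof -
      have "d.inv i (x # st') fs (parent A) c" "length (S @ (x # st') @ fs) = K \<or> c x = length (L x)"
        using assms(2,9) unfolding Cons xy x(2) by simp_all
      from d.inv_finish[OF this(1) assms(3) this(2)]
      show "d.inv i st' (x # fs) (parent A) c" "d.potential i st' (x # fs) c < d.potential i st fs c"
        unfolding Cons xy by simp_all
    qed
    have pn: "p < n"
      using d.inv_top(2)[OF inv(1) assms(3)] by (simp add: p_def)
    \<comment> \<open>The arc last scanned at the parent \<open>p\<close> is the one to
      \<open>x\<close>, so the successor of \<open>x\<close> in the list of \<open>p\<close> is the
      place to resume. For this reason the invariant records the last scanned arc of every vertex
      below the top.\<close>
    have link: "parent A x = p" "0 < c p" "L p ! (c p - 1) = x" "c p \<le> length (L p)"
      using D(11)[OF assms(3)] D(7) by (auto simp: Cons xy p_def successively_Cons)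
    then have nx: "A (0, p, x) = (L p @ [n]) ! c p" "{p, x} \<in> E"
      using representsD(7,8)[OF assms(5) pn, of "c p - 1"] by auto
    have K: "K - length fs = Suc (K - Suc (length fs))" "length S \<le> K - Suc (length fs)"
      using len Cons by auto
    have f': "(A((4, K - Suc (length fs), 0) := x)) (4, K - Suc (length fs) + j, 0) = (x # fs) ! j"
      if "j < Suc (length fs)" for j
      using f[of "j - 1"] that K by (cases j) auto
    have "searching L S K i st' (x # fs) c (R(16 := 1, 13 := K - Suc (length fs), 17 := p, 11 := (L p @ [n]) ! c p, 10 := p))
      (A((4, K - Suc (length fs), 0) := x))"
    proof (unfold searching_def, intro conjI allI impI)
      show "(A((4, K - Suc (length fs), 0) := x)) (4, j, 0) = S ! j" if "j < length S" for j
        using o[OF that] that K(2) by simp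
      show "(A((4, K - Suc (length fs), 0) := x)) (4, K - length (x # fs) + j, 0) = (x # fs) ! j"
        if "j < length (x # fs)" for j
        using f'[of j] that by simp
      show "(A((4, K - Suc (length fs), 0) := x)) (2, v, 0) =
        (if v \<in> set S then 2 else if v \<in> set st' \<union> set (x # fs) then 1 else 0)" if "v < n" for v
        using vis[OF that] Cons xy by simp
      show "(R(16 := 1, 13 := K - Suc (length fs), 17 := p, 11 := (L p @ [n]) ! c p, 10 := p)) 14 =
        length (S @ st' @ x # fs)"
        using S Cons by simp
    qed (use x p_def in simp_all)
    moreover have "parent (A((4, K - Suc (length fs), 0) := x)) = parent A" by auto
    moreover have "K - Suc (length fs) < n" using K(1) assms(8) by simp
    ultimately show ?thesis
      using inv x(5) pn unfolding finish_def
      by (simp add: C x(2-4) v mem_cells link(1) nx)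
        (rule exI[of _ i], rule exI[of _ st'], rule exI[of _ "x # fs"], simp)
  qed
qed

lemma wp_advance:
  assumes "dfs L {..<n} K cap S" "dfs.inv L {..<n} K S par0 i st fs (parent A) c" "i < length S"
    "searching L S K i st fs c R A" "represents A L" "constants R" "R 15 = length S" "K \<le> n"
    "length (S @ st @ fs) < K" "c (R 10) < length (L (R 10))"
  shows "wp advance (\<lambda>R' A' Z' t'. t' \<le> t + 7 \<and> (\<exists>st' c'. 
     dfs.inv L {..<n} K S par0 i st' fs (parent A') c' \<and> searching L S K i st' fs c' R' A' \<and>
     dfs.potential K cap S i st' fs c' < dfs.potential K cap S i st fs c)) R A Z t"
proof -
  interpret d: dfs L "{..<n}" K cap S par0 by fact
  note D = d.invD[OF assms(2)] and S = assms(4)[unfolded searching_def] and C = constantsD[OF assms(6)]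
  define x y where "x = R 10" and "y = L x ! c x"
  have x: "x = hd (st @ [S ! i])" "R 10 = x" "R 12 = i" "R 13 = K - length fs" "x < n" "x \<in> set (S @ st)"
    using S assms(3) d.inv_top(1,2)[OF assms(2,3)] by (auto simp: x_def)
  have cx: "c x < length (L x)" using assms(10) x by simp
  have y: "R 11 = y" "y < n" "{x, y} \<in> E" "A (0, x, y) = (L x @ [n]) ! Suc (c x)"
    using S assms(3) cx x representsD[OF assms(5) x(5)] by (auto simp: y_def nth_append)
  have vis: "\<And>v. v < n \<Longrightarrow> A (2, v, 0) = (if v \<in> set S then 2 else if v \<in> set st \<union> set fs then 1 else 0)"
    using S by blast+
  show ?thesis
  proof (cases "y \<in> set (S @ st @ fs)")
    case True
    then have v: "A (2, y, 0) \<noteq> 0" using vis y by auto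
    have inv: "d.inv i st fs (parent A) (c(x := Suc (c x)))"
      "d.potential i st fs (c(x := Suc (c x))) < d.potential i st fs c"
      using d.inv_scan[OF assms(2,3) x(1) cx] True by (auto simp: y_def)
    have "searching L S K i st fs (c(x := Suc (c x))) (R(16 := A (2, y, 0), 11 := (L x @ [n]) ! Suc (c x))) A"
      unfolding searching_def using S x by simp
    then show ?thesis
      using inv v x(5) y(2,3) unfolding advance_def
      by (simp add: C x(2) y(1,4) mem_cells) (rule exI[of _ st], rule exI[of _ "c(x := Suc (c x))"], simp)
  next
    case False
    then have v: "A (2, y, 0) = 0" using vis y by auto
    have inv: "d.inv i (y # st) fs ((parent A)(y := x)) (c(x := Suc (c x)))"
      "d.potential i (y # st) fs (c(x := Suc (c x))) < d.potential i st fs c"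
      using d.inv_discover[OF assms(2,3) x(1) cx y_def False assms(9)] by auto
    have cy: "c y = 0" "y \<noteq> x" using D(9) False x(6) by auto
    let ?A = "A((2, y, 0) := 1, (3, y, 0) := x)"
    have p: "(parent A)(y := x) = parent ?A" by (auto simp: fun_eq_iff)
    have "A (0, y, n) = (L y @ [n]) ! 0"
      using representsD(6)[OF assms(5) y(2)] .
    moreover have "searching L S K i (y # st) fs (c(x := Suc (c x)))
      (R(16 := 0, 14 := Suc (length (S @ st @ fs)), 10 := y, 11 := (L y @ [n]) ! 0)) ?A"
      unfolding searching_def using S False cy by auto
    moreover have "R 14 = length (S @ st @ fs)" using S by blast
    moreover have "Suc (length (S @ st @ fs)) < B" using assms(8,9) B by simp
    ultimately show ?thesis
      using inv[unfolded p] x(5) y(2,3) unfolding advance_def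
      by (simp add: C x(2) y(1) v mem_cells) (rule exI[of _ "y # st"], rule exI[of _ "c(x := Suc (c x))"], simp)
  qed
qed

text \<open>An iteration takes at most ten ticks and lowers \<open>potential\<close>, whose initial
  value is at most \<open>3 * K + cap\<close>; marking adds at most \<open>4 * K\<close> and a
  constant.\<close>

lemma wp_search:
  assumes "dfs L {..<n} K cap S" "S \<noteq> []" "represents A L" "constants R" "R 15 = length S" "R 18 = K" "K \<le> n"
    "\<forall>i<length S. A (4, i, 0) = S ! i" "\<forall>v<n. A (2, v, 0) = 0"
    "feasible (\<lambda>u. set (L u)) (set S) K"
  shows "wp search (\<lambda>R' A' Z' t'. \<exists>fs. length (S @ fs) = K \<and> distinct (S @ fs) \<and> set (S @ fs) \<subseteq> {..<n} \<and>
     finish_order (\<lambda>u. set (L u)) (parent A') (set S) fs \<and>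
     (\<forall>i<K. A' (4, i, 0) = (S @ fs) ! i) \<and> (\<forall>u\<in>set S. parent A' u = parent A u) \<and>
     (\<forall>v<n. A' (2, v, 0) = (if v \<in> set S then 2 else if v \<in> set fs then 1 else 0)) \<and>
     t' \<le> t + 40 * K + 10 * cap + 10) R A Z t"
proof -
  interpret d: dfs L "{..<n}" K cap S "parent A" by fact
  have S0: "S ! 0 < n" "S ! 0 = hd S" "0 < length S" "length S \<le> K"
    using d.length_S assms(2) subsetD[OF d.V(2) nth_mem[of 0 S]] by (auto simp: hd_conv_nth)
  let ?body = "Cond (Lt 14 18) (Cond (Lt 11 0) advance finish) finish"
  show ?thesis
    unfolding search_def wp_simps
  proof (rule wp_mono[OF wp_mark[OF assms(4,5,8) d.V(2) d.distinct(1) assms(9)]], goal_cases)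
    case (1 R1 A1 Z1 t1)
    note U = unchangedD[OF 1(1), unfolded mark_def, simplified] and P = 1(2)
    have R1: "R1 0 = n" "R1 1 = R 1" "R1 2 = 0" "R1 3 = 1" "R1 4 = 2" "R1 15 = length S" "R1 18 = K"
      using U(1) assms(4,5,6) by (auto simp: constants_def)
    have A1: "\<And>i. i < length S \<Longrightarrow> A1 (4, i, 0) = S ! i" "parent A1 = parent A"
      using U(2) assms(8) by auto
    have rep1: "represents A1 L"
      using assms(3) represents_cong[of A1 A] U(2) by simp
    let ?R = "R1(14 := length S, 13 := K, 12 := 0, 10 := S ! 0, 11 := (L (S ! 0) @ [n]) ! 0)"
    let ?p = "d.potential 0 [] [] (\<lambda>_. 0)"
    let ?I = "\<lambda>p R A Z t'. \<exists>i st fs c. d.inv i st fs (parent A) c \<and> searching L S K i st fs c R A \<and>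
      p = d.potential i st fs c \<and> t' + 10 * p \<le> t1 + 5 + 10 * ?p"
    have nx: "A1 (0, S ! 0, n) = (L (S ! 0) @ [n]) ! 0"
      using representsD(6)[OF rep1 S0(1)] .
    have loop: "wp (Loop (Lt 12 15) ?body) (\<lambda>R' A' Z' t'. \<exists>fs. length (S @ fs) = K \<and> distinct (S @ fs) \<and> set (S @ fs) \<subseteq> {..<n} \<and>
     finish_order (\<lambda>u. set (L u)) (parent A') (set S) fs \<and>
     (\<forall>i<K. A' (4, i, 0) = (S @ fs) ! i) \<and> (\<forall>u\<in>set S. parent A' u = parent A u) \<and>
     (\<forall>v<n. A' (2, v, 0) = (if v \<in> set S then 2 else if v \<in> set fs then 1 else 0)) \<and>
     t' \<le> t + 40 * K + 10 * cap + 10) ?R A1 Z1 (Suc (Suc (Suc (Suc (Suc t1)))))"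
    proof (rule wp_Loop[where I = ?I and i = ?p])
      have "searching L S K 0 [] [] (\<lambda>_. 0) ?R A1"
        using P A1 by (simp add: searching_def)
      moreover have "d.inv 0 [] [] (parent A1) (\<lambda>_. 0)"
        using d.inv_init[OF assms(2)] A1 by simp
      ultimately show "?I ?p ?R A1 Z1 (Suc (Suc (Suc (Suc (Suc t1)))))"
        by (intro exI[of _ "0::nat"] exI[of _ "[]"] exI[of _ "\<lambda>_. 0"]) simp
    next
      fix p R' A' Z' t'
      assume I: "?I p R' A' Z' t'" and U': "unchanged ?body ?R A1 Z1 R' A' Z'" and h: "holds (Lt 12 15) R'"
      note U' = unchangedD[OF U', unfolded advance_def finish_def, simplified]
      have R': "constants R'" "R' 15 = length S" "R' 18 = K" "R' 0 = n"
        using U'(1) R1 by (auto simp: constants_def)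
      have rep': "represents A' L"
        using rep1 represents_cong[of A' A1] U'(2) by simp
      from I obtain i st fs c where I: "d.inv i st fs (parent A') c" "searching L S K i st fs c R' A'"
        "p = d.potential i st fs c" "t' + 10 * p \<le> t1 + 5 + 10 * ?p" by blast
      have i: "i < length S" using h I(2) R' by (simp add: searching_def)
      have cR: "c (R' 10) \<le> length (L (R' 10))" "R' 14 = length (S @ st @ fs)" "R' 10 < n"
        "R' 11 = (L (R' 10) @ [n]) ! c (R' 10)" "length (S @ st @ fs) \<le> K"
        using d.invD(2,7)[OF I(1)] d.inv_top(2)[OF I(1) i] I(2) i by (auto simp: searching_def)
      have y: "R' 11 < n \<longleftrightarrow> c (R' 10) < length (L (R' 10))"
        using cR representsD(5)[OF rep' cR(3), of "c (R' 10)"] by (auto simp: nth_append)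
      have dfs: "dfs L {..<n} K cap S" by fact
      let ?Q = "\<lambda>R A Z t. \<exists>j<p. ?I j R A Z t"
      have adv: "wp advance ?Q R' A' Z' (Suc (Suc (Suc t')))"
        if "length (S @ st @ fs) < K" "c (R' 10) < length (L (R' 10))"
        by (rule wp_mono[OF wp_advance[OF dfs I(1) i I(2) rep' R'(1,2) assms(7) that]])
          (use I(3,4) in fastforce)
      have fin: "wp finish ?Q R' A' Z' t''"
        if "length (S @ st @ fs) = K \<or> c (R' 10) = length (L (R' 10))" "t'' \<le> t' + 3" for t''
        by (rule wp_mono[OF wp_finish[OF dfs I(1) i I(2) rep' R'(1,2) assms(7) that(1)]])
          (use I(3,4) that(2) in fastforce)
      show "wp ?body ?Q R' A' Z' (Suc t')"
        using adv fin y cR R' by (auto simp del: append_assoc simp: not_less)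
    next
      fix p R' A' Z' t'
      assume I: "?I p R' A' Z' t'" and U': "unchanged ?body ?R A1 Z1 R' A' Z'" and h: "\<not> holds (Lt 12 15) R'"
      note U' = unchangedD[OF U', unfolded advance_def finish_def, simplified]
      have R': "R' 15 = length S" using U'(1) R1 by simp
      from I obtain i st fs c where I: "d.inv i st fs (parent A') c" "searching L S K i st fs c R' A'"
        "t' + 10 * p \<le> t1 + 5 + 10 * ?p" by blast
      have "i = length S" using d.invD(4)[OF I(1)] I(2) h R' by (simp add: searching_def)
      note inv = I(1)[unfolded this] and s = I(2)[unfolded this]
      note c = d.inv_complete[OF inv assms(10)]
      have "?p \<le> 2 * K + K + cap"
        using S0(4) by (simp add: d.potential_def)
      then have t: "Suc t' \<le> t + 40 * K + 10 * cap + 10"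
        using I(3) P S0(4) by linarith
      have "A' (4, i, 0) = (S @ fs) ! i" if "i < K" for i
      proof (cases "i < length S")
        case False
        then have "i - length S < length fs" "K - length fs + (i - length S) = i"
          using that c(2) by auto
        with s False show ?thesis unfolding searching_def by (metis nth_append)
      qed (use s in \<open>auto simp: searching_def nth_append\<close>)
      moreover have "distinct (S @ fs)" "set (S @ fs) \<subseteq> {..<n}" "\<forall>u\<in>set S. parent A' u = parent A u"
        using d.invD(1,3,13)[OF inv] c(1) by auto
      moreover have "\<forall>v<n. A' (2, v, 0) = (if v \<in> set S then 2 else if v \<in> set fs then 1 else 0)"
        using s c(1) by (simp add: searching_def)
      ultimately show "\<exists>fs. length (S @ fs) = K \<and> distinct (S @ fs) \<and> set (S @ fs) \<subseteq> {..<n} \<and>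
         finish_order (\<lambda>u. set (L u)) (parent A') (set S) fs \<and>
         (\<forall>i<K. A' (4, i, 0) = (S @ fs) ! i) \<and> (\<forall>u\<in>set S. parent A' u = parent A u) \<and>
         (\<forall>v<n. A' (2, v, 0) = (if v \<in> set S then 2 else if v \<in> set fs then 1 else 0)) \<and>
         Suc t' \<le> t + 40 * K + 10 * cap + 10"
        using c t by blast
    qed
    have "0 < n" using S0(1) by simp
    then show ?case
      using loop B S0(1,3,4) by (simp add: R1 A1(1) mem_cells nx)
  qed
qed

end

section \<open>Removing and reinserting arcs\<close>

definition unlink :: "arrays \<Rightarrow> nat \<Rightarrow> nat \<Rightarrow> arrays" where
  "unlink A u y = A((0, u, A (1, u, y)) := A (0, u, y), (1, u, A (0, u, y)) := A (1, u, y))"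

text \<open>Besides shortening the list, it records that the old neighbours of \<open>y\<close>
  pointed to \<open>y\<close>, which is what reinsertion has to reproduce.\<close>

lemma linked_unlink:
  assumes "linked n A u p (as @ y # bs)" "distinct (p # as @ y # bs)" "n \<notin> set (as @ y # bs)"
  shows "linked n (unlink A u y) u p (as @ bs)" "A (0, u, A (1, u, y)) = y" "A (1, u, A (0, u, y)) = y"
    "A (1, u, y) \<in> insert p (set as)" "A (0, u, y) \<in> insert n (set bs)"
proof -
  have 1: "A (1, u, y) \<in> insert p (set as) \<and> A (0, u, A (1, u, y)) = y \<and> linked n A u y bs"
    using assms(1) by (induction as arbitrary: p) auto
  then show "A (1, u, y) \<in> insert p (set as)" "A (0, u, A (1, u, y)) = y" by auto
  from 1 show 2: "A (0, u, y) \<in> insert n (set bs)" "A (1, u, A (0, u, y)) = y"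
    by (cases bs; auto)+
  show "linked n (unlink A u y) u p (as @ bs)"
    using assms
  proof (induction as arbitrary: p)
    case Nil
    then show ?case
    proof (cases bs)
      case (Cons b bs')
      have "linked n A u b bs' \<longleftrightarrow> linked n (unlink A u y) u b bs'"
        using Nil Cons by (intro linked_cong) (auto simp: unlink_def)
      moreover have "unlink A u y (0, u, p) = b" "unlink A u y (1, u, b) = p"
        using Nil Cons by (auto simp: unlink_def)
      ultimately show ?thesis
        using Nil Cons by simp
    qed (auto simp: unlink_def)
  next
    case (Cons a as)
    have "A (1, u, y) \<in> insert a (set as)"
      using Cons.prems(1) by (induction as arbitrary: a p) auto
    then have "p \<noteq> A (1, u, y)" "a \<noteq> A (0, u, y)"
      using Cons.prems 2(1) by auto
    then show ?case
      using Cons by (auto simp: unlink_def)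
  qed
qed

context enumeration
begin

text \<open>Undoing must recover the link arrays exactly and not just the lists they represent: the
  links of removed entries belong to no list but are needed to reinsert those entries.\<close>

definition same_lists :: "arrays \<Rightarrow> arrays \<Rightarrow> bool" where
  "same_lists A A' \<longleftrightarrow> (\<forall>u v. A' (0, u, v) = A (0, u, v) \<and> A' (1, u, v) = A (1, u, v))"

lemma represents_same_lists: "same_lists A A' \<Longrightarrow> represents A' L \<longleftrightarrow> represents A L"
  by (rule represents_cong) (auto simp: same_lists_def)

lemma represents_unlink:
  assumes "represents A L" "u < n" "y \<in> set (L u)"
  shows "represents (unlink A u y) (L(u := remove1 y (L u)))"
    "A (0, u, A (1, u, y)) = y" "A (1, u, A (0, u, y)) = y" "A (0, u, y) \<noteq> y" "A (1, u, y) \<noteq> y"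
    "A (0, u, y) = n \<or> {u, A (0, u, y)} \<in> E" "A (1, u, y) = n \<or> {u, A (1, u, y)} \<in> E"
proof -
  note d = representsD[OF assms(1,2)]
  obtain as bs where L: "L u = as @ y # bs"
    using assms(3) by (auto simp: in_set_conv_decomp)
  have n: "n \<notin> set (L u)" using d(4) by auto
  have l: "linked n A u n (as @ y # bs)" and di: "distinct (n # as @ y # bs)" "n \<notin> set (as @ y # bs)"
    using d(1,2) n unfolding L by auto
  note un = linked_unlink[OF l di]
  show "A (0, u, A (1, u, y)) = y" "A (1, u, A (0, u, y)) = y" using un by auto
  show "A (0, u, y) \<noteq> y" "A (1, u, y) \<noteq> y" using un(4,5) di by auto
  show "A (0, u, y) = n \<or> {u, A (0, u, y)} \<in> E" "A (1, u, y) = n \<or> {u, A (1, u, y)} \<in> E"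
    using un(4,5) d(3) unfolding L by auto
  have r: "remove1 y (L u) = as @ bs" using di unfolding L by (simp add: remove1_append)
  show "represents (unlink A u y) (L(u := remove1 y (L u)))"
    unfolding represents_def
  proof (intro allI impI)
    fix w assume w: "w < n"
    show "linked n (unlink A u y) w n ((L(u := remove1 y (L u))) w) \<and> distinct ((L(u := remove1 y (L u))) w) \<and>
      set ((L(u := remove1 y (L u))) w) \<subseteq> {v. {w, v} \<in> E}"
    proof (cases "w = u")
      case True
      then show ?thesis
        using un(1) di d(3) r unfolding L by auto
    next
      case False
      have "linked n (unlink A u y) w n (L w) \<longleftrightarrow> linked n A w n (L w)"
        using False by (intro linked_cong) (auto simp: unlink_def)
      then show ?thesis
        using False assms(1) w by (simp add: represents_def)
    qed
  qed
qed

lemma wp_remove: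
  assumes "represents A L" "R 21 = u" "R 22 = y" "u < n" "y \<in> set (L u)"
  shows "wp remove (\<lambda>R' A' Z' t'. A' = unlink A u y \<and> t' = t + 4) R A Z t"
  using assms(4) represents_unlink[OF assms(1,4,5)] representsD(3)[OF assms(1,4,5)]
  unfolding remove_def by (simp add: assms(2,3) mem_cells unlink_def)

text \<open>The two cells changed by the removal are not the cells of \<open>y\<close>, as an entry
  is never its own neighbour in the list; hence the links at \<open>y\<close> still hold the old
  neighbours.\<close>

lemma wp_restore:
  assumes "represents A L" "R 21 = u" "R 22 = y" "u < n" "y \<in> set (L u)" "same_lists (unlink A u y) A'"
  shows "wp restore (\<lambda>R' A'' Z' t'. same_lists A A'' \<and> t' = t + 4) R A' Z t"
proof -
  note d = represents_unlink[OF assms(1,4,5)]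
  have e: "A' (0, u, y) = A (0, u, y)" "A' (Suc 0, u, y) = A (1, u, y)"
    using assms(6) d(4,5) by (auto simp: same_lists_def unlink_def)
  have "same_lists A (A'((0, u, A (1, u, y)) := y, (1, u, A (0, u, y)) := y))"
    using assms(6) d(2,3) by (auto simp: same_lists_def unlink_def)
  then show ?thesis
    using assms(4) d(6,7) representsD(3)[OF assms(1,4,5)]
    unfolding restore_def by (simp add: assms(2,3) e mem_cells)
qed

text \<open>Only visited vertices are reset, so that a node pays for \<open>k\<close> marks and not
  for \<open>n\<close>.\<close>

lemma wp_clear:
  assumes "constants R" "R 18 = length xs" "\<forall>i<length xs. A (4, i, 0) = xs ! i" "set xs \<subseteq> {..<n}"
    "distinct xs" "\<forall>v<n. v \<notin> set xs \<longrightarrow> A (2, v, 0) = 0"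
  shows "wp clear (\<lambda>R' A' Z' t'. (\<forall>v<n. A' (2, v, 0) = 0) \<and> t' \<le> t + 4 * length xs + 2) R A Z t"
proof -
  have len: "length xs \<le> n"
    using card_mono[OF _ assms(4)] distinct_card[OF assms(5)] by simp
  let ?I = "\<lambda>p R A Z t'. \<exists>i\<le>length xs. p = length xs - i \<and> R 12 = i \<and> t' + 4 * p \<le> t + 4 * length xs + 1 \<and>
    (\<forall>v<n. v \<notin> set (drop i xs) \<longrightarrow> A (2, v, 0) = 0)"
  show ?thesis
    unfolding clear_def wp_simps
  proof (rule conjI, use B in simp, rule wp_Loop[where I = ?I and i = "length xs"])
    show "?I (length xs) (R(12 := 0)) A Z (Suc t)"
      using assms by simp
  next
    fix p R' A' Z' t'
    assume I: "?I p R' A' Z' t'" and h: "holds (Lt 12 18) R'"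
      and U: "unchanged (Ld 10 4 12 2 ;; St 2 10 2 2 ;; Inc 12) (R(12 := 0)) A Z R' A' Z'"
    note U = unchangedD[OF U, simplified]
    have R: "R' 0 = n" "R' 2 = 0" "R' 18 = length xs"
      using U(1) assms(1,2) by (auto simp: constants_def)
    from I h R obtain i where i: "R' 12 = i" "p = length xs - i" "i < length xs"
      "t' + 4 * p \<le> t + 4 * length xs + 1"
      "\<And>v. v < n \<Longrightarrow> v \<notin> set (drop i xs) \<Longrightarrow> A' (2, v, 0) = 0"
      by auto
    have A: "A' (4, i, 0) = xs ! i"
      using U(2) assms(3) i by simp
    have "xs ! i < n" using subsetD[OF assms(4) nth_mem[OF i(3)]] by simp
    moreover have "?I (length xs - Suc i) (R'(10 := xs ! i, 12 := Suc i)) (A'((2, xs ! i, 0) := 0)) Z' (t' + 4)"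
    proof -
      have "(A'((2, xs ! i, 0) := 0)) (2, v, 0) = 0" if "v < n" "v \<notin> set (drop (Suc i) xs)" for v
      proof (cases "v = xs ! i")
        case False
        have "set (drop i xs) = insert (xs ! i) (set (drop (Suc i) xs))"
          unfolding Cons_nth_drop_Suc[OF i(3), symmetric] by simp
        with False that i(5)[OF that(1)] show ?thesis by simp
      qed simp
      then show ?thesis using i by auto
    qed
    ultimately show "wp (Ld 10 4 12 2 ;; St 2 10 2 2 ;; Inc 12) (\<lambda>R A Z t. \<exists>j<p. ?I j R A Z t) R' A' Z' (Suc t')"
      using i(2,3) len B by (simp add: R i(1) A mem_cells)
  next
    fix p R' A' Z' t'
    assume I: "?I p R' A' Z' t'" and h: "\<not> holds (Lt 12 18) R'"
      and U: "unchanged (Ld 10 4 12 2 ;; St 2 10 2 2 ;; Inc 12) (R(12 := 0)) A Z R' A' Z'"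
    have "R' 18 = length xs" using unchangedD(1)[OF U] assms(2) by simp
    then show "(\<forall>v<n. A' (2, v, 0) = 0) \<and> Suc t' \<le> t + 4 * length xs + 2"
      using I h by auto
  qed
qed

lemma wp_print_tree:
  assumes "constants R" "R 1 = length xs" "\<forall>i<length xs. A (4, i, 0) = xs ! i" "set xs \<subseteq> {..<n}"
    "distinct xs" "xs \<noteq> []"
  shows "wp print_tree (\<lambda>R' A' Z' t'. Z' = Z @ words_of (map (\<lambda>x. (parent A x, x)) (tl xs)) \<and>
    t' \<le> t + 6 * length xs + 2) R A Z t"
proof -
  have len: "length xs \<le> n"
    using card_mono[OF _ assms(4)] distinct_card[OF assms(5)] by simp
  let ?w = "\<lambda>i. words_of (map (\<lambda>x. (parent A x, x)) (tl (take i xs)))"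
  let ?I = "\<lambda>p R A' Z' t'. \<exists>i\<le>length xs. 1 \<le> i \<and> p = length xs - i \<and> R 12 = i \<and> t' + 6 * p \<le> t + 6 * length xs + 1 \<and>
    Z' = Z @ ?w i"
  have "1 \<le> length xs" using assms(6) by (cases xs) auto
  show ?thesis
    unfolding print_tree_def wp_simps
  proof (rule conjI, use B in simp, rule wp_Loop[where I = ?I and i = "length xs - 1"])
    have "tl (take 1 xs) = []" by (cases xs) auto
    then show "?I (length xs - 1) (R(12 := 1)) A Z (Suc t)"
      using \<open>1 \<le> length xs\<close> by (auto simp: words_of_def)
  next
    fix p R' A' Z' t'
    assume I: "?I p R' A' Z' t'" and h: "holds (Lt 12 1) R'"
      and U: "unchanged (Ld 10 4 12 2 ;; Ld 17 3 10 2 ;; Emit 17 ;; Emit 10 ;; Inc 12) (R(12 := 1)) A Z R' A' Z'"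
    note U = unchangedD[OF U, simplified]
    have R: "R' 0 = n" "R' 2 = 0" "R' 1 = length xs"
      using U(1) assms(1,2) by (auto simp: constants_def)
    from I h R obtain i where i: "R' 12 = i" "p = length xs - i" "i < length xs" "1 \<le> i"
      "t' + 6 * p \<le> t + 6 * length xs + 1" "Z' = Z @ ?w i"
      by auto
    have A: "A' (4, i, 0) = xs ! i" "A' (3, xs ! i, 0) = A (3, xs ! i, 0)"
      using U(2) assms(3) i by simp_all
    have "xs ! i < n" using subsetD[OF assms(4) nth_mem[OF i(3)]] by simp
    moreover have "tl (take (Suc i) xs) = tl (take i xs) @ [xs ! i]"
      using i(3,4) by (simp add: take_Suc_conv_app_nth) (cases xs; cases i; simp)
    then have "Z @ ?w (Suc i) = Z' @ [parent A (xs ! i)] @ [xs ! i]"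
      unfolding i(6) by (simp add: words_of_def)
    then have "?I (length xs - Suc i) (R'(10 := xs ! i, 17 := A (3, xs ! i, 0), 12 := Suc i)) A'
      ((Z' @ [parent A (xs ! i)]) @ [xs ! i]) (t' + 6)"
      using i by (intro exI[of _ "Suc i"]) simp
    ultimately show "wp (Ld 10 4 12 2 ;; Ld 17 3 10 2 ;; Emit 17 ;; Emit 10 ;; Inc 12)
      (\<lambda>R A Z t. \<exists>j<p. ?I j R A Z t) R' A' Z' (Suc t')"
      using i(2,3) len B by (simp add: R i(1) A mem_cells)
  next
    fix p R' A' Z' t'
    assume I: "?I p R' A' Z' t'" and h: "\<not> holds (Lt 12 1) R'"
      and U: "unchanged (Ld 10 4 12 2 ;; Ld 17 3 10 2 ;; Emit 17 ;; Emit 10 ;; Inc 12) (R(12 := 1)) A Z R' A' Z'"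
    have "R' 1 = length xs" using unchangedD(1)[OF U] assms(2) by simp
    then show "Z' = Z @ words_of (map (\<lambda>x. (parent A x, x)) (tl xs)) \<and> Suc t' \<le> t + 6 * length xs + 2"
      using I h by auto
  qed
qed

section \<open>Looking for a branching arc\<close>

definition branch_point where
  "branch_point L par xs m a y \<longleftrightarrow> (\<exists>i<m. a = xs ! i) \<and> y \<in> set (L a) \<and> y \<notin> set (take m xs) \<and>
     \<not> (y \<in> set xs \<and> par y = a)"

lemma wp_test_arc:
  assumes "constants R" "R 10 = a" "R 11 = y" "a < n" "y < n" "{a, y} \<in> E"
  shows "wp test_arc (\<lambda>R' A' Z' t'.
    if A (2, y, 0) = 2 \<or> A (2, y, 0) = 1 \<and> parent A y = a
    then t' \<le> t + 6 \<and> R' 11 = A (0, a, y) \<and> R' 20 = R 20 \<and> R' 19 = R 19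
    else t' \<le> t + 10 \<and> R' 11 = n \<and> R' 20 = 1 \<and> R' 19 = 0 \<and> R' 21 = a \<and> R' 22 = y) R A Z t"
  using assms(4-6) B unfolding test_arc_def next_arc_def found_def
  by (cases "A (2, y, 0) = 2"; cases "A (2, y, 0) = 1"; cases "parent A y = a")
    (simp_all add: assms(2,3) constantsD[OF assms(1)] mem_cells)

text \<open>The scan of the neighbours of a vertex stops at the first neighbour outside \<open>xs\<close>, which
  bounds its length by that of \<open>xs\<close>.\<close>

lemma wp_scan_neighbours:
  assumes "constants R" "represents A L" "a < n" "R 10 = a" "R 11 = (L a @ [n]) ! 0" "R 20 = 0" "R 19 = k"
    "distinct xs" "length xs = k" "i < m" "xs ! i = a"
    "\<forall>v<n. A (2, v, 0) = (if v \<in> set (take m xs) then 2 else if v \<in> set xs then 1 else 0)"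
  shows "wp (Loop (Lt 11 0) test_arc) (\<lambda>R' A' Z' t'. t' \<le> t + 7 * k + 14 \<and>
    (R' 20 = 0 \<and> R' 19 = k \<and> (\<forall>y\<in>set (L a). y \<notin> set (take m xs) \<longrightarrow> y \<in> set xs \<and> parent A y = a) \<or>
     R' 20 = 1 \<and> R' 19 = 0 \<and> branch_point L (parent A) xs m (R' 21) (R' 22))) R A Z t"
proof -
  note d = representsD[OF assms(2,3)]
  let ?good = "\<lambda>y. y \<notin> set (take m xs) \<longrightarrow> y \<in> set xs \<and> parent A y = a"
  \<comment> \<open>The second alternative, with variant 0, is the state after a branching arc has
    been found.\<close>
  let ?I = "\<lambda>p R A' Z' t'.
    (\<exists>c\<le>length (L a). c \<le> k \<and> p = k + 1 - c \<and> t' + 7 * p \<le> t + 7 * k + 7 \<and> R 11 = (L a @ [n]) ! c \<and> R 20 = 0 \<and> R 19 = k \<and>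
       (\<forall>y\<in>set (take c (L a)). ?good y)) \<or>
    p = 0 \<and> t' \<le> t + 7 * k + 13 \<and> R 11 = n \<and> R 20 = 1 \<and> R 19 = 0 \<and> branch_point L (parent A) xs m (R 21) (R 22)"
  show ?thesis
  proof (rule wp_Loop[where I = ?I and i = "k + 1"])
    show "?I (k + 1) R A Z t"
      using assms(5-7) by (intro disjI1 exI[of _ 0]) auto
  next
    fix p R' A' Z' t'
    assume I: "?I p R' A' Z' t'" and h: "holds (Lt 11 0) R'"
      and U: "unchanged test_arc R A Z R' A' Z'"
    note U = unchangedD[OF U, unfolded test_arc_def next_arc_def found_def, simplified]
    have R: "R' 0 = n" "R' 2 = 0" "R' 3 = 1" "R' 4 = 2" "R' 10 = a"
      using U(1) assms(1,4) by (auto simp: constants_def)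
    have A: "A' x = A x" for x
      using U(2) by (cases x) auto
    from I h R obtain c where c: "c \<le> length (L a)" "c \<le> k" "p = k + 1 - c" "t' + 7 * p \<le> t + 7 * k + 7"
      "R' 11 = (L a @ [n]) ! c" "R' 20 = 0" "R' 19 = k" "\<forall>y\<in>set (take c (L a)). ?good y"
      by auto
    have cl: "c < length (L a)"
      using c(1,5) h R by (cases "c = length (L a)") auto
    define y where "y = L a ! c"
    have y: "R' 11 = y" "y < n" "{a, y} \<in> E" "A (0, a, y) = (L a @ [n]) ! Suc c" "y \<in> set (L a)"
      using c(5) cl d by (auto simp: y_def nth_append)
    have tk: "take (Suc c) (L a) = take c (L a) @ [y]"
      using cl by (simp add: take_Suc_conv_app_nth y_def)
    have vis: "(A (2, y, 0) = 2 \<or> A (2, y, 0) = 1 \<and> parent A y = a) \<longleftrightarrow> ?good y"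
      using assms(12) y(2) by simp
    show "wp test_arc (\<lambda>R A Z t. \<exists>j<p. ?I j R A Z t) R' A' Z' (Suc t')"
    proof (rule wp_mono[OF wp_test_arc[where a = a and y = y]], unfold A vis)
      fix R2 A2 Z2 t2
      assume P: "if ?good y
        then t2 \<le> Suc t' + 6 \<and> R2 11 = A (0, a, y) \<and> R2 20 = R' 20 \<and> R2 19 = R' 19
        else t2 \<le> Suc t' + 10 \<and> R2 11 = n \<and> R2 20 = 1 \<and> R2 19 = 0 \<and> R2 21 = a \<and> R2 22 = y"
      show "\<exists>j<p. ?I j R2 A2 Z2 t2"
      proof (cases "?good y")
        case True
        have g: "\<forall>y\<in>set (take (Suc c) (L a)). ?good y"
          using c(8) True tk by auto
        then have "set (take (Suc c) (L a)) \<subseteq> set xs"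
          using set_take_subset[of m xs] by blast
        then have "card (set (take (Suc c) (L a))) \<le> card (set xs)"
          by (intro card_mono) auto
        then have k: "Suc c \<le> k"
          using cl assms(8,9) d(2) by (simp add: distinct_card)
        have "t2 + 7 * (k + 1 - Suc c) \<le> t + 7 * k + 7" "R2 11 = (L a @ [n]) ! Suc c" "R2 20 = 0" "R2 19 = k"
          using P True c(2-4,6,7) y(4) k by auto
        then show ?thesis
          using g cl k c(3) by (intro exI[of _ "k + 1 - Suc c"] conjI disjI1 exI[of _ "Suc c"]) auto
      next
        case False
        then have "branch_point L (parent A) xs m (R2 21) (R2 22)"
          using P y(5) assms(10,11) by (auto simp: branch_point_def)
        moreover have "0 < p" "t2 \<le> t + 7 * k + 13"
          using P False c(2-4) by (auto split: if_splits)
        ultimately show ?thesis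
          using P False by (intro exI[of _ 0] conjI disjI2) auto
      qed
    qed (use R y assms(3) in \<open>auto simp: constants_def\<close>)
  next
    fix p R' A' Z' t'
    assume I: "?I p R' A' Z' t'" and h: "\<not> holds (Lt 11 0) R'" and U: "unchanged test_arc R A Z R' A' Z'"
    note U = unchangedD[OF U, unfolded test_arc_def next_arc_def found_def, simplified]
    have R: "R' 0 = n" using U(1) assms(1) by (auto simp: constants_def)
    have "c = length (L a)" if "c \<le> length (L a)" "R' 11 = (L a @ [n]) ! c" for c
      using that h R d(5)[of c] by (cases "c = length (L a)") (auto simp: nth_append)
    then show "Suc t' \<le> t + 7 * k + 14 \<and>
      (R' 20 = 0 \<and> R' 19 = k \<and> (\<forall>y\<in>set (L a). ?good y) \<or>
       R' 20 = 1 \<and> R' 19 = 0 \<and> branch_point L (parent A) xs m (R' 21) (R' 22))"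
      using I by fastforce
  qed
qed

text \<open>The vertices after the partial tree are added one by one; each is forced as long as no branching
  arc has been found.\<close>

lemma wp_scan:
  assumes "constants R" "represents A L" "R 1 = k" "R 15 = m0" "0 < m0" "m0 \<le> k" "k \<le> n"
    "distinct xs" "length xs = k" "set xs \<subseteq> {..<n}" "hd xs = r"
    "\<forall>i<k. A (4, i, 0) = xs ! i"
    "\<forall>v<n. A (2, v, 0) = (if v \<in> set (take m0 xs) then 2 else if v \<in> set xs then 1 else 0)"
    "finish_order (\<lambda>u. set (L u)) (parent A) (set (take m0 xs)) (drop m0 xs)"
  shows "wp scan (\<lambda>R' A' Z' t'. t' \<le> t + 40 * k\<^sup>2 + 10 \<and> m0 \<le> R' 15 \<and> R' 15 \<le> k \<and>
    (\<forall>v<n. v \<notin> set xs \<longrightarrow> A' (2, v, 0) = 0) \<and>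
    solutions (\<lambda>u. set (L u)) r k (tree_arcs (parent A) (take (R' 15) xs)) =
      solutions (\<lambda>u. set (L u)) r k (tree_arcs (parent A) (take m0 xs)) \<and>
    (R' 20 = 0 \<and> R' 15 = k \<or>
     R' 20 = 1 \<and> R' 15 < k \<and> branch_point L (parent A) xs (R' 15) (R' 21) (R' 22))) R A Z t"
proof -
  let ?L = "\<lambda>u. set (L u)" and ?p = "parent A"
  let ?sol = "\<lambda>m. solutions ?L r k (tree_arcs ?p (take m xs))"
  let ?vis = "\<lambda>A m. \<forall>v<n. A (2, v, 0) = (if v \<in> set (take m xs) then 2 else if v \<in> set xs then 1 else 0)"
  \<comment> \<open>Bounds the ticks of one iteration: at most \<open>7 * k + 14\<close> for the
    neighbours of a vertex, the rest is constant.\<close>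
  define D where "D = 7 * k + 30"
  let ?I = "\<lambda>p R A' Z' t'. \<exists>m. R 15 = m \<and> m0 \<le> m \<and> m \<le> k \<and> ?vis A' m \<and> ?sol m = ?sol m0 \<and>
    ((\<exists>i\<le>k. p = k - i \<and> R 12 = i \<and> t' + D * p \<le> t + D * k + 5 \<and> R 20 = 0 \<and> R 19 = k \<and> m = max m0 i \<and>
        finish_order ?L ?p (set (take m xs)) (drop m xs) \<and> (m < k \<longrightarrow> scanned ?L ?p xs i m)) \<or>
     (p = 0 \<and> t' \<le> t + D * k + 5 \<and> R 20 = 1 \<and> R 19 = 0 \<and> m < k \<and> branch_point L ?p xs m (R 21) (R 22)))"
  let ?body = "Ld 10 4 12 2 ;; Cond (Lt 12 15) Skip (St 2 10 2 4 ;; Inc 15) ;;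
      Cond (Lt 15 1) (Ld 11 0 10 0 ;; Loop (Lt 11 0) test_arc) Skip ;; Inc 12"
  have "wp (Loop (Lt 12 19) ?body) (\<lambda>R' A' Z' t'. t' \<le> t + 40 * k\<^sup>2 + 10 \<and> m0 \<le> R' 15 \<and> R' 15 \<le> k \<and>
    (\<forall>v<n. v \<notin> set xs \<longrightarrow> A' (2, v, 0) = 0) \<and> ?sol (R' 15) = ?sol m0 \<and>
    (R' 20 = 0 \<and> R' 15 = k \<or> R' 20 = 1 \<and> R' 15 < k \<and> branch_point L ?p xs (R' 15) (R' 21) (R' 22)))
    (R(20 := 0, 12 := 0, 19 := k)) A Z (t + 3)"
  proof (rule wp_Loop[where I = ?I and i = k])
    show "?I k (R(20 := 0, 12 := 0, 19 := k)) A Z (t + 3)"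
      using assms(4,5,6,13,14)
      by (intro exI[of _ m0] conjI disjI1 exI[of _ "0::nat"]) (simp_all add: scanned_def)
  next
    fix p R' A' Z' t'
    assume I: "?I p R' A' Z' t'" and h: "holds (Lt 12 19) R'"
      and U: "unchanged ?body (R(20 := 0, 12 := 0, 19 := k)) A Z R' A' Z'"
    note U = unchangedD[OF U, unfolded test_arc_def next_arc_def found_def, simplified]
    have R: "R' 0 = n" "R' 2 = 0" "R' 3 = 1" "R' 4 = 2" "R' 1 = k"
      using U(1) assms(1,3) by (auto simp: constants_def)
    have A: "A' (4, i, 0) = xs ! i" if "i < k" for i
      using U(2) assms(12) that by simp
    have par: "parent A' = ?p" using U(2) by simp
    have rep: "represents A' L" using represents_cong[of A' A] U(2) assms(2) by simp
    from I h obtain i where i: "R' 12 = i" "i < k" "p = k - i" "t' + D * p \<le> t + D * k + 5" "R' 20 = 0" "R' 19 = k"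
      "R' 15 = max m0 i" "?vis A' (max m0 i)" "?sol (max m0 i) = ?sol m0"
      "finish_order ?L ?p (set (take (max m0 i) xs)) (drop (max m0 i) xs)"
      "max m0 i < k \<Longrightarrow> scanned ?L ?p xs i (max m0 i)"
      by auto
    define a m where "a = xs ! i" and "m = max m0 (Suc i)"
    have a: "a < n" using subsetD[OF assms(10) nth_mem[of i xs]] i(2) assms(9) by (simp add: a_def)
    have m: "m0 \<le> m" "m \<le> k" "i < m" using i(2) assms(6) by (auto simp: m_def)
    have tk: "take (Suc i) xs = take i xs @ [a]"
      using i(2) assms(9) by (simp add: take_Suc_conv_app_nth a_def)
    have new: "?sol m = ?sol m0 \<and> finish_order ?L ?p (set (take m xs)) (drop m xs)"
    proof (cases "i < m0")
      case True
      then have e: "max m0 i = m0" "m = m0" by (auto simp: m_def)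
      show ?thesis using i(10) unfolding e by simp
    next
      case False
      then have e: "max m0 i = i" "m = Suc i" by (auto simp: m_def)
      have "0 < i" using False assms(5) by simp
      from forced_vertex[OF i(10)[unfolded e] i(11)[unfolded e, OF i(2)] this _ assms(9,8,11)] i(2,9) assms(9)
      show ?thesis unfolding e by simp
    qed
    have sc: "scanned ?L ?p xs i m" if "m < k"
      using scanned_mono[OF i(11), of m] that i(2) m(1) by (auto simp: m_def max_def split: if_splits)
    define A2 where "A2 = (if i < m0 then A' else A'((2, a, 0) := 2))"
    have A2: "?vis A2 m"
    proof (cases "i < m0")
      case True
      then have e: "max m0 i = m0" "m = m0" by (auto simp: m_def)
      show ?thesis using i(8) True unfolding e A2_def by simp
    next
      case False
      then have e: "max m0 i = i" "m = Suc i" by (auto simp: m_def)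
      show ?thesis using i(8) False unfolding e A2_def tk by simp
    qed
    have A2': "A2 (0, u, v) = A' (0, u, v)" "A2 (Suc 0, u, v) = A' (Suc 0, u, v)" "parent A2 = ?p" for u v
      using par unfolding A2_def by (auto simp: fun_eq_iff)
    have rep2: "represents A2 L" using represents_cong[of A2 A'] A2' rep by simp
    let ?Q = "\<lambda>R A Z t. \<exists>j<p. ?I j R A Z t"
    let ?rest = "Cond (Lt 15 1) (Ld 11 0 10 0 ;; Loop (Lt 11 0) test_arc) Skip ;; Inc 12"
    have D1: "D * (k - Suc i) + D = D * (k - i)"
      using i(2) by (metis Suc_diff_Suc mult_Suc_right add.commute)
    have iB: "Suc i < B" "m < B" using i(2) m(2) assms(7) B by auto
    have cont: "?Q (R3(12 := Suc i)) A2 Z3 (Suc t3)"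
      if "R3 15 = m" "t3 \<le> t' + 7 * k + 24"
        "R3 20 = 0 \<and> R3 19 = k \<and> (m < k \<longrightarrow> (\<forall>y\<in>set (L a). y \<notin> set (take m xs) \<longrightarrow> y \<in> set xs \<and> ?p y = a)) \<or>
         R3 20 = 1 \<and> R3 19 = 0 \<and> m < k \<and> branch_point L ?p xs m (R3 21) (R3 22)" for R3 :: "nat \<Rightarrow> nat" and Z3 t3
      using that(3)
    proof
      assume f: "R3 20 = 0 \<and> R3 19 = k \<and> (m < k \<longrightarrow> (\<forall>y\<in>set (L a). y \<notin> set (take m xs) \<longrightarrow> y \<in> set xs \<and> ?p y = a))"
      have "scanned ?L ?p xs (Suc i) m" if "m < k"
        using sc[OF that] f that unfolding scanned_def a_def less_Suc_eq by blast
      moreover have "Suc t3 + D * (k - Suc i) \<le> t + D * k + 5"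
        using that(2) i(3,4) D1 by (simp add: D_def)
      moreover have "m = max m0 (Suc i)" by (simp add: m_def)
      moreover have "Suc i \<le> k" "R3 20 = 0" "R3 19 = k" using i(2) f by auto
      ultimately have "\<exists>i'\<le>k. k - Suc i = k - i' \<and> (R3(12 := Suc i)) 12 = i' \<and>
          Suc t3 + D * (k - Suc i) \<le> t + D * k + 5 \<and> (R3(12 := Suc i)) 20 = 0 \<and> (R3(12 := Suc i)) 19 = k \<and>
          m = max m0 i' \<and> finish_order ?L ?p (set (take m xs)) (drop m xs) \<and> (m < k \<longrightarrow> scanned ?L ?p xs i' m)"
        using new by (intro exI[of _ "Suc i"]) simp
      moreover have "(R3(12 := Suc i)) 15 = m" using that(1) by simp
      ultimately have "?I (k - Suc i) (R3(12 := Suc i)) A2 Z3 (Suc t3)"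
        using m(1,2) A2 conjunct1[OF new] by blast
      moreover have "k - Suc i < p" using i(2,3) by simp
      ultimately show ?thesis by blast
    next
      assume f: "R3 20 = 1 \<and> R3 19 = 0 \<and> m < k \<and> branch_point L ?p xs m (R3 21) (R3 22)"
      have "Suc t3 \<le> t + D * k + 5"
        using that(2) i(3,4) D1 by (simp add: D_def)
      then have "?I 0 (R3(12 := Suc i)) A2 Z3 (Suc t3)"
        using that(1) f m(1,2) A2 conjunct1[OF new] by simp
      moreover have "0 < p" using i(2,3) by simp
      ultimately show ?thesis by blast
    qed
    have rest: "wp ?rest ?Q R3 A2 Z' t3"
      if r: "R3 15 = m" "constants R3" "R3 10 = a" "R3 12 = i" "R3 20 = 0" "R3 19 = k" "R3 1 = k" "t3 \<le> t' + 5" for R3 t3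
    proof (cases "m < k")
      case True
      have cR: "constants (R3(11 := (L a @ [n]) ! 0))" using r(2) by (simp add: constants_def)
      note nb = wp_scan_neighbours[OF cR rep2 a _ _ _ _ assms(8,9) m(3) a_def[symmetric] A2]
      have "wp (Loop (Lt 11 0) test_arc) (wp (Inc 12) ?Q) (R3(11 := (L a @ [n]) ! 0)) A2 Z' (Suc (Suc t3))"
      proof (rule wp_mono[OF nb])
        fix R4 A4 Z4 t4
        assume U4: "unchanged (Loop (Lt 11 0) test_arc) (R3(11 := (L a @ [n]) ! 0)) A2 Z' R4 A4 Z4"
        assume P4: "t4 \<le> Suc (Suc t3) + 7 * k + 14 \<and>
          (R4 20 = 0 \<and> R4 19 = k \<and> (\<forall>y\<in>set (L a). y \<notin> set (take m xs) \<longrightarrow> y \<in> set xs \<and> parent A2 y = a) \<or>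
           R4 20 = 1 \<and> R4 19 = 0 \<and> branch_point L (parent A2) xs m (R4 21) (R4 22))"
        note U4 = unchangedD[OF U4, unfolded test_arc_def next_arc_def found_def, simplified]
        have "A4 x = A2 x" for x using U4(2) by (cases x) auto
        then have A4: "A4 = A2" by auto
        have P5: "R4 20 = 0 \<and> R4 19 = k \<and> (\<forall>y\<in>set (L a). y \<notin> set (take m xs) \<longrightarrow> y \<in> set xs \<and> ?p y = a) \<or>
           R4 20 = 1 \<and> R4 19 = 0 \<and> branch_point L ?p xs m (R4 21) (R4 22)" and "t4 \<le> t' + 7 * k + 24"
          using P4 r(8) fun_cong[OF A2'(3)] unfolding A2'(3) by auto
        have "?Q (R4(12 := Suc i)) A2 Z4 (Suc t4)"
          by (rule cont) (use P5 \<open>t4 \<le> t' + 7 * k + 24\<close> r(1) U4(1) True in auto)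
        then show "wp (Inc 12) ?Q R4 A4 Z4 t4"
          using U4(1) r(4) iB A4 by simp
      qed (use r in simp_all)
      moreover have "A2 (0, a, n) = (L a @ [n]) ! 0" by (rule representsD(6)[OF rep2 a])
      ultimately show ?thesis
        using True r a constantsD[OF r(2)] by (simp add: mem_cells)
    next
      case False
      have skip: "wp ?rest Q R3 A2 Z' t3" if "Q (R3(12 := Suc i)) A2 Z' (Suc (Suc t3))" for Q
        using that False r(1,4,7) iB by simp
      show ?thesis
        by (rule skip, rule cont) (use r False in auto)
    qed
    have i0: "i < n" using i(2) assms(7) by simp
    have init: "wp (Ld 10 4 12 2 ;; Cond (Lt 12 15) Skip (St 2 10 2 4 ;; Inc 15) ;; c) Q R' A' Z' (Suc t')"
      if "wp c Q (if i < m0 then R'(10 := a) else R'(10 := a, 15 := Suc i)) A2 Z'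
        (if i < m0 then Suc (Suc (Suc t')) else Suc (Suc (Suc (Suc (Suc t')))))" for c Q
      using that i(7) i0 A[OF i(2)] a iB(1)
      by (cases "i < m0") (simp_all add: R i(1) mem_cells A2_def a_def max_def)
    show "wp ?body ?Q R' A' Z' (Suc t')"
      by (rule init, rule rest) (use R i in \<open>auto simp: constants_def m_def max_def\<close>)
  next
    fix p R' A' Z' t'
    assume I: "?I p R' A' Z' t'" and h: "\<not> holds (Lt 12 19) R'"
      and U: "unchanged ?body (R(20 := 0, 12 := 0, 19 := k)) A Z R' A' Z'"
    from I obtain m where m: "R' 15 = m" "m0 \<le> m" "m \<le> k" "?vis A' m" "?sol m = ?sol m0"
      "(\<exists>i\<le>k. p = k - i \<and> R' 12 = i \<and> t' + D * p \<le> t + D * k + 5 \<and> R' 20 = 0 \<and> R' 19 = k \<and> m = max m0 i) \<or>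
       (t' \<le> t + D * k + 5 \<and> R' 20 = 1 \<and> R' 19 = 0 \<and> m < k \<and> branch_point L ?p xs m (R' 21) (R' 22))"
      by blast
    have "set (take m xs) \<subseteq> set xs" by (rule set_take_subset)
    then have "\<forall>v<n. v \<notin> set xs \<longrightarrow> A' (2, v, 0) = 0"
      using m(4) by auto
    moreover have "D * k \<le> 37 * k\<^sup>2"
      using assms(5,6) by (cases k) (auto simp: D_def power2_eq_square algebra_simps)
    then have "Suc t' \<le> t + 40 * k\<^sup>2 + 10"
      using m(6) by (auto intro: order.trans[rotated])
    moreover have "R' 20 = 0 \<and> m = k \<or> R' 20 = 1 \<and> m < k \<and> branch_point L ?p xs m (R' 21) (R' 22)"
      using m(3,6) h by auto
    ultimately show "Suc t' \<le> t + 40 * k\<^sup>2 + 10 \<and> m0 \<le> R' 15 \<and> R' 15 \<le> k \<and>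
      (\<forall>v<n. v \<notin> set xs \<longrightarrow> A' (2, v, 0) = 0) \<and> ?sol (R' 15) = ?sol m0 \<and>
      (R' 20 = 0 \<and> R' 15 = k \<or> R' 20 = 1 \<and> R' 15 < k \<and> branch_point L ?p xs (R' 15) (R' 21) (R' 22))"
      using m(1,2,3,5) by simp
  qed
  then show ?thesis
    using B assms(3) unfolding scan_def by (simp add: eval_nat_numeral)
qed

end

section \<open>The recursion below a fixed root\<close>

locale k_enumeration = enumeration +
  fixes k :: nat
  assumes k: "2 \<le> k" "k \<le> n"
begin

abbreviation arc_count :: "(nat \<Rightarrow> nat list) \<Rightarrow> nat" where
  "arc_count L \<equiv> \<Sum>u<n. length (L u)"

text \<open>The last conjunct bounds the stack. A frame pushed for the branch with the arc goes with
  a longer partial tree; when that frame is kept for the branch without the arc, one arc is gone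
  instead. The sum never increases.\<close>

definition node_state where
  "node_state L S r sp R A \<longleftrightarrow> constants R \<and> R 1 = k \<and> R 18 = k \<and> R 15 = length S \<and> R 23 = sp \<and> R 24 = 1 \<and>
     R 25 = 1 \<and> represents A L \<and> (\<forall>i<length S. A (4, i, 0) = S ! i) \<and> (\<forall>v<n. A (2, v, 0) = 0) \<and>
     partial_tree (\<lambda>u. set (L u)) (parent A) r S \<and> feasible (\<lambda>u. set (L u)) (set S) k \<and>
     length S \<le> k \<and> set S \<subseteq> {..<n} \<and> sp + arc_count L + (k - length S) \<le> D"

definition sols where
  "sols L A r S = solutions (\<lambda>u. set (L u)) r k (tree_arcs (parent A) S)"

definition leaf_outcome where
  "leaf_outcome L S r sp A Z R' A' Z' \<longleftrightarrow> R' 24 = 0 \<and> R' 23 = sp \<and>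
     (\<exists>T. sols L A r S = {set T} \<and> Z' = Z @ words_of T \<and> length T = k - 1 \<and> distinct T)"

text \<open>The branch with the arc is already set up as a \<open>node_state\<close>. For the other
  branch, started later from frame \<open>sp\<close>, the facts are recorded that will then be
  needed.\<close>

definition branch_outcome where
  "branch_outcome L S r sp A Z R' A' Z' \<longleftrightarrow> (\<exists>S' a y. Z' = Z \<and> a \<in> set S' \<and> a < n \<and> y \<in> set (L a) \<and>
     length S \<le> length S' \<and> length S' < k \<and> set S' \<subseteq> {..<n} \<and> S = take (length S) S' \<and>
     node_state L (S' @ [y]) r (Suc sp) R' A' \<and>
     A' (6, sp, 0) = length S' \<and> A' (7, sp, 0) = a \<and> A' (8, sp, 0) = y \<and>
     partial_tree (\<lambda>u. set ((L(a := remove1 y (L a))) u)) (parent A') r S' \<and>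
     feasible (\<lambda>u. set ((L(a := remove1 y (L a))) u)) (set S') k \<and>
     sols L A r S = sols L A' r (S' @ [y]) \<union> sols (L(a := remove1 y (L a))) A' r S' \<and>
     sols L A' r (S' @ [y]) \<inter> sols (L(a := remove1 y (L a))) A' r S' = {} \<and>
     sols L A' r (S' @ [y]) \<noteq> {} \<and> sols (L(a := remove1 y (L a))) A' r S' \<noteq> {})"

lemma dfs_k:
  assumes "represents A L" "partial_tree (\<lambda>u. set (L u)) par r S" "length S \<le> k" "set S \<subseteq> {..<n}"
  shows "dfs L {..<n} k (k\<^sup>2) S"
proof
  show "card (SIGMA u:U. set (L u) \<inter> U) \<le> k\<^sup>2" if "U \<subseteq> {..<n}" "card U \<le> k" for U
  proof -
    have "finite U" using that(1) finite_subset by blast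
    then have "card (SIGMA u:U. set (L u) \<inter> U) \<le> card (U \<times> U)"
      by (intro card_mono) auto
    also have "\<dots> \<le> k\<^sup>2"
      using that(2) by (simp add: card_cartesian_product power2_eq_square mult_le_mono)
    finally show ?thesis .
  qed
  show "set (L u) \<subseteq> {..<n}" if "u \<in> {..<n}" for u
    using representsD(4)[OF assms(1), of u] that by blast
  show "distinct (L u)" if "u \<in> {..<n}" for u
    using representsD(2)[OF assms(1), of u] that by blast
  show "distinct S" using assms(2) by (simp add: partial_tree_def)
qed (use assms(3,4) in simp_all)

lemma finite_sols:
  assumes "represents A L" "r < n"
  shows "finite (sols L A' r S)"
  unfolding sols_def
proof (rule finite_solutions[of r "{..<n}"])
  show "set (L u) \<subseteq> {..<n}" if "u \<in> {..<n}" for u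
    using representsD(4)[OF assms(1), of u] that by blast
qed (use assms(2) in simp_all)

text \<open>Searching, scanning, clearing and printing take at most \<open>50 * k^2 + 50 * k\<close>
  ticks plus a constant, which \<open>k \<ge> 2\<close> absorbs into
  \<open>90 * k^2\<close>.\<close>

lemma wp_node:
  assumes st: "node_state L S r sp R A"
  shows "wp node (\<lambda>R' A' Z' t'. t' \<le> t + 90 * k\<^sup>2 \<and> (\<forall>v<n. A' (2, v, 0) = 0) \<and>
     (\<forall>i<sp. \<forall>j\<in>{6,7,8}. A' (j, i, 0) = A (j, i, 0)) \<and>
     (\<forall>i<length S. A' (4, i, 0) = S ! i) \<and> (\<forall>u\<in>set S. parent A' u = parent A u) \<and>
     (leaf_outcome L S r sp A Z R' A' Z' \<or> branch_outcome L S r sp A Z R' A' Z')) R A Z t"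
proof -
  let ?L = "\<lambda>u. set (L u)"
  note st = st[unfolded node_state_def]
  have C: "constants R" and R: "R 1 = k" "R 18 = k" "R 15 = length S" "R 23 = sp" "R 24 = 1" "R 25 = 1"
    and rep: "represents A L" and o: "\<forall>i<length S. A (4, i, 0) = S ! i" and v: "\<forall>v<n. A (2, v, 0) = 0"
    and pt: "partial_tree ?L (parent A) r S" and fe: "feasible ?L (set S) k"
    and le: "length S \<le> k" and Sn: "set S \<subseteq> {..<n}" and sp: "sp + arc_count L + (k - length S) \<le> D"
    using st by auto
  have ne: "S \<noteq> []" using pt by (simp add: partial_tree_def)
  let ?Q = "\<lambda>R' A' Z' t'. t' \<le> t + 90 * k\<^sup>2 \<and> (\<forall>v<n. A' (2, v, 0) = 0) \<and>
     (\<forall>i<sp. \<forall>j\<in>{6,7,8}. A' (j, i, 0) = A (j, i, 0)) \<and>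
     (\<forall>i<length S. A' (4, i, 0) = S ! i) \<and> (\<forall>u\<in>set S. parent A' u = parent A u) \<and>
     (leaf_outcome L S r sp A Z R' A' Z' \<or> branch_outcome L S r sp A Z R' A' Z')"
  show ?thesis
    unfolding node_def wp_simps(10)
  proof (rule wp_mono[OF wp_search[OF dfs_k[OF rep pt le Sn] ne rep C R(3,2) k(2) o v fe]], goal_cases)
    case (1 R1 A1 Z1 t1)
    note U1 = unchangedD[OF 1(1), unfolded search_def mark_def advance_def finish_def, simplified]
    from 1(2) obtain fs where fs: "length (S @ fs) = k" "distinct (S @ fs)" "set (S @ fs) \<subseteq> {..<n}"
     "finish_order ?L (parent A1) (set S) fs" "\<forall>i<k. A1 (4, i, 0) = (S @ fs) ! i"
     "\<forall>u\<in>set S. parent A1 u = parent A u"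
     "\<forall>v<n. A1 (2, v, 0) = (if v \<in> set S then 2 else if v \<in> set fs then 1 else 0)"
     "t1 \<le> t + 40 * k + 10 * k\<^sup>2 + 10" by blast
    define xs where "xs = S @ fs"
    have xs: "length xs = k" "distinct xs" "set xs \<subseteq> {..<n}" "take (length S) xs = S" "drop (length S) xs = fs"
      using fs by (auto simp: xs_def)
    have Z1: "Z1 = Z" using U1(3) .
    have C1: "constants R1" and R1: "R1 1 = k" "R1 18 = k" "R1 15 = length S" "R1 23 = sp" "R1 24 = 1" "R1 25 = 1"
      using C R U1(1) by (auto simp: constants_def)
    have rep1: "represents A1 L" using rep represents_cong[of A1 A] U1(2) by simp
    have pt1: "partial_tree ?L (parent A1) r S"
      using pt partial_tree_cong[of S "parent A" "parent A1" ?L r] fs(6) by simp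
    have hd: "hd xs = r" using pt ne by (simp add: partial_tree_def xs_def)
    have sols1: "sols L A r S = solutions ?L r k (tree_arcs (parent A1) S)"
      using tree_arcs_cong[of S "parent A" "parent A1"] fs(6) by (simp add: sols_def)
    have ptm: "partial_tree ?L (parent A1) r (take m xs)" if "length S \<le> m" for m
      using partial_tree_take[OF pt1 fs(4,2), of "m - length S"] that by (simp add: xs_def)
    have vis1: "\<forall>v<n. A1 (2, v, 0) = (if v \<in> set (take (length S) xs) then 2 else if v \<in> set xs then 1 else 0)"
      using fs(7) by (auto simp: xs_def)
    have ord1: "\<forall>i<k. A1 (4, i, 0) = xs ! i" using fs(5) by (simp add: xs_def)
    have fin1: "finish_order ?L (parent A1) (set (take (length S) xs)) (drop (length S) xs)"
      using fs(4) xs by simp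
    have S0: "0 < length S" using ne by simp
    show ?case
      unfolding wp_simps(10)
    proof (rule wp_mono[OF wp_scan[OF C1 rep1 R1(1,3) S0 le k(2) xs(2,1,3) hd ord1 vis1 fin1]], goal_cases)
      case (1 R2 A2 Z2 t2)
      note U2 = unchangedD[OF 1(1), unfolded scan_def test_arc_def next_arc_def found_def, simplified]
      define m where "m = R2 15"
      from 1(2) have P2: "t2 \<le> t1 + 40 * k\<^sup>2 + 10" "length S \<le> m" "m \<le> k" "\<forall>v<n. v \<notin> set xs \<longrightarrow> A2 (2, v, 0) = 0"
        "solutions ?L r k (tree_arcs (parent A1) (take m xs)) = solutions ?L r k (tree_arcs (parent A1) S)"
        "R2 20 = 0 \<and> m = k \<or> R2 20 = 1 \<and> m < k \<and> branch_point L (parent A1) xs m (R2 21) (R2 22)"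
        unfolding m_def[symmetric] xs(4) by blast+
      have Z2: "Z2 = Z" using U2(3) Z1 by simp
      have C2: "constants R2" and R2: "R2 1 = k" "R2 18 = k" "R2 23 = sp" "R2 24 = 1" "R2 25 = 1" "R2 15 = m"
        using C1 R1 U2(1) m_def by (auto simp: constants_def)
      have rep2: "represents A2 L" using rep1 represents_cong[of A2 A1] U2(2) by simp
      have ord2: "\<forall>i<length xs. A2 (4, i, 0) = xs ! i" using ord1 U2(2) xs(1) by simp
      have R2': "R2 18 = length xs" using R2 xs by simp
      show ?case
        unfolding wp_simps(10)
      proof (rule wp_mono[OF wp_clear[OF C2 R2' ord2 xs(3,2) P2(4)]], goal_cases)
        case (1 R3 A3 Z3 t3)
        note U3 = unchangedD[OF 1(1), unfolded clear_def, simplified]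
        from 1(2) have P3: "\<forall>v<n. A3 (2, v, 0) = 0" "t3 \<le> t2 + 4 * k + 2" using xs(1) by auto
        have Z3: "Z3 = Z" using U3(3) Z2 by simp
        have C3: "constants R3" and R3: "R3 1 = k" "R3 18 = k" "R3 23 = sp" "R3 24 = 1" "R3 25 = 1" "R3 15 = m"
          "R3 20 = R2 20" "R3 21 = R2 21" "R3 22 = R2 22"
          using C2 R2 U3(1) by (auto simp: constants_def)
        have rep3: "represents A3 L" using rep2 represents_cong[of A3 A2] U3(2) by simp
        have ord3: "\<forall>i<length xs. A3 (4, i, 0) = xs ! i" using ord2 U3(2) by simp
        have par3: "parent A3 = parent A1" using U3(2) U2(2) by simp
        have stk: "A3 (j, i, 0) = A (j, i, 0)" if "j \<in> {6,7,8}" for i j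
          using that U1(2) U2(2) U3(2) by auto
        have parS: "\<forall>u\<in>set S. parent A3 u = parent A u" using par3 fs(6) by (metis)
        have ordS: "A3 (4, i, 0) = S ! i" if "i < length S" for i
          using ord3 that xs(1) le by (simp add: xs_def nth_append)
        have kk: "2 * k \<le> k\<^sup>2" "4 \<le> k\<^sup>2"
          using k(1) mult_le_mono[of 2 k 2 k] mult_le_mono1[of 2 k k] by (simp_all add: power2_eq_square)
        have t3: "t3 + 6 * k + 12 \<le> t + 90 * k\<^sup>2"
          using P3(2) P2(1) fs(8) kk by linarith
        show ?case
        proof (cases "R3 20 = 1")
          case False
          then have m: "m = k" using P2(6) R3(7) by auto
          have xsk: "R3 1 = length xs" "xs \<noteq> []" using R3 xs k by auto
          let ?T = "map (\<lambda>x. (parent A3 x, x)) (tl xs)"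
          have T: "set ?T = tree_arcs (parent A1) xs" "length ?T = k - 1" "distinct ?T"
            using xs(1,2) unfolding par3 tree_arcs_def parent_arcs_def
            by (auto simp: distinct_map distinct_tl inj_on_def fun_cong[OF par3] image_iff)
          have "partial_tree ?L (parent A1) r xs" using ptm[of k] xs(1) le by simp
          from solutions_complete[OF this xs(1)] have "sols L A r S = {set ?T}"
            unfolding T(1) sols1 P2(5)[symmetric] m using xs(1) by simp
          then have leaf: "leaf_outcome L S r sp A Z R4 A4 (Z @ words_of ?T)"
            if "R4 24 = 0" "R4 23 = sp" for R4 A4
            using that T(2,3) unfolding leaf_outcome_def by blast
          have "wp (print_tree ;; Cst 24 0) ?Q R3 A3 Z3 (Suc t3)"
            unfolding wp_simps(10)
          proof (rule wp_mono[OF wp_print_tree[OF C3 xsk(1) ord3 xs(3,2) xsk(2)]], goal_cases)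
            case (1 R4 A4 Z4 t4)
            note U4 = unchangedD[OF 1(1), unfolded print_tree_def, simplified]
            have "A4 x = A3 x" for x using U4(2) by (cases x) auto
            then have A4: "A4 = A3" by auto
            have "leaf_outcome L S r sp A Z (R4(24 := 0)) A4 Z4"
              using leaf[of "R4(24 := 0)" A4] 1(2) Z3 U4(1) R3 by simp
            moreover have "Suc t4 \<le> t + 90 * k\<^sup>2" using 1(2) t3 xs(1) by simp
            ultimately show ?case
              using P3(1) stk ordS parS B unfolding A4 by simp
          qed
          moreover have "R3 3 = 1" using constantsD[OF C3] by simp
          ultimately show ?thesis using False by simp
        next
          case True
          then have m: "m < k" and bp: "branch_point L (parent A1) xs m (R3 21) (R3 22)"
            using P2(6) R3 by auto
          define a y S' where "a = R3 21" and "y = R3 22" and "S' = take m xs"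
          from bp obtain i where i: "i < m" "a = xs ! i" "y \<in> set (L a)" "y \<notin> set (take m xs)"
            "\<not> (y \<in> set xs \<and> parent A1 y = a)"
            unfolding branch_point_def a_def y_def by blast
          have lS': "length S' = m" using m xs(1) by (simp add: S'_def)
          have aS: "a \<in> set S'" using i m nth_mem[of i S'] lS' by (simp add: S'_def)
          have S'n: "set S' \<subseteq> {..<n}" using xs(3) set_take_subset[of m xs] by (auto simp: S'_def)
          have an: "a < n" using aS S'n by auto
          have yn: "y < n" using representsD(4)[OF rep an i(3)] .
          have yS': "y \<notin> set S'" using i(4) by (simp add: S'_def)
          have SS': "S = take (length S) S'" using P2(2) xs(4) by (simp add: S'_def min_def)
          have SsubS': "set S \<subseteq> set S'" using SS' by (metis set_take_subset)
          have "r \<in> set S" using pt unfolding partial_tree_def by (metis hd_in_set)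
          then have rn: "r < n" using Sn by auto
          have fin: "finite (solutions ?L r k (tree_arcs (parent A1) (take m xs)))"
            using finite_sols[OF rep rn, of A1] by (simp add: sols_def)
          have fe': "feasible ?L (set (take m xs)) k"
            using feasible_mono[OF fe SsubS'] by (simp add: S'_def)
          have ptx: "partial_tree ?L (parent A1) r xs" using ptm[of k] xs(1) le by simp
          have m0: "0 < m" using P2(2) S0 by linarith
          note br = branch_arc[OF ptx xs(1) m0 m i(1) i(3)[unfolded i(2)] i(4) i(5)[unfolded i(2)] fe'
            ptm[OF P2(2)] fin, folded i(2), folded S'_def]
          let ?L' = "L(a := remove1 y (L a))"
          have L': "(\<lambda>u. set (L u))(a := set (L a) - {y}) = (\<lambda>u. set (?L' u))"
            using representsD(2)[OF rep an] by (auto simp: fun_eq_iff)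
          let ?A = "A3((6, sp, 0) := m, (7, sp, 0) := a, (8, sp, 0) := y, (4, m, 0) := y, (3, y, 0) := a)"
          let ?R = "R3(23 := Suc sp, 15 := Suc m)"
          have p': "(parent A1)(y := a) = parent ?A" using par3 by (auto simp: fun_eq_iff)
          have pe: "tree_arcs (parent ?A) S' = tree_arcs (parent A1) S'"
            by (rule tree_arcs_cong) (use yS' fun_cong[OF par3] in auto)
          note br = br[unfolded L' p']
          have pt': "partial_tree (\<lambda>u. set (?L' u)) (parent ?A) r S'"
          proof -
            have "partial_tree (\<lambda>u. set (?L' u)) (parent ?A) r S' \<longleftrightarrow>
              partial_tree (\<lambda>u. set (?L' u)) (parent A1) r S'"
              by (rule partial_tree_cong) (use yS' fun_cong[OF par3] in auto)
            with br(3) show ?thesis by simp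
          qed
          have rep4: "represents ?A L" using rep3 represents_cong[of ?A A3] by simp
          have ord4: "\<forall>i<length (S' @ [y]). ?A (4, i, 0) = (S' @ [y]) ! i"
            using ord3 lS' m xs(1) by (auto simp: nth_append S'_def less_Suc_eq)
          have arcs: "1 \<le> arc_count L"
            using member_le_sum[of a "{..<n}" "\<lambda>u. length (L u)"] an i(3) by (cases "L a") auto
          have ns: "node_state L (S' @ [y]) r (Suc sp) ?R ?A"
            unfolding node_state_def using C3 R3 rep4 ord4 P3(1) br(1,2) lS' m S'n yn sp P2(2)
            by (auto simp: constants_def)
          have "branch_outcome L S r sp A Z ?R ?A Z"
            unfolding branch_outcome_def
          proof (intro exI conjI)
            show "sols L A r S = sols L ?A r (S' @ [y]) \<union> sols ?L' ?A r S'"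
              unfolding sols_def[of L ?A] sols_def[of ?L' ?A] pe sols1 P2(5)[symmetric] S'_def[symmetric] by (rule br(5))
            show "sols L ?A r (S' @ [y]) \<inter> sols ?L' ?A r S' = {}"
              unfolding sols_def[of L ?A] sols_def[of ?L' ?A] pe by (rule br(6))
            show "sols L ?A r (S' @ [y]) \<noteq> {}" unfolding sols_def by (rule br(7))
            show "sols ?L' ?A r S' \<noteq> {}" unfolding sols_def pe by (rule br(8))
            show "feasible (\<lambda>u. set (?L' u)) (set S') k" by (rule br(4))
          qed (use aS an i(3) P2(2) lS' m S'n SS' ns pt' in simp_all)
          moreover have "\<forall>i<length S. ?A (4, i, 0) = S ! i" using ordS P2(2) by auto
          moreover have "\<forall>u\<in>set S. parent ?A u = parent A u" using parS SsubS' yS' by auto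
          moreover have "\<forall>i<sp. \<forall>j\<in>{6,7,8}. ?A (j, i, 0) = A (j, i, 0)" using stk by auto
          moreover have "\<forall>v<n. ?A (2, v, 0) = 0" using P3(1) by simp
          moreover have "Suc (Suc (Suc (Suc (Suc (Suc (Suc (Suc t3))))))) \<le> t + 90 * k\<^sup>2" using t3 by simp
          ultimately have Q: "?Q ?R ?A Z (Suc (Suc (Suc (Suc (Suc (Suc (Suc (Suc t3))))))))" by blast
          have upd: "wp (Cond (Eq 20 3) (St 6 23 2 15 ;; St 7 23 2 21 ;; St 8 23 2 22 ;; Inc 23 ;;
              St 4 15 2 22 ;; St 3 22 2 21 ;; Inc 15) c) Q R3 A3 Z3 t3"
            if "Q ?R ?A Z (Suc (Suc (Suc (Suc (Suc (Suc (Suc (Suc t3))))))))" for Q c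
            using that sp arcs m k(2) B True yn
            by (simp add: R3(3,6) Z3 constantsD[OF C3] mem_cells a_def[symmetric] y_def[symmetric])
          show ?thesis by (rule upd) (rule Q)
        qed
      qed
    qed
  qed
qed

section \<open>Backtracking and the recursion\<close>

lemma wp_backtrack_stop:
  assumes "constants R" "R 23 = 0"
  shows "wp backtrack (\<lambda>R' A' Z' t'. R' 25 = 0 \<and> A' = A \<and> Z' = Z \<and> t' \<le> t + 2) R A Z t"
  using B unfolding backtrack_def by (simp add: constantsD[OF assms(1)] assms(2))

lemma wp_backtrack_exclude:
  assumes "constants R" "R 23 = Suc sp" "sp < D" "A (6, sp, 0) = l" "l \<noteq> 0" "A (7, sp, 0) = a" "A (8, sp, 0) = y"
    "represents A L" "a < n" "y \<in> set (L a)"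
  shows "wp backtrack (\<lambda>R' A' Z' t'. R' 23 = Suc sp \<and> R' 15 = l \<and> R' 24 = 1 \<and> R' 25 = R 25 \<and>
    A' = unlink (A((6, sp, 0) := 0)) a y \<and> t' \<le> t + 14) R A Z t"
proof -
  let ?A = "A((6, sp, 0) := 0)"
  have rep: "represents ?A L" using assms(8) represents_cong[of ?A A] by simp
  let ?R = "R(23 := Suc sp, 16 := l, 21 := a, 22 := y, 15 := l)"
  have "wp remove (wp (Cst 24 1) (\<lambda>R' A' Z' t'. R' 23 = Suc sp \<and> R' 15 = l \<and> R' 24 = 1 \<and> R' 25 = R 25 \<and>
    A' = unlink ?A a y \<and> t' \<le> t + 14)) (R(16 := l, 21 := a, 22 := y, 23 := Suc sp, 15 := l)) ?A Z
    (Suc (Suc (Suc (Suc (Suc (Suc (Suc (Suc (Suc t)))))))))"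
  proof (rule wp_mono[OF wp_remove[OF rep, where u = a and y = y]], goal_cases)
    case (5 R' A' Z' t')
    note U = unchangedD[OF 5(1), unfolded remove_def, simplified]
    show ?case using 5(2) U(1) B by simp
  qed (use assms in simp_all)
  then show ?thesis
    using assms(3,5) B unfolding backtrack_def
    by (simp add: constantsD[OF assms(1)] assms(2,4,6,7) mem_cells fun_upd_twist)
qed

text \<open>\<open>A0\<close> are the arrays before the removal. After the exploration without the
  arc only the link arrays are known to agree with \<open>unlink A0 a y\<close>, and this suffices
  for undoing it.\<close>

lemma wp_backtrack_return:
  assumes "constants R" "R 23 = Suc sp" "sp < D" "A (6, sp, 0) = 0" "A (7, sp, 0) = a" "A (8, sp, 0) = y"
    "represents A0 L" "a < n" "y \<in> set (L a)" "same_lists (unlink A0 a y) A"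
  shows "wp backtrack (\<lambda>R' A' Z' t'. R' 23 = sp \<and> R' 24 = R 24 \<and> R' 25 = R 25 \<and>
    same_lists A0 A' \<and> (\<forall>i. A' (6, i, 0) = A (6, i, 0)) \<and> t' \<le> t + 12) R A Z t"
proof -
  have "wp restore (\<lambda>R' A' Z' t'. R' 23 = sp \<and> R' 24 = R 24 \<and> R' 25 = R 25 \<and>
    same_lists A0 A' \<and> (\<forall>i. A' (6, i, 0) = A (6, i, 0)) \<and> t' \<le> t + 12)
    (R(23 := sp, 16 := 0, 21 := a, 22 := y)) A Z (Suc (Suc (Suc (Suc (Suc (Suc t))))))"
  proof (rule wp_mono[OF wp_restore[OF assms(7) _ _ assms(8,9,10)]], goal_cases)
    case (3 R' A' Z' t')
    note U = unchangedD[OF 3(1), unfolded restore_def, simplified]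
    show ?case using 3(2) U(1,2) by simp
  qed simp_all
  then show ?thesis
    using assms(3) unfolding backtrack_def
    by (simp add: constantsD[OF assms(1)] assms(2,4,5,6) mem_cells)
qed

definition listing where
  "listing Ts F \<longleftrightarrow> (\<forall>T\<in>set Ts. length T = k - 1 \<and> distinct T) \<and> distinct (map set Ts) \<and> set (map set Ts) = F"

lemma listing_append:
  "listing Ts F \<Longrightarrow> listing Ts' F' \<Longrightarrow> F \<inter> F' = {} \<Longrightarrow> listing (Ts @ Ts') (F \<union> F')"
  by (auto simp: listing_def)

text \<open>What a completed call owes its caller: links, lower stack frames and the data of the
  vertices in \<open>S\<close> are as before, and register 24 requests backtracking. Order and
  parents beyond \<open>S\<close> may have changed.\<close>

definition returned where
  "returned A S sp R' A' \<longleftrightarrow> constants R' \<and> R' 1 = k \<and> R' 18 = k \<and> R' 23 = sp \<and> R' 24 = 0 \<and> R' 25 = 1 \<and>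
     same_lists A A' \<and> (\<forall>v<n. A' (2, v, 0) = 0) \<and> (\<forall>i<sp. \<forall>j\<in>{6,7,8}. A' (j, i, 0) = A (j, i, 0)) \<and>
     (\<forall>i<length S. A' (4, i, 0) = A (4, i, 0)) \<and> (\<forall>u\<in>set S. parent A' u = parent A u)"

text \<open>One loop runs the whole recursion, so a call is specified by its continuation: what the
  loop achieves from every \<open>returned\<close> state it achieves from the node. The induction is
  on the number of solutions, which is smaller in both branches because neither is empty. The
  summand \<open>100 * k^2\<close> on the left of the time bound is the reserve that pays for binary
  nodes.\<close>

lemma enumerate_node:
  assumes "node_state L S r sp R A"
    and "\<And>R' A' t' Ts. returned A S sp R' A' \<Longrightarrow> listing Ts (sols L A r S) \<Longrightarrow>
      t' + 100 * k\<^sup>2 \<le> t + 200 * k\<^sup>2 * card (sols L A r S) \<Longrightarrow>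
      wp (Loop (Lt 2 25) (Cond (Eq 24 3) node backtrack)) Q R' A' (Z @ concat (map words_of Ts)) t'"
  shows "wp (Loop (Lt 2 25) (Cond (Eq 24 3) node backtrack)) Q R A Z t"
  using assms
proof (induction "card (sols L A r S)" arbitrary: L S sp R A Z t rule: less_induct)
  case less
  let ?loop = "Loop (Lt 2 25) (Cond (Eq 24 3) node backtrack)"
  note st = less.prems(1)[unfolded node_state_def] and cont = less.prems(2)
  have C: "constants R" and R: "R 1 = k" "R 18 = k" "R 24 = 1" "R 25 = 1"
    and rep: "represents A L" and o: "\<forall>i<length S. A (4, i, 0) = S ! i"
    and pt: "partial_tree (\<lambda>u. set (L u)) (parent A) r S" and Sn: "set S \<subseteq> {..<n}"
    using st by auto
  have "r \<in> set S" using pt unfolding partial_tree_def by (metis hd_in_set)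
  then have rn: "r < n" using Sn by auto
  have kk: "4 \<le> k\<^sup>2"
    using k(1) mult_le_mono[of 2 k 2 k] by (simp add: power2_eq_square)
  have "wp node (wp ?loop Q) R A Z (Suc (Suc t))"
  proof (rule wp_mono[OF wp_node[OF less.prems(1)]], goal_cases)
    case (1 R1 A1 Z1 t1)
    note U1 = unchangedD[OF 1(1), unfolded node_def search_def mark_def advance_def finish_def scan_def
      test_arc_def next_arc_def found_def clear_def print_tree_def, simplified]
    from 1(2) have P1: "t1 \<le> t + 2 + 90 * k\<^sup>2" "\<forall>v<n. A1 (2, v, 0) = 0"
      "\<forall>i<sp. \<forall>j\<in>{6,7,8}. A1 (j, i, 0) = A (j, i, 0)"
      "\<forall>i<length S. A1 (4, i, 0) = S ! i" "\<forall>u\<in>set S. parent A1 u = parent A u"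
      "leaf_outcome L S r sp A Z R1 A1 Z1 \<or> branch_outcome L S r sp A Z R1 A1 Z1"
      by simp_all
    have C1: "constants R1" and R1: "R1 1 = k" "R1 18 = k" "R1 25 = 1"
      using C R U1(1) by (auto simp: constants_def)
    have same1: "same_lists A A1" using U1(2) by (simp add: same_lists_def)
    from P1(6) show ?case
    proof
      assume "leaf_outcome L S r sp A Z R1 A1 Z1"
      then obtain T where T: "R1 24 = 0" "R1 23 = sp" "sols L A r S = {set T}" "Z1 = Z @ words_of T"
        "length T = k - 1" "distinct T"
        by (auto simp: leaf_outcome_def)
      have "wp ?loop Q R1 A1 (Z @ concat (map words_of [T])) t1"
      proof (rule cont)
        show "returned A S sp R1 A1"
          using C1 R1 T(1,2) same1 P1(2-5) o by (simp add: returned_def)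
        show "listing [T] (sols L A r S)" using T by (simp add: listing_def)
        show "t1 + 100 * k\<^sup>2 \<le> t + 200 * k\<^sup>2 * card (sols L A r S)"
          using P1(1) kk unfolding T(3) by simp
      qed
      then show ?thesis using T(4) by simp
    next
      assume "branch_outcome L S r sp A Z R1 A1 Z1"
      then obtain S' a y where b: "Z1 = Z" "a \<in> set S'" "a < n" "y \<in> set (L a)"
        "length S \<le> length S'" "length S' < k" "set S' \<subseteq> {..<n}" "S = take (length S) S'"
        "node_state L (S' @ [y]) r (Suc sp) R1 A1"
        "A1 (6, sp, 0) = length S'" "A1 (7, sp, 0) = a" "A1 (8, sp, 0) = y"
        "partial_tree (\<lambda>u. set ((L(a := remove1 y (L a))) u)) (parent A1) r S'"
        "feasible (\<lambda>u. set ((L(a := remove1 y (L a))) u)) (set S') k"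
        "sols L A r S = sols L A1 r (S' @ [y]) \<union> sols (L(a := remove1 y (L a))) A1 r S'"
        "sols L A1 r (S' @ [y]) \<inter> sols (L(a := remove1 y (L a))) A1 r S' = {}"
        "sols L A1 r (S' @ [y]) \<noteq> {}" "sols (L(a := remove1 y (L a))) A1 r S' \<noteq> {}"
        unfolding branch_outcome_def by blast
      define L' where "L' = L(a := remove1 y (L a))"
      let ?c1 = "card (sols L A1 r (S' @ [y]))" and ?c2 = "card (sols L' A1 r S')"
      note b' = b[folded L'_def]
      have finS: "finite (sols L A r S)" using finite_sols[OF rep rn] .
      then have fin: "finite (sols L A1 r (S' @ [y]))" "finite (sols L' A1 r S')"
        unfolding b'(15) by auto
      have cards: "card (sols L A r S) = ?c1 + ?c2" "0 < ?c1" "0 < ?c2"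
        unfolding b'(15) using fin b'(16,17,18) by (auto simp: card_Un_disjoint card_gt_0_iff)
      have SsubS': "set S \<subseteq> set S'" using b(8) by (metis set_take_subset)
      note st1 = b(9)[unfolded node_state_def]
      have rep1: "represents A1 L" and o1: "\<forall>i<length (S' @ [y]). A1 (4, i, 0) = (S' @ [y]) ! i"
        and sp1: "Suc sp + arc_count L + (k - length (S' @ [y])) \<le> D"
        using st1 by blast+
      have lS': "0 < length S'" using b(2) by (cases S') auto
      have arc: "Suc (arc_count L') = arc_count L"
      proof -
        have "a \<in> {..<n}" using b(3) by simp
        moreover have "Suc (length (L' a)) = length (L a)"
          using b(4) length_pos_if_in_set[OF b(4)] by (simp add: L'_def length_remove1)
        moreover have "(\<Sum>u\<in>{..<n} - {a}. length (L' u)) = (\<Sum>u\<in>{..<n} - {a}. length (L u))"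
          by (intro sum.cong) (auto simp: L'_def)
        ultimately show ?thesis
          by (simp add: sum.remove[of "{..<n}" a])
      qed
      have spD: "sp < D" using sp1 by simp
      have "wp ?loop Q R1 A1 Z t1"
      proof (rule less.hyps[OF _ b(9)])
        show "?c1 < card (sols L A r S)" using cards by simp
        fix R2 A2 t2 Ts1
        assume ret: "returned A1 (S' @ [y]) (Suc sp) R2 A2" and Ts1: "listing Ts1 (sols L A1 r (S' @ [y]))"
          and t2: "t2 + 100 * k\<^sup>2 \<le> t1 + 200 * k\<^sup>2 * ?c1"
        let ?Z = "Z @ concat (map words_of Ts1)"
        note r2 = ret[unfolded returned_def]
        have C2: "constants R2" and R2: "R2 1 = k" "R2 18 = k" "R2 23 = Suc sp" "R2 24 = 0" "R2 25 = 1"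
          and same2: "same_lists A1 A2" and stk2: "\<And>i j. i < Suc sp \<Longrightarrow> j \<in> {6,7,8} \<Longrightarrow> A2 (j, i, 0) = A1 (j, i, 0)"
          using r2 by auto
        have rep2: "represents A2 L" using represents_same_lists[OF same2] rep1 by simp
        have top: "A2 (6, sp, 0) = length S'" "A2 (7, sp, 0) = a" "A2 (8, sp, 0) = y"
          using stk2 b(10-12) by auto
        have "wp backtrack (wp ?loop Q) R2 A2 ?Z (Suc (Suc t2))"
        proof (rule wp_mono[OF wp_backtrack_exclude[OF C2 R2(3) spD top(1) _ top(2,3) rep2 b(3,4)]], goal_cases)
          case 1
          then show ?case using lS' by simp
        next
          case (2 R3 A3 Z3 t3)
          note U3 = unchangedD[OF 2(1), unfolded backtrack_def remove_def restore_def, simplified]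
          let ?A2 = "A2((6, sp, 0) := 0)"
          from 2(2) have P3: "R3 23 = Suc sp" "R3 15 = length S'" "R3 24 = 1" "R3 25 = 1" "A3 = unlink ?A2 a y"
            "t3 \<le> t2 + 16" using R2(5) by auto
          have Z3: "Z3 = ?Z" using U3(3) .
          have C3: "constants R3" and R3: "R3 1 = k" "R3 18 = k" "R3 25 = 1"
            using C2 R2 U3(1) P3(4) by (auto simp: constants_def)
          have rep2': "represents ?A2 L" using rep2 represents_cong[of ?A2 A2] by simp
          have rep3: "represents A3 L'"
            unfolding P3(5) L'_def by (rule represents_unlink(1)[OF rep2' b(3,4)])
          have A3: "A3 (j, u, 0) = A2 (j, u, 0)" if "1 < j" "j \<noteq> 6 \<or> u \<noteq> sp" for j u
            using that unfolding P3(5) unlink_def by auto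
          have par3: "parent A3 u = parent A1 u" if "u \<in> set S'" for u
            using A3[of 3 u] r2 that by auto
          have pt3: "partial_tree (\<lambda>u. set (L' u)) (parent A3) r S'"
          proof -
            have "partial_tree (\<lambda>u. set (L' u)) (parent A3) r S' \<longleftrightarrow> partial_tree (\<lambda>u. set (L' u)) (parent A1) r S'"
              by (rule partial_tree_cong) (use par3 in simp)
            with b'(13) show ?thesis by simp
          qed
          have sols3: "sols L' A3 r S' = sols L' A1 r S'"
          proof -
            have "tree_arcs (parent A3) S' = tree_arcs (parent A1) S'"
              by (rule tree_arcs_cong) (use par3 in simp)
            then show ?thesis by (simp add: sols_def)
          qed
          have ord3: "\<forall>i<length S'. A3 (4, i, 0) = S' ! i"
            using A3[of 4] r2 o1 by (simp add: nth_append)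
          have vis3: "\<forall>v<n. A3 (2, v, 0) = 0" using A3[of 2] r2 by simp
          \<comment> \<open>The frame stays on the stack during the second branch; the arc missing
            from \<open>L'\<close> makes up for it in the stack bound.\<close>
          have ns: "node_state L' S' r (Suc sp) R3 A3"
            unfolding node_state_def
            using C3 R3 P3(1-3) rep3 ord3 vis3 pt3 b'(14) b(6,7) sp1 arc by simp
          show ?case
            unfolding Z3
          proof (rule less.hyps[OF _ ns], unfold sols3)
            show "?c2 < card (sols L A r S)" using cards by simp
            fix R4 A4 t4 Ts2
            assume ret: "returned A3 S' (Suc sp) R4 A4" and Ts2: "listing Ts2 (sols L' A1 r S')"
              and t4: "t4 + 100 * k\<^sup>2 \<le> t3 + 200 * k\<^sup>2 * ?c2"
            let ?Z4 = "?Z @ concat (map words_of Ts2)"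
            note r4 = ret[unfolded returned_def]
            have C4: "constants R4" and R4: "R4 1 = k" "R4 18 = k" "R4 23 = Suc sp" "R4 24 = 0" "R4 25 = 1"
              and same4: "same_lists (unlink ?A2 a y) A4"
              and stk4: "\<And>i j. i < Suc sp \<Longrightarrow> j \<in> {6,7,8} \<Longrightarrow> A4 (j, i, 0) = A3 (j, i, 0)"
              using r4 P3(5) by auto
            have top4: "A4 (6, sp, 0) = 0" "A4 (7, sp, 0) = a" "A4 (8, sp, 0) = y"
              using stk4 A3[of 7 sp] A3[of 8 sp] top P3(5) by (auto simp: unlink_def)
            \<comment> \<open>The second call has left the links as it found them, so the removal of
              \<open>(a, y)\<close> is the latest change still in force and can be undone.\<close>
            have "wp backtrack (wp ?loop Q) R4 A4 ?Z4 (Suc (Suc t4))"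
            proof (rule wp_mono[OF wp_backtrack_return[OF C4 R4(3) spD top4 rep2' b(3,4) same4]], goal_cases)
              case (1 R5 A5 Z5 t5)
              have nb: "A5 (j, u, 0) = A4 (j, u, 0)" if "1 < j" "j \<noteq> 6" for j u
                using unchangedD(2)[OF 1(1), of j u 0] that
                by (simp add: backtrack_def remove_def restore_def)
              note U5 = unchangedD[OF 1(1), unfolded backtrack_def remove_def restore_def, simplified]
              from 1(2) have P5: "R5 23 = sp" "R5 24 = 0" "R5 25 = 1" "same_lists ?A2 A5"
                "\<forall>i. A5 (6, i, 0) = A4 (6, i, 0)" "t5 \<le> t4 + 14" using R4 by auto
              have C5: "constants R5" and R5: "R5 1 = k" "R5 18 = k"
                using C4 R4 U5(1) by (auto simp: constants_def)
              have same5: "same_lists A A5"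
                using same1 same2 P5(4) by (simp add: same_lists_def)
              have nb': "A5 (j, u, 0) = A4 (j, u, 0)" if "1 < j" for j u
                using nb[OF that] P5(5) by (cases "j = 6") auto
              have "wp ?loop Q R5 A5 (Z @ concat (map words_of (Ts1 @ Ts2))) t5"
              proof (rule cont)
                have stk5: "A5 (j, i, 0) = A (j, i, 0)" if ij: "i < sp" "j \<in> {6,7,8}" for i j
                proof -
                  have "A5 (j, i, 0) = A3 (j, i, 0)" using nb'[of j i] stk4[of i j] ij by auto
                  also have "\<dots> = A1 (j, i, 0)" using A3[of j i] stk2[of i j] ij by auto
                  finally show ?thesis using P1(3) ij by auto
                qed
                have ord5: "A5 (4, i, 0) = A (4, i, 0)" if i: "i < length S" for i
                proof -
                  have iS: "i < length S'" using i b(5) by simp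
                  have "A5 (4, i, 0) = S' ! i" using nb'[of 4 i] r4 ord3 iS by auto
                  also have "\<dots> = S ! i" using i b(8) by (metis nth_take)
                  finally show ?thesis using o i by simp
                qed
                have par5: "parent A5 u = parent A u" if u: "u \<in> set S" for u
                  using nb'[of 3 u] r4 par3[of u] P1(5) u SsubS' by auto
                have vis5: "\<forall>v<n. A5 (2, v, 0) = 0" using nb'[of 2] r4 by simp
                show "returned A S sp R5 A5"
                  unfolding returned_def using C5 R5 P5(1-3) same5 vis5 stk5 ord5 par5 by blast
                show "listing (Ts1 @ Ts2) (sols L A r S)"
                  unfolding b'(15) by (rule listing_append[OF Ts1 Ts2 b'(16)])
                have "200 * k\<^sup>2 * (?c1 + ?c2) = 200 * k\<^sup>2 * ?c1 + 200 * k\<^sup>2 * ?c2"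
                  by (rule add_mult_distrib2)
                then show "t5 + 100 * k\<^sup>2 \<le> t + 200 * k\<^sup>2 * card (sols L A r S)"
                  using P5(6) t4 P3(6) t2 P1(1) kk unfolding cards(1) by linarith
              qed
              then show ?case using U5(3) by simp
            qed
            then show "wp ?loop Q R4 A4 ?Z4 t4"
              by (intro wp_Loop_unfold) (simp add: constantsD[OF C4] R4(4,5))
          qed
        qed
        then show "wp ?loop Q R2 A2 ?Z t2"
          by (intro wp_Loop_unfold) (simp add: constantsD[OF C2] R2(4,5))
      qed
      then show ?thesis using b(1) by simp
    qed
  qed
  then show ?case
    by (intro wp_Loop_unfold) (simp add: constantsD[OF C] R(3,4))
qed

end

section \<open>From one root to all roots\<close>

context k_enumeration
begin

lemma wp_enumerate_root:
  assumes "constants R" "R 1 = k" "R 18 = k" "R 15 = 1" "A (4, 0, 0) = r" "represents A L"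
    "\<forall>v<n. A (2, v, 0) = 0" "feasible (\<lambda>u. set (L u)) {r} k" "r < n" "arc_count L + k \<le> D"
  shows "wp enumerate_root (\<lambda>R' A' Z' t'. same_lists A A' \<and> (\<forall>v<n. A' (2, v, 0) = 0) \<and>
     (\<exists>Ts. Z' = Z @ concat (map words_of Ts) \<and> listing Ts (solutions (\<lambda>u. set (L u)) r k {}) \<and>
       t' \<le> t + 200 * k\<^sup>2 * card (solutions (\<lambda>u. set (L u)) r k {}))) R A Z t"
proof -
  let ?R = "R(23 := 0, 24 := 1, 25 := 1)"
  have kk: "4 \<le> k\<^sup>2"
    using k(1) mult_le_mono[of 2 k 2 k] by (simp add: power2_eq_square)
  have pt: "partial_tree (\<lambda>u. set (L u)) (parent A) r [r]"
    using out_tree.root[of r] by (simp add: partial_tree_def tree_arcs_def parent_arcs_def)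
  have ns: "node_state L [r] r 0 ?R A"
    unfolding node_state_def using assms k pt by (auto simp: constants_def)
  have s: "sols L A r [r] = solutions (\<lambda>u. set (L u)) r k {}"
    by (simp add: sols_def tree_arcs_def parent_arcs_def)
  have loop: "wp (Loop (Lt 2 25) (Cond (Eq 24 3) node backtrack)) (\<lambda>R' A' Z' t'. same_lists A A' \<and> (\<forall>v<n. A' (2, v, 0) = 0) \<and>
     (\<exists>Ts. Z' = Z @ concat (map words_of Ts) \<and> listing Ts (solutions (\<lambda>u. set (L u)) r k {}) \<and>
       t' \<le> t + 200 * k\<^sup>2 * card (solutions (\<lambda>u. set (L u)) r k {}))) ?R A Z (Suc (Suc (Suc t)))" (is "wp ?loop ?Q _ _ _ _")
  proof (rule enumerate_node[OF ns], unfold s)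
    fix R1 A1 t1 Ts
    assume ret: "returned A [r] 0 R1 A1" and Ts: "listing Ts (solutions (\<lambda>u. set (L u)) r k {})"
      and t1: "t1 + 100 * k\<^sup>2 \<le> Suc (Suc (Suc t)) + 200 * k\<^sup>2 * card (solutions (\<lambda>u. set (L u)) r k {})"
    note r = ret[unfolded returned_def]
    have C1: "constants R1" and R1: "R1 23 = 0" "R1 24 = 0" "R1 25 = 1" using r by auto
    let ?Z = "Z @ concat (map words_of Ts)"
    have "wp backtrack (wp ?loop ?Q) R1 A1 ?Z (Suc (Suc t1))"
    proof (rule wp_mono[OF wp_backtrack_stop[OF C1 R1(1)]], goal_cases)
      case (1 R2 A2 Z2 t2)
      have U: "R2 2 = 0" using unchangedD(1)[OF 1(1), of 2] constantsD[OF C1]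
        by (simp add: backtrack_def remove_def restore_def)
      have "?Q R2 A1 ?Z (Suc t2)"
        using r Ts t1 1(2) kk by auto
      then show ?case
        using 1(2) U by (intro wp_Loop_unfold) simp
    qed
    then show "wp ?loop ?Q R1 A1 ?Z t1"
      by (intro wp_Loop_unfold) (simp add: constantsD[OF C1] R1(2,3))
  qed
  then show ?thesis
    unfolding enumerate_root_def using B by simp
qed

lemma wp_delete_root:
  assumes "constants R" "R 26 = q" "q < n" "A (5, q, 0) = r" "r < n" "represents A L"
    "\<And>u. u \<in> set (L r) \<Longrightarrow> r \<in> set (L u)"
  shows "wp delete_root (\<lambda>R' A' Z' t'. represents A' (\<lambda>u. if u \<in> set (L r) then remove1 r (L u) else L u) \<and>
     t' \<le> t + 6 * length (L r) + 3) R A Z t"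
proof -
  note d = representsD[OF assms(6,5)]
  define L' where "L' c u = (if u \<in> set (take c (L r)) then remove1 r (L u) else L u)" for c u
  have r: "r \<notin> set (L r)" using d(3)[of r] edges by blast
  \<comment> \<open>There are no self-loops, so the list that is being traversed is not affected by
    the removals.\<close>
  have L'r: "L' c r = L r" for c
    using r in_set_takeD by (fastforce simp: L'_def)
  let ?I = "\<lambda>p R A Z t'. \<exists>c\<le>length (L r). p = length (L r) - c \<and> t' + 6 * p \<le> t + 6 * length (L r) + 2 \<and>
    R 21 = (L r @ [n]) ! c \<and> represents A (L' c)"
  let ?body = "remove ;; Ld 21 0 22 21"
  have "wp (Loop (Lt 21 0) ?body) (\<lambda>R' A' Z' t'. represents A' (\<lambda>u. if u \<in> set (L r) then remove1 r (L u) else L u) \<and>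
     t' \<le> t + 6 * length (L r) + 3) (R(22 := r, 21 := (L r @ [n]) ! 0)) A Z (Suc (Suc t))"
  proof (rule wp_Loop[where I = ?I and i = "length (L r)"])
    show "?I (length (L r)) (R(22 := r, 21 := (L r @ [n]) ! 0)) A Z (Suc (Suc t))"
      using assms(6) by (intro exI[of _ "0::nat"]) (simp add: L'_def[abs_def])
  next
    fix p R' A' Z' t'
    assume I: "?I p R' A' Z' t'" and h: "holds (Lt 21 0) R'"
      and U: "unchanged ?body (R(22 := r, 21 := (L r @ [n]) ! 0)) A Z R' A' Z'"
    note U = unchangedD[OF U, unfolded remove_def, simplified]
    have R: "constants R'" "R' 22 = r" "R' 0 = n"
      using U(1) assms(1) by (auto simp: constants_def)
    from I obtain c where c: "c \<le> length (L r)" "p = length (L r) - c" "t' + 6 * p \<le> t + 6 * length (L r) + 2"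
      "R' 21 = (L r @ [n]) ! c" "represents A' (L' c)" by blast
    have cl: "c < length (L r)"
      using c(1,4) h R(3) by (cases "c = length (L r)") auto
    define u where "u = L r ! c"
    have u: "R' 21 = u" "u < n" "u \<in> set (L r)" "{r, u} \<in> E"
      using c(4) cl d(5,8)[OF cl] by (auto simp: u_def nth_append)
    have ur: "u \<noteq> r" using u(3) r by blast
    have tk: "take (Suc c) (L r) = take c (L r) @ [u]"
      using cl by (simp add: take_Suc_conv_app_nth u_def)
    have ut: "u \<notin> set (take c (L r))"
      using d(2) cl unfolding u_def by (metis distinct_take tk u_def distinct_append disjoint_iff list.set_intros(1))
    have L'u: "L' c u = L u" using ut by (simp add: L'_def)
    have step: "(L' c)(u := remove1 r (L' c u)) = L' (Suc c)"
      unfolding L'u using tk by (auto simp: L'_def fun_eq_iff)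
    show "wp ?body (\<lambda>R A Z t. \<exists>j<p. ?I j R A Z t) R' A' Z' (Suc t')"
      unfolding wp_simps(10)
    proof (rule wp_mono[OF wp_remove[OF c(5) u(1) R(2) u(2)]], goal_cases)
      case 1
      then show ?case using assms(7)[OF u(3)] L'u by simp
    next
      case (2 R2 A2 Z2 t2)
      note U2 = unchangedD[OF 2(1), unfolded remove_def, simplified]
      have rep: "represents A2 (L' (Suc c))"
        using represents_unlink(1)[OF c(5) u(2), of r] 2(2) assms(7)[OF u(3)] L'u step by simp
      have nx: "A2 (0, r, u) = (L r @ [n]) ! Suc c"
        using representsD(7)[OF rep assms(5), of c] cl by (simp add: L'r u_def)
      have "?I (length (L r) - Suc c) (R2(21 := (L r @ [n]) ! Suc c)) A2 Z2 (Suc t2)"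
        using c(2,3) cl 2(2) rep by (intro exI[of _ "Suc c"]) auto
      moreover have "length (L r) - Suc c < p" using c(2) cl by simp
      ultimately have "\<exists>j<p. ?I j (R2(21 := (L r @ [n]) ! Suc c)) A2 Z2 (Suc t2)" by blast
      moreover have "R2 22 = r" "R2 21 = u" using U2(1) R(2) u(1) by simp_all
      ultimately show ?case
        using nx u(4) assms(5) by (simp add: mem_cells)
    qed
  next
    fix p R' A' Z' t'
    assume I: "?I p R' A' Z' t'" and h: "\<not> holds (Lt 21 0) R'"
      and U: "unchanged ?body (R(22 := r, 21 := (L r @ [n]) ! 0)) A Z R' A' Z'"
    note U = unchangedD[OF U, unfolded remove_def, simplified]
    have R: "R' 0 = n" using U(1) assms(1) by (auto simp: constants_def)
    from I obtain c where c: "c \<le> length (L r)" "t' \<le> t + 6 * length (L r) + 2"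
      "R' 21 = (L r @ [n]) ! c" "represents A' (L' c)" by (auto intro: add_leD1)
    have "c = length (L r)"
      using c(1,3) h R d(5)[of c] by (cases "c = length (L r)") (auto simp: nth_append)
    then show "represents A' (\<lambda>u. if u \<in> set (L r) then remove1 r (L u) else L u) \<and>
      Suc t' \<le> t + 6 * length (L r) + 3"
      using c(2,4) by (simp add: L'_def[abs_def])
  qed
  then show ?thesis
    using assms(3,5) d(6) unfolding delete_root_def
    by (simp add: constantsD[OF assms(1)] assms(2,4) mem_cells)
qed

text \<open>Each neighbour of \<open>r\<close> loses one arc. In \<open>wp_all_roots\<close> an arc
  is worth seven ticks, and this loss pays for the deletion.\<close>

lemma arc_count_delete:
  assumes "represents A L" "r < n" "\<And>u. u \<in> set (L r) \<Longrightarrow> r \<in> set (L u)"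
  shows "arc_count (\<lambda>u. if u \<in> set (L r) then remove1 r (L u) else L u) + length (L r) = arc_count L"
proof -
  have sub: "set (L r) \<subseteq> {..<n}" using representsD(4)[OF assms(1,2)] by blast
  have "arc_count L = (\<Sum>u<n. length (if u \<in> set (L r) then remove1 r (L u) else L u) + (if u \<in> set (L r) then 1 else 0))"
  proof (rule sum.cong)
    fix u assume "u \<in> {..<n}"
    show "length (L u) = length (if u \<in> set (L r) then remove1 r (L u) else L u) + (if u \<in> set (L r) then 1 else 0)"
      using assms(3)[of u] length_pos_if_in_set[of r "L u"] by (simp add: length_remove1)
  qed simp
  also have "\<dots> = arc_count (\<lambda>u. if u \<in> set (L r) then remove1 r (L u) else L u) +
      (\<Sum>u<n. if u \<in> set (L r) then 1 else 0)"
    by (rule sum.distrib)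
  also have "(\<Sum>u<n. if u \<in> set (L r) then 1 else 0) = card (set (L r))"
    using sub by (simp add: sum.If_cases Int_absorb1 Int_commute)
  also have "\<dots> = length (L r)"
    using representsD(2)[OF assms(1,2)] by (simp add: distinct_card)
  finally show ?thesis by simp
qed

text \<open>Every prefix of the order induces a connected graph.\<close>

definition connected_order :: "nat list \<Rightarrow> bool" where
  "connected_order qs \<longleftrightarrow> distinct qs \<and> set qs = {..<n} \<and> (\<forall>j<length qs. 0 < j \<longrightarrow> (\<exists>i<j. {qs ! i, qs ! j} \<in> E))"

text \<open>A closed set containing the last vertex contains, by following earlier neighbours, the
  first one, and from there by induction all \<open>Suc q\<close> vertices of the prefix.\<close>

lemma connected_order_feasible:
  assumes "connected_order qs" "q < n" "k \<le> Suc q"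
    "\<And>u. u \<in> set (take (Suc q) qs) \<Longrightarrow> set (L u) = {v \<in> set (take (Suc q) qs). {u, v} \<in> E}"
  shows "feasible (\<lambda>u. set (L u)) {qs ! q} k"
  unfolding feasible_def
proof (intro allI impI)
  fix W assume W: "finite W" "{qs ! q} \<subseteq> W" "\<forall>w\<in>W. set (L w) \<subseteq> W"
  have len: "length qs = n" "distinct qs"
    using assms(1) distinct_card[of qs] by (auto simp: connected_order_def)
  have mem: "qs ! j \<in> set (take (Suc q) qs)" if "j \<le> q" for j
    using that assms(2) len nth_mem[of j "take (Suc q) qs"] by simp
  have arc: "qs ! i \<in> set (L (qs ! j))" if "i \<le> q" "j \<le> q" "{qs ! i, qs ! j} \<in> E" for i j
    using that assms(4)[OF mem[of j]] mem[of i] by (simp add: insert_commute)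
  have pre: "\<exists>i<j. {qs ! i, qs ! j} \<in> E" if "0 < j" "j \<le> q" for j
    using assms(1,2) that len unfolding connected_order_def by auto
  have down: "qs ! 0 \<in> W" if "j \<le> q" "qs ! j \<in> W" for j
    using that
  proof (induction j rule: less_induct)
    case (less j)
    show ?case
    proof (cases "j = 0")
      case False
      then obtain i where i: "i < j" "{qs ! i, qs ! j} \<in> E" using pre[of j] less.prems by auto
      then have "qs ! i \<in> W" using arc[of i j] less.prems W(3) by auto
      then show ?thesis using less.IH[OF i(1)] i(1) less.prems by simp
    qed (use less.prems in simp)
  qed
  have up: "qs ! j \<in> W" if "j \<le> q" for j
    using that
  proof (induction j rule: less_induct)
    case (less j)
    show ?case
    proof (cases "j = 0")
      case True
      then show ?thesis using down[of q] W(2) by simp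
    next
      case False
      then obtain i where i: "i < j" "{qs ! i, qs ! j} \<in> E" using pre[of j] less.prems by auto
      then have "qs ! i \<in> W" using less.IH less.prems by simp
      then show ?thesis using arc[of j i] i less.prems W(3) by (auto simp: insert_commute)
    qed
  qed
  have "set (take (Suc q) qs) \<subseteq> W"
    using up len assms(2) by (auto simp: in_set_conv_nth)
  then have "card (set (take (Suc q) qs)) \<le> card W" using W(1) card_mono by blast
  moreover have "card (set (take (Suc q) qs)) = Suc q"
    using len assms(2) by (simp add: distinct_card)
  ultimately show "k \<le> card W" using assms(3) by simp
qed

lemma edges_of_undirected: "edges_of T = undirected (set T)"
  by (simp add: edges_of_def undirected_def)

definition subtree_listing where
  "subtree_listing Ts F \<longleftrightarrow> (\<forall>T\<in>set Ts. length T = k - 1 \<and> distinct (map (\<lambda>(u, v). {u, v}) T)) \<and>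
     distinct (map edges_of Ts) \<and> set (map edges_of Ts) = F"

lemma subtree_listing_append:
  "subtree_listing Ts F \<Longrightarrow> subtree_listing Ts' F' \<Longrightarrow> F \<inter> F' = {} \<Longrightarrow> subtree_listing (Ts @ Ts') (F \<union> F')"
  by (auto simp: subtree_listing_def)

text \<open>Injectivity of \<open>undirected\<close> on the solutions of a root carries distinctness
  over from arc sets to edge sets.\<close>

lemma listing_subtree_listing:
  assumes "listing Ts (solutions L r k {})" "r \<in> U" "\<And>u. u \<in> U \<Longrightarrow> L u = {v \<in> U. {u, v} \<in> E}"
  shows "subtree_listing Ts {T \<in> k_subtrees E k. r \<in> \<Union>T \<and> \<Union>T \<subseteq> U}"
    "card (solutions L r k {}) = card {T \<in> k_subtrees E k. r \<in> \<Union>T \<and> \<Union>T \<subseteq> U}"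
proof -
  have u: "undirected ` solutions L r k {} = {T \<in> k_subtrees E k. r \<in> \<Union>T \<and> \<Union>T \<subseteq> U}"
    "inj_on undirected (solutions L r k {})"
    using undirected_solutions[of k r U L E] k(1) assms(2,3) by blast+
  have l: "\<forall>T\<in>set Ts. length T = k - 1 \<and> distinct T" "distinct (map set Ts)" "set ` set Ts = solutions L r k {}"
    using assms(1) by (auto simp: listing_def)
  show "card (solutions L r k {}) = card {T \<in> k_subtrees E k. r \<in> \<Union>T \<and> \<Union>T \<subseteq> U}"
    using card_image[OF u(2)] u(1) by simp
  have "distinct (map (\<lambda>(u, v). {u, v}) T)" if T: "T \<in> set Ts" for T
  proof (rule card_distinct)
    have "set T \<in> solutions L r k {}" using l(3) T by blast
    then obtain W where "out_tree r (set T) W" by (auto simp: solutions_def)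
    from card_undirected[OF this] show "card (set (map (\<lambda>(u, v). {u, v}) T)) = length (map (\<lambda>(u, v). {u, v}) T)"
      using l(1) T by (simp add: undirected_def distinct_card)
  qed
  moreover have "distinct (map edges_of Ts)"
  proof -
    have e: "map edges_of Ts = map undirected (map set Ts)"
      by (simp add: edges_of_undirected)
    show ?thesis
      unfolding e distinct_map[of undirected] using l(2,3) u(2) by simp
  qed
  moreover have "set (map edges_of Ts) = {T \<in> k_subtrees E k. r \<in> \<Union>T \<and> \<Union>T \<subseteq> U}"
  proof -
    have "set (map edges_of Ts) = undirected ` (set ` set Ts)"
      by (simp add: edges_of_undirected image_image)
    then show ?thesis unfolding l(3) u(1) .
  qed
  ultimately show "subtree_listing Ts {T \<in> k_subtrees E k. r \<in> \<Union>T \<and> \<Union>T \<subseteq> U}"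
    using l(1) by (simp add: subtree_listing_def)
qed

text \<open>A tree inside the first \<open>Suc q\<close> vertices but not inside the first
  \<open>q\<close> contains the root \<open>qs ! q\<close>; this makes the trees of different roots
  disjoint and exhaustive. The trees not yet listed, the arcs not yet deleted and the remaining
  roots carry the time still to be spent.\<close>

lemma wp_all_roots:
  assumes "constants R" "R 1 = k" "represents A L" "\<And>u. u < n \<Longrightarrow> set (L u) = {v. {u, v} \<in> E}"
    "\<forall>v<n. A (2, v, 0) = 0" "\<forall>i<n. A (5, i, 0) = qs ! i" "connected_order qs"
    "arc_count L + k \<le> D" "finite (k_subtrees E k)"
  shows "wp all_roots (\<lambda>R' A' Z' t'. \<exists>Ts. Z' = Z @ concat (map words_of Ts) \<and> subtree_listing Ts (k_subtrees E k) \<and>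
    t' \<le> t + 200 * k\<^sup>2 * card (k_subtrees E k) + 7 * arc_count L + 20 * n + 10) R A Z t"
proof -
  have qs: "length qs = n" "distinct qs" "set qs = {..<n}"
    using assms(7) distinct_card[of qs] by (auto simp: connected_order_def)
  let ?U = "\<lambda>q. set (take q qs)"
  let ?K = "\<lambda>q. {T \<in> k_subtrees E k. \<Union>T \<subseteq> ?U q}"
  let ?N = "\<lambda>q. {T \<in> k_subtrees E k. \<not> \<Union>T \<subseteq> ?U q}"
  let ?bound = "t + 200 * k\<^sup>2 * card (k_subtrees E k) + 7 * arc_count L + 20 * n + 4"
  let ?I = "\<lambda>q R A Z' t'. \<exists>L' Ts. k - 1 \<le> q \<and> q \<le> n \<and> R 26 = q \<and> represents A L' \<and>
    (\<forall>u\<in>?U q. set (L' u) = {v \<in> ?U q. {u, v} \<in> E}) \<and> (\<forall>v<n. A (2, v, 0) = 0) \<and> arc_count L' + k \<le> D \<and>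
    Z' = Z @ concat (map words_of Ts) \<and> subtree_listing Ts (?N q) \<and>
    t' + 200 * k\<^sup>2 * card (?K q) + 7 * arc_count L' + 20 * q \<le> ?bound"
  let ?body = "Dec 26 ;; Ld 10 5 26 2 ;; St 4 2 2 10 ;; Cst 15 1 ;; enumerate_root ;; delete_root"
  let ?R = "R(18 := k, 27 := k - 1, 26 := n)"
  \<comment> \<open>The assumption on \<open>E\<close> concerns edges written as pairs, so an edge
    at \<open>v\<close> is obtained by leaving \<open>{v}\<close> along the tree.\<close>
  have cover: "\<Union>T \<subseteq> {..<n}" if "T \<in> k_subtrees E k" for T
  proof
    fix v assume v: "v \<in> \<Union>T"
    have c: "connected_graph (\<Union>T) T" "card (\<Union>T) = k" "T \<subseteq> E"
      using that by (auto simp: k_subtrees_def)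
    have "\<Union>T \<noteq> {v}" using c(2) k(1) by auto
    then obtain w where w: "w \<in> \<Union>T" "w \<noteq> v" using v by blast
    have "(v, w) \<in> {(x, y). {x, y} \<in> T}\<^sup>*"
      using c(1) w v unfolding connected_graph_def by blast
    from rtrancl_crossing[OF this, of "{v}"] w(2) obtain y where "{v, y} \<in> T" by auto
    then show "v \<in> {..<n}" using c(3) edges by auto
  qed
  have "wp (Loop (Lt 27 26) ?body) (\<lambda>R' A' Z' t'. \<exists>Ts. Z' = Z @ concat (map words_of Ts) \<and>
    subtree_listing Ts (k_subtrees E k) \<and>
    t' \<le> t + 200 * k\<^sup>2 * card (k_subtrees E k) + 7 * arc_count L + 20 * n + 10) ?R A Z (Suc (Suc (Suc (Suc t))))"
  proof (rule wp_Loop[where I = ?I and i = n])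
    have "?U n = {..<n}" using qs by simp
    then have e: "?N n = {}" "?K n = k_subtrees E k" using cover by auto
    have "set (L u) = {v \<in> {..<n}. {u, v} \<in> E}" if "u < n" for u
      using assms(4)[OF that] edges by blast
    then show "?I n ?R A Z (Suc (Suc (Suc (Suc t))))"
      unfolding e using assms(3,5,8) k qs
      by (intro exI[of _ L] exI[of _ "[]"]) (auto simp: subtree_listing_def)
  next
    fix p R1 A1 Z1 t1
    assume I: "?I p R1 A1 Z1 t1" and h: "holds (Lt 27 26) R1" and U: "unchanged ?body ?R A Z R1 A1 Z1"
    note U = unchangedD[OF U, unfolded enumerate_root_def node_def search_def mark_def advance_def finish_def scan_def
      test_arc_def next_arc_def found_def clear_def print_tree_def backtrack_def remove_def restore_def delete_root_def,
      simplified]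
    have C1: "constants R1" and R1: "R1 1 = k" "R1 18 = k" "R1 27 = k - 1"
      using U(1) assms(1,2) by (auto simp: constants_def)
    have A15: "A1 (5, i, 0) = qs ! i" if "i < n" for i using U(2) assms(6) that by simp
    from I obtain L1 Ts where I: "k - 1 \<le> p" "p \<le> n" "R1 26 = p" "represents A1 L1"
      "\<forall>u\<in>?U p. set (L1 u) = {v \<in> ?U p. {u, v} \<in> E}" "\<forall>v<n. A1 (2, v, 0) = 0" "arc_count L1 + k \<le> D"
      "Z1 = Z @ concat (map words_of Ts)" "subtree_listing Ts (?N p)"
      "t1 + 200 * k\<^sup>2 * card (?K p) + 7 * arc_count L1 + 20 * p \<le> ?bound"
      by blast
    from h I(3) R1(3) have "k - 1 < p" by simp
    then obtain q where q: "p = Suc q" "k \<le> Suc q" "q < n" using I(2) by (cases p) auto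
    define r where "r = qs ! q"
    have Up: "?U (Suc q) = insert r (?U q)" using q(3) qs(1) by (simp add: take_Suc_conv_app_nth r_def)
    have rq: "r \<notin> ?U q"
    proof -
      have "take (Suc q) qs = take q qs @ [r]" using q(3) qs(1) by (simp add: take_Suc_conv_app_nth r_def)
      moreover have "distinct (take (Suc q) qs)" using qs(2) by (rule distinct_take)
      ultimately show ?thesis by simp
    qed
    have Un: "?U (Suc q) \<subseteq> {..<n}" using set_take_subset[of "Suc q" qs] qs(3) by simp
    have rn: "r < n" using Un Up by simp
    have LU: "\<And>u. u \<in> ?U (Suc q) \<Longrightarrow> set (L1 u) = {v \<in> ?U (Suc q). {u, v} \<in> E}" using I(5) q(1) by simp
    have feas: "feasible (\<lambda>u. set (L1 u)) {r} k"
      unfolding r_def by (rule connected_order_feasible[OF assms(7) q(3,2) LU])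
    have sym: "r \<in> set (L1 u)" if "u \<in> set (L1 r)" for u
      using LU[of r] LU[of u] that Up by (auto simp: insert_commute)
    let ?R1 = "R1(26 := q, 10 := r, 15 := 1)" and ?A1 = "A1((4, 0, 0) := r)"
    let ?Q = "\<lambda>R A Z t. \<exists>j<p. ?I j R A Z t"
    have rep: "represents ?A1 L1" using I(4) represents_cong[of ?A1 A1] by simp
    have pre: "constants ?R1" "?R1 1 = k" "?R1 18 = k" "?R1 15 = 1" "?A1 (4, 0, 0) = r" "\<forall>v<n. ?A1 (2, v, 0) = 0"
      using C1 R1 I(6) by (auto simp: constants_def)
    let ?s = "solutions (\<lambda>u. set (L1 u)) r k {}"
    have "wp enumerate_root (wp delete_root ?Q) ?R1 ?A1 Z1 (Suc (Suc (Suc (Suc (Suc t1)))))"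
    proof (rule wp_mono[OF wp_enumerate_root[OF pre(1-5) rep pre(6) feas rn I(7)]], goal_cases)
      case (1 R2 A2 Z2 t2)
      note U2 = unchangedD[OF 1(1), unfolded enumerate_root_def node_def search_def mark_def advance_def finish_def scan_def
        test_arc_def next_arc_def found_def clear_def print_tree_def backtrack_def remove_def restore_def, simplified]
      from 1(2) obtain Ts' where P2: "same_lists ?A1 A2" "\<forall>v<n. A2 (2, v, 0) = 0"
        "Z2 = Z1 @ concat (map words_of Ts')" "listing Ts' ?s" "t2 \<le> t1 + 5 + 200 * k\<^sup>2 * card ?s"
        by auto
      have C2: "constants R2" "R2 26 = q" using U2(1) C1 by (auto simp: constants_def)
      have rep2: "represents A2 L1" using represents_same_lists[OF P2(1)] rep by simp
      have A25: "A2 (5, q, 0) = r" using U2(2) A15[OF q(3)] by (simp add: r_def)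
      let ?L2 = "\<lambda>u. if u \<in> set (L1 r) then remove1 r (L1 u) else L1 u"
      show ?case
      proof (rule wp_mono[OF wp_delete_root[OF C2 q(3) A25 rn rep2 sym]], goal_cases)
        case (2 R3 A3 Z3 t3)
        note U3 = unchangedD[OF 2(1), unfolded delete_root_def remove_def, simplified]
        have R3: "R3 26 = q" and Z3: "Z3 = Z2" and vis3: "\<forall>v<n. A3 (2, v, 0) = 0"
          using U3 C2(2) P2(2) by auto
        note arcs = arc_count_delete[OF rep2 rn sym]
        have LU3: "set (?L2 u) = {v \<in> ?U q. {u, v} \<in> E}" if u: "u \<in> ?U q" for u
        proof -
          have "set (L1 u) = {v \<in> insert r (?U q). {u, v} \<in> E}" using LU[of u] Up u by simp
          moreover have "u \<in> set (L1 r) \<longleftrightarrow> {u, r} \<in> E" using LU[of r] Up u by (auto simp: insert_commute)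
          moreover have "distinct (L1 u)" using representsD(2)[OF rep2, of u] Un Up u by auto
          ultimately show ?thesis using rq by auto
        qed
        have rU: "r \<in> ?U (Suc q)" using Up by simp
        note ls = listing_subtree_listing[OF P2(4) rU LU]
        have N: "?N q = ?N (Suc q) \<union> {T \<in> k_subtrees E k. r \<in> \<Union>T \<and> \<Union>T \<subseteq> ?U (Suc q)}"
          "?N (Suc q) \<inter> {T \<in> k_subtrees E k. r \<in> \<Union>T \<and> \<Union>T \<subseteq> ?U (Suc q)} = {}"
          unfolding Up using rq by blast+
        have Kq: "card (?K (Suc q)) = card (?K q) + card ?s"
        proof -
          have "?K (Suc q) = ?K q \<union> {T \<in> k_subtrees E k. r \<in> \<Union>T \<and> \<Union>T \<subseteq> ?U (Suc q)}"
            "?K q \<inter> {T \<in> k_subtrees E k. r \<in> \<Union>T \<and> \<Union>T \<subseteq> ?U (Suc q)} = {}"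
            unfolding Up using rq by blast+
          then show ?thesis using assms(9) ls(2) by (simp add: card_Un_disjoint del: Union_iff)
        qed
        have "?I q R3 A3 Z3 t3"
        proof (intro exI[of _ ?L2] exI[of _ "Ts @ Ts'"] conjI)
          show "subtree_listing (Ts @ Ts') (?N q)"
            unfolding N(1) using subtree_listing_append[OF I(9)[unfolded q(1)] ls(1) N(2)] .
          have "200 * k\<^sup>2 * card (?K p) = 200 * k\<^sup>2 * card (?K q) + 200 * k\<^sup>2 * card ?s"
            unfolding q(1) Kq by (rule add_mult_distrib2)
          then show "t3 + 200 * k\<^sup>2 * card (?K q) + 7 * arc_count ?L2 + 20 * q \<le> ?bound"
            using I(10) arcs P2(5) 2(2) q(1) by simp
          show "Z3 = Z @ concat (map words_of (Ts @ Ts'))" using Z3 P2(3) I(8) by simp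
          show "arc_count ?L2 + k \<le> D" using arcs I(7) by linarith
          show "\<forall>u\<in>?U q. set (?L2 u) = {v \<in> ?U q. {u, v} \<in> E}" using LU3 by blast
          show "represents A3 ?L2" using 2(2) by blast
        qed (use q R3 vis3 in auto)
        then show ?case using q(1) by blast
      qed simp
    qed
    moreover have pre': "wp (Dec 26 ;; Ld 10 5 26 2 ;; St 4 2 2 10 ;; Cst 15 1 ;; c) Q R1 A1 Z1 (Suc t1)"
      if "wp c Q ?R1 ?A1 Z1 (Suc (Suc (Suc (Suc (Suc t1)))))" for c Q
      using that q(1,3) B A15[OF q(3)] by (simp add: constantsD[OF C1] I(3) mem_cells r_def)
    ultimately show "wp ?body ?Q R1 A1 Z1 (Suc t1)"
      by (intro pre') (simp only: wp_simps(10))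
  next
    fix p R1 A1 Z1 t1
    assume I: "?I p R1 A1 Z1 t1" and h: "\<not> holds (Lt 27 26) R1" and U: "unchanged ?body ?R A Z R1 A1 Z1"
    note U = unchangedD[OF U, unfolded enumerate_root_def node_def search_def mark_def advance_def finish_def scan_def
      test_arc_def next_arc_def found_def clear_def print_tree_def backtrack_def remove_def restore_def delete_root_def,
      simplified]
    have "R1 27 = k - 1" using U(1) by simp
    with I h have p: "p = k - 1" by auto
    have "?N p = k_subtrees E k"
    proof -
      have "\<not> \<Union>T \<subseteq> ?U p" if "T \<in> k_subtrees E k" for T
      proof
        assume "\<Union>T \<subseteq> ?U p"
        then have "card (\<Union>T) \<le> card (?U p)" by (intro card_mono) auto
        also have "\<dots> \<le> p" using card_length[of "take p qs"] by simp
        finally show False using that p k(1) by (simp add: k_subtrees_def)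
      qed
      then show ?thesis by blast
    qed
    with I show "\<exists>Ts. Z1 = Z @ concat (map words_of Ts) \<and> subtree_listing Ts (k_subtrees E k) \<and>
      Suc t1 \<le> t + 200 * k\<^sup>2 * card (k_subtrees E k) + 7 * arc_count L + 20 * n + 10"
      by fastforce
  qed
  then show ?thesis
    using assms(2) constantsD[OF assms(1)] unfolding all_roots_def by simp
qed

end

section \<open>Reading the input and ordering the roots\<close>

lemma linked_nthI:
  "(\<forall>i<length xs. A (0, u, (p # xs) ! i) = xs ! i \<and> A (1, u, xs ! i) = (p # xs) ! i) \<Longrightarrow>
   A (0, u, last (p # xs)) = n \<Longrightarrow> A (1, u, n) = last (p # xs) \<Longrightarrow> linked n A u p xs"
proof (induction xs arbitrary: p)
  case (Cons x xs)
  have "A (0, u, p) = x" "A (1, u, x) = p"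
    using Cons.prems(1)[rule_format, of 0] by simp_all
  moreover have "linked n A u x xs"
  proof (rule Cons.IH)
    show "\<forall>i<length xs. A (0, u, (x # xs) ! i) = xs ! i \<and> A (1, u, xs ! i) = (x # xs) ! i"
    proof (intro allI impI)
      fix i assume "i < length xs"
      then show "A (0, u, (x # xs) ! i) = xs ! i \<and> A (1, u, xs ! i) = (x # xs) ! i"
        using Cons.prems(1)[rule_format, of "Suc i"] by simp
    qed
  qed (use Cons.prems in simp_all)
  ultimately show ?case by simp
qed simp

definition list_start :: "nat list list \<Rightarrow> nat \<Rightarrow> nat" where
  "list_start adj u = Suc (length adj) + length (concat (take u adj))"

lemma list_start_Suc: "u < length adj \<Longrightarrow> list_start adj (Suc u) = list_start adj u + length (adj ! u)"
  by (simp add: list_start_def take_Suc_conv_app_nth)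

lemma list_start_mono: "u \<le> v \<Longrightarrow> v \<le> length adj \<Longrightarrow> list_start adj u \<le> list_start adj v"
  by (induction v rule: dec_induct) (auto simp: list_start_Suc)

lemma length_input_words: "length (input_words adj) = list_start adj (length adj)"
  by (simp add: input_words_def list_start_def)

lemma input_words_pointer: "u \<le> length adj \<Longrightarrow> input_words adj ! u = list_start adj u"
  by (simp add: input_words_def list_start_def nth_append del: upt_Suc)

lemma input_words_neighbour:
  assumes "u < length adj" "i < length (adj ! u)"
  shows "input_words adj ! (list_start adj u + i) = adj ! u ! i"
proof -
  have "concat adj = concat (take u adj) @ adj ! u @ concat (drop (Suc u) adj)"
    using id_take_nth_drop[OF assms(1)] by (metis concat.simps(2) concat_append)
  then have "concat adj ! (length (concat (take u adj)) + i) = adj ! u ! i"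
    using assms(2) by (simp add: nth_append)
  then show ?thesis
    by (simp add: input_words_def list_start_def nth_append del: upt_Suc)
qed

lemma finish_order_parent:
  "finish_order L par P zs \<Longrightarrow> i < length zs \<Longrightarrow> par (zs ! i) \<in> P \<union> set (take i zs) \<and> zs ! i \<in> L (par (zs ! i))"
proof (induction zs arbitrary: P i)
  case (Cons z zs)
  then show ?case
    by (cases i) auto
qed simp

context k_enumeration
begin

lemma wp_build_lists:
  assumes "constants R" "N = length (input_words adj)" "\<And>a. a < N \<Longrightarrow> inp a = input_words adj ! a" "N < B"
    "adjacency_lists n E adj"
  shows "wp build_lists (\<lambda>R' A' Z' t'. represents A' (\<lambda>u. adj ! u) \<and>
    t' \<le> t + 6 * arc_count (\<lambda>u. adj ! u) + 14 * n + 2) R A Z t"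
proof -
  have adj: "length adj = n" "\<And>u. u < n \<Longrightarrow> distinct (adj ! u) \<and> set (adj ! u) = {v. {u, v} \<in> E}"
    using assms(5) by (auto simp: adjacency_lists_def)
  let ?cost = "\<lambda>u. 6 * length (adj ! u) + 14"
  let ?in = "LdIn 8 6 ;; St 0 5 9 8 ;; St 1 5 8 9 ;; Mov 9 8 ;; Inc 6"
  let ?body = "LdIn 6 5 ;; Mov 9 5 ;; Inc 9 ;; LdIn 7 9 ;; Mov 9 0 ;; Loop (Lt 6 7) ?in ;;
      St 0 5 9 0 ;; St 1 5 0 9 ;; Inc 5"
  let ?I = "\<lambda>p R A Z t'. \<exists>u\<le>n. p = n - u \<and> R 5 = u \<and> (\<forall>w<u. linked n A w n (adj ! w)) \<and> t' \<le> t + 1 + sum ?cost {..<u}"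
  have start: "list_start adj u \<le> N" if "u \<le> n" for u
    using list_start_mono[of u n adj] that adj(1) assms(2) by (simp add: length_input_words)
  have "wp (Loop (Lt 5 0) ?body) (\<lambda>R' A' Z' t'. represents A' (\<lambda>u. adj ! u) \<and>
    t' \<le> t + 6 * arc_count (\<lambda>u. adj ! u) + 14 * n + 2) (R(5 := 0)) A Z (Suc t)"
  proof (rule wp_Loop[where I = ?I and i = n])
    show "?I n (R(5 := 0)) A Z (Suc t)" by simp
  next
    fix p R1 A1 Z1 t1
    assume I: "?I p R1 A1 Z1 t1" and h: "holds (Lt 5 0) R1" and U: "unchanged ?body (R(5 := 0)) A Z R1 A1 Z1"
    note U = unchangedD[OF U, simplified]
    have R1: "R1 0 = n" using U(1) assms(1) by (simp add: constants_def)
    from I h R1 obtain u where u: "u < n" "p = n - u" "R1 5 = u" "\<forall>w<u. linked n A1 w n (adj ! w)"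
      "t1 \<le> t + 1 + sum ?cost {..<u}" by auto
    define xs where "xs = adj ! u"
    have xs: "distinct xs" "set xs = {v. {u, v} \<in> E}" using adj(2)[OF u(1)] by (auto simp: xs_def)
    have xn: "v < n" if "v \<in> set xs" for v using that xs(2) edges by blast
    then have nxs: "n \<notin> set xs" by blast
    have dn: "distinct (n # xs)" using xs(1) nxs by simp
    let ?s = "list_start adj u"
    have ls: "?s + length xs = list_start adj (Suc u)" "list_start adj (Suc u) \<le> N"
      using list_start_Suc[of u adj] start[of "Suc u"] u(1) adj(1) by (simp_all add: xs_def)
    have sn: "Suc n \<le> ?s" using adj(1) by (simp add: list_start_def)
    have ptr: "inp u = ?s" "inp (Suc u) = ?s + length xs" "u < N" "Suc u < N"
    proof -
      show "u < N" "Suc u < N" using u(1) sn ls by auto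
      then show "inp u = ?s" "inp (Suc u) = ?s + length xs"
        using assms(3) input_words_pointer[of _ adj] u(1) adj(1) ls(1) by simp_all
    qed
    let ?R = "R1(6 := ?s, 7 := ?s + length xs, 9 := n)"
    \<comment> \<open>Register 9 trails one entry behind: \<open>(n # xs) ! c\<close> is the
      predecessor of \<open>xs ! c\<close>, the sentinel preceding the first entry.\<close>
    let ?J = "\<lambda>p R A' Z t'. \<exists>c\<le>length xs. p = length xs - c \<and> R 6 = ?s + c \<and> R 9 = (n # xs) ! c \<and>
      (\<forall>i<c. A' (0, u, (n # xs) ! i) = xs ! i \<and> A' (1, u, xs ! i) = (n # xs) ! i) \<and>
      (\<forall>j w v. w \<noteq> u \<longrightarrow> A' (j, w, v) = A1 (j, w, v)) \<and> t' \<le> t1 + 6 + 6 * c"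
    let ?Q = "\<lambda>R A Z t. \<exists>j<p. ?I j R A Z t"
    have inner: "wp (Loop (Lt 6 7) ?in) (wp (St 0 5 9 0 ;; St 1 5 0 9 ;; Inc 5) ?Q) ?R A1 Z1
      (Suc (Suc (Suc (Suc (Suc (Suc t1))))))"
    proof (rule wp_Loop[where I = ?J and i = "length xs"])
      show "?J (length xs) ?R A1 Z1 (Suc (Suc (Suc (Suc (Suc (Suc t1))))))"
        by (intro exI[of _ "0::nat"]) simp
    next
      fix p' R2 A2 Z2 t2
      assume J: "?J p' R2 A2 Z2 t2" and h: "holds (Lt 6 7) R2" and U: "unchanged ?in ?R A1 Z1 R2 A2 Z2"
      note U = unchangedD[OF U, simplified]
      have R2: "R2 5 = u" "R2 7 = ?s + length xs" using U(1) u(3) by simp_all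
      from J h R2 obtain c where c: "c < length xs" "p' = length xs - c" "R2 6 = ?s + c" "R2 9 = (n # xs) ! c"
        "\<forall>i<c. A2 (0, u, (n # xs) ! i) = xs ! i \<and> A2 (1, u, xs ! i) = (n # xs) ! i"
        "\<forall>j w v. w \<noteq> u \<longrightarrow> A2 (j, w, v) = A1 (j, w, v)" "t2 \<le> t1 + 6 + 6 * c" by auto
      have "inp (?s + c) = xs ! c"
        using assms(3)[of "?s + c"] input_words_neighbour[of u adj c] c(1) ls u(1) adj(1) by (simp add: xs_def)
      moreover have "?s + c < N" "Suc (?s + c) < B" using c(1) ls assms(4) by simp_all
      moreover have cell: "{u, xs ! c} \<in> E" "(n # xs) ! c = n \<or> {u, (n # xs) ! c} \<in> E"
        using xs(2) nth_mem[OF c(1)] nth_mem[of "c - 1" xs] c(1) by (cases c; auto)+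
      moreover have "xs ! c < n" using xn nth_mem[OF c(1)] by blast
      moreover have "\<exists>j<p'. ?J j (R2(8 := xs ! c, 9 := xs ! c, 6 := Suc (?s + c)))
        (A2((0, u, (n # xs) ! c) := xs ! c, (1, u, xs ! c) := (n # xs) ! c)) Z2 (Suc (Suc (Suc (Suc (Suc (Suc t2))))))"
      proof -
        let ?A = "A2((0, u, (n # xs) ! c) := xs ! c, (1, u, xs ! c) := (n # xs) ! c)"
        have ne: "(n # xs) ! i \<noteq> (n # xs) ! c" "xs ! i \<noteq> xs ! c" if "i < c" for i
        proof -
          have i: "i \<noteq> c" "i < length xs" "c < length xs" "i < length (n # xs)" "c < length (n # xs)"
            using that c(1) by auto
          show "(n # xs) ! i \<noteq> (n # xs) ! c" using nth_eq_iff_index_eq[OF dn i(4,5)] i(1) by blast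
          show "xs ! i \<noteq> xs ! c" using nth_eq_iff_index_eq[OF xs(1) i(2,3)] i(1) by blast
        qed
        have upd: "?A (0, u, (n # xs) ! i) = xs ! i \<and> ?A (1, u, xs ! i) = (n # xs) ! i" if "i < Suc c" for i
        proof (cases "i = c")
          case False
          then have "i < c" using that by simp
          then show ?thesis using ne[of i] c(5) by simp
        qed simp
        have "?J (length xs - Suc c) (R2(8 := xs ! c, 9 := xs ! c, 6 := Suc (?s + c))) ?A Z2
          (Suc (Suc (Suc (Suc (Suc (Suc t2))))))"
        proof (rule exI[of _ "Suc c"], intro conjI)
          show "\<forall>i<Suc c. ?A (0, u, (n # xs) ! i) = xs ! i \<and> ?A (1, u, xs ! i) = (n # xs) ! i"
            using upd by blast
        qed (use c in simp_all)
        moreover have "length xs - Suc c < p'" using c(1,2) by simp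
        ultimately show ?thesis by blast
      qed
      ultimately show "wp ?in (\<lambda>R A Z t. \<exists>j<p'. ?J j R A Z t) R2 A2 Z2 (Suc t2)"
        using u(1) by (simp add: R2(1) c(3,4) mem_cells)
    next
      fix p' R2 A2 Z2 t2
      assume J: "?J p' R2 A2 Z2 t2" and h: "\<not> holds (Lt 6 7) R2" and U: "unchanged ?in ?R A1 Z1 R2 A2 Z2"
      note U = unchangedD[OF U, simplified]
      have R2: "R2 5 = u" "R2 7 = ?s + length xs" "R2 0 = n" using U(1) u(3) R1 by simp_all
      from J h R2 have c: "R2 9 = (n # xs) ! length xs"
        "\<forall>i<length xs. A2 (0, u, (n # xs) ! i) = xs ! i \<and> A2 (1, u, xs ! i) = (n # xs) ! i"
        "\<forall>j w v. w \<noteq> u \<longrightarrow> A2 (j, w, v) = A1 (j, w, v)" "t2 \<le> t1 + 6 + 6 * length xs" by auto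
      define l where "l = last (n # xs)"
      have l: "(n # xs) ! length xs = l" using last_conv_nth[of "n # xs"] by (simp add: l_def)
      have lc: "l = n \<or> {u, l} \<in> E" using xs(2) last_in_set[of xs] by (auto simp: l_def)
      let ?A = "A2((0, u, l) := n, (1, u, n) := l)"
      have lk: "linked n ?A w n (adj ! w)" if "w < Suc u" for w
      proof (cases "w = u")
        case True
        have ne: "(n # xs) ! i \<noteq> l" "xs ! i \<noteq> n" if "i < length xs" for i
          using that dn nxs nth_mem[OF that] unfolding l[symmetric]
          by (auto simp: nth_eq_iff_index_eq simp del: distinct.simps nth_Cons_Suc)
        show ?thesis
          unfolding True xs_def[symmetric]
        proof (rule linked_nthI, fold l_def)
          show "\<forall>i<length xs. ?A (0, u, (n # xs) ! i) = xs ! i \<and> ?A (1, u, xs ! i) = (n # xs) ! i"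
            using c(2) ne by simp
        qed simp_all
      next
        case False
        have "linked n ?A w n (adj ! w) \<longleftrightarrow> linked n A1 w n (adj ! w)"
          using False c(3) by (intro linked_cong) auto
        then show ?thesis using u(4) that False by auto
      qed
      have "?I (n - Suc u) (R2(5 := Suc u)) ?A Z2 (Suc (Suc (Suc (Suc t2))))"
        using u(1,5) lk c(4) by (intro exI[of _ "Suc u"]) (auto simp: xs_def)
      moreover have "n - Suc u < p" using u(1,2) by simp
      ultimately have "?Q (R2(5 := Suc u)) ?A Z2 (Suc (Suc (Suc (Suc t2))))" by blast
      then show "wp (St 0 5 9 0 ;; St 1 5 0 9 ;; Inc 5) ?Q R2 A2 Z2 (Suc t2)"
        using u(1) B lc by (simp add: R2 c(1) l mem_cells)
    qed
    have init: "wp (LdIn 6 5 ;; Mov 9 5 ;; Inc 9 ;; LdIn 7 9 ;; Mov 9 0 ;; c) Q R1 A1 Z1 (Suc t1)"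
      if "wp c Q ?R A1 Z1 (Suc (Suc (Suc (Suc (Suc (Suc t1))))))" for c Q
      using that ptr u(1) B by (simp add: u(3) R1 fun_upd_twist)
    show "wp ?body ?Q R1 A1 Z1 (Suc t1)"
      by (rule init) (use inner in \<open>simp only: wp_simps(10)\<close>)
  next
    fix p R1 A1 Z1 t1
    assume I: "?I p R1 A1 Z1 t1" and h: "\<not> holds (Lt 5 0) R1" and U: "unchanged ?body (R(5 := 0)) A Z R1 A1 Z1"
    note U = unchangedD[OF U, simplified]
    have R1: "R1 0 = n" using U(1) assms(1) by (simp add: constants_def)
    from I h R1 have 1: "\<forall>w<n. linked n A1 w n (adj ! w)" "t1 \<le> t + 1 + sum ?cost {..<n}" by auto
    have "sum ?cost {..<n} = 6 * arc_count (\<lambda>u. adj ! u) + 14 * n"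
      by (simp add: sum.distrib sum_distrib_left)
    with 1 adj(2) show "represents A1 (\<lambda>u. adj ! u) \<and> Suc t1 \<le> t + 6 * arc_count (\<lambda>u. adj ! u) + 14 * n + 2"
      by (simp add: represents_def)
  qed
  then show ?thesis
    unfolding build_lists_def using B by simp
qed

text \<open>The code of the enumeration is reused with \<open>n\<close> as the required size and
  vertex 0 as the partial tree. In the order obtained every parent precedes its child, which
  supplies the earlier neighbour.\<close>

lemma wp_order_roots:
  assumes "constants R" "represents A L" "\<And>u. u < n \<Longrightarrow> set (L u) = {v. {u, v} \<in> E}"
    "\<forall>v<n. A (2, v, 0) = 0" "connected_graph {..<n} E"
  shows "wp order_roots (\<lambda>R' A' Z' t'. \<exists>qs. connected_order qs \<and> (\<forall>i<n. A' (5, i, 0) = qs ! i) \<and>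
    (\<forall>v<n. A' (2, v, 0) = 0) \<and> t' \<le> t + 50 * n + 10 * arc_count L + 20) R A Z t"
proof -
  let ?L = "\<lambda>u. set (L u)"
  have n0: "0 < n" using k by simp
  have dfs: "dfs L {..<n} n (arc_count L) [0]"
  proof
    show "set (L u) \<subseteq> {..<n}" if "u \<in> {..<n}" for u
      using representsD(4)[OF assms(2), of u] that by blast
    show "distinct (L u)" if "u \<in> {..<n}" for u
      using representsD(2)[OF assms(2), of u] that by blast
    show "card (SIGMA u:U. set (L u) \<inter> U) \<le> arc_count L" if "U \<subseteq> {..<n}" for U
    proof -
      have "card (SIGMA u:U. set (L u) \<inter> U) \<le> card (SIGMA u:{..<n}. set (L u))"
        using that by (intro card_mono) auto
      also have "\<dots> = (\<Sum>u<n. card (set (L u)))" by simp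
      also have "\<dots> \<le> arc_count L" by (intro sum_mono card_length)
      finally show ?thesis .
    qed
  qed (use n0 in simp_all)
  \<comment> \<open>A path from 0 to a missing vertex would leave the closed set along an
    edge.\<close>
  have feas: "feasible ?L (set [0]) n"
    unfolding feasible_def
  proof (intro allI impI)
    fix W assume W: "finite W" "set [0] \<subseteq> W" "\<forall>w\<in>W. ?L w \<subseteq> W"
    have "v \<in> W" if v: "v < n" for v
    proof (rule ccontr)
      assume nv: "v \<notin> W"
      have "(0, v) \<in> {(x, y). {x, y} \<in> E}\<^sup>*"
        using assms(5) n0 v unfolding connected_graph_def by blast
      from rtrancl_crossing[OF this _ nv] W(2) obtain a y where "a \<in> W" "y \<notin> W" "{a, y} \<in> E" by auto
      moreover have "a < n" using edges calculation(3) by blast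
      ultimately show False using W(3) assms(3) by blast
    qed
    then have "card {..<n} \<le> card W" using W(1) by (intro card_mono) auto
    then show "n \<le> card W" by simp
  qed
  let ?R = "R(18 := n, 15 := 1)" and ?A = "A((4, 0, 0) := 0)"
  have pre: "constants ?R" "?R 15 = length [0]" "?R 18 = n" "\<forall>i<length [0]. ?A (4, i, 0) = [0] ! i"
    "\<forall>v<n. ?A (2, v, 0) = 0" "represents ?A L"
    using assms(1,2,4) represents_cong[of ?A A] by (auto simp: constants_def)
  let ?copy = "Ld 10 4 12 2 ;; St 5 12 2 10 ;; Inc 12"
  let ?Q = "\<lambda>R' A' Z' t'. \<exists>qs. connected_order qs \<and> (\<forall>i<n. A' (5, i, 0) = qs ! i) \<and>
    (\<forall>v<n. A' (2, v, 0) = 0) \<and> t' \<le> t + 50 * n + 10 * arc_count L + 20"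
  have "wp search (wp ((Cst 12 0 ;; Loop (Lt 12 0) ?copy) ;; clear) ?Q) ?R ?A Z (Suc (Suc (Suc t)))"
  proof (rule wp_mono[OF wp_search[OF dfs _ pre(6,1,2,3) order.refl pre(4,5) feas]], goal_cases)
    case (2 R1 A1 Z1 t1)
    note U1 = unchangedD[OF 2(1), unfolded search_def mark_def advance_def finish_def, simplified]
    from 2(2) obtain fs where fs: "length ([0] @ fs) = n" "distinct ([0] @ fs)" "set ([0] @ fs) \<subseteq> {..<n}"
     "finish_order ?L (parent A1) (set [0]) fs" "\<forall>i<n. A1 (4, i, 0) = ([0] @ fs) ! i"
     "\<forall>v<n. A1 (2, v, 0) = (if v \<in> set [0] then 2 else if v \<in> set fs then 1 else 0)"
     "t1 \<le> t + 3 + 40 * n + 10 * arc_count L + 10" by auto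
    define qs where "qs = [0] @ fs"
    have qs: "length qs = n" "distinct qs" "set qs = {..<n}"
    proof -
      show "length qs = n" "distinct qs" using fs by (simp_all add: qs_def)
      then have "card (set qs) = card {..<n}" using distinct_card[of qs] by simp
      with fs(3) show "set qs = {..<n}" unfolding qs_def by (intro card_subset_eq) auto
    qed
    have order: "connected_order qs"
      unfolding connected_order_def
    proof (intro conjI allI impI qs)
      fix j assume j: "j < length qs" "0 < j"
      define p where "p = parent A1 (qs ! j)"
      have q: "qs ! j = fs ! (j - 1)" "j - 1 < length fs" using j by (auto simp: qs_def nth_Cons')
      from finish_order_parent[OF fs(4) q(2)] have p: "p \<in> set [0] \<union> set (take (j - 1) fs)" "qs ! j \<in> ?L p"
        unfolding p_def q(1) by auto
      have "set [0] \<union> set (take (j - 1) fs) = set (take j qs)" using j(2) by (cases j) (auto simp: qs_def)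
      with p(1) have "p \<in> set (take j qs)" by blast
      then obtain i where i: "i < j" "p = qs ! i" using j(1) by (auto simp: in_set_conv_nth)
      have "p < n" using i j(1) qs(3) nth_mem[of i qs] by auto
      then have "{p, qs ! j} \<in> E" using p(2) assms(3) by blast
      then show "\<exists>i<j. {qs ! i, qs ! j} \<in> E" using i by blast
    qed
    have C1: "constants R1" "R1 18 = n" using U1(1) assms(1) by (auto simp: constants_def)
    let ?I = "\<lambda>p R A' Z t'. \<exists>c\<le>n. p = n - c \<and> R 12 = c \<and> t' \<le> t1 + 1 + 4 * c \<and> (\<forall>i<c. A' (5, i, 0) = qs ! i)"
    have "wp (Loop (Lt 12 0) ?copy) (wp clear ?Q) (R1(12 := 0)) A1 Z1 (Suc t1)"
    proof (rule wp_Loop[where I = ?I and i = n])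
      show "?I n (R1(12 := 0)) A1 Z1 (Suc t1)" by simp
    next
      fix p R2 A2 Z2 t2
      assume I: "?I p R2 A2 Z2 t2" and h: "holds (Lt 12 0) R2" and U: "unchanged ?copy (R1(12 := 0)) A1 Z1 R2 A2 Z2"
      note U = unchangedD[OF U, simplified]
      have R2: "R2 0 = n" "R2 2 = 0" using U(1) C1(1) by (auto simp: constants_def)
      from I h R2 obtain c where c: "c < n" "p = n - c" "R2 12 = c" "t2 \<le> t1 + 1 + 4 * c" "\<forall>i<c. A2 (5, i, 0) = qs ! i"
        by auto
      have A24: "A2 (4, c, 0) = qs ! c" using U(2) fs(5) c(1) by (simp add: qs_def)
      have "?I (n - Suc c) (R2(10 := qs ! c, 12 := Suc c)) (A2((5, c, 0) := qs ! c)) Z2 (Suc (Suc (Suc (Suc t2))))"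
        using c by (intro exI[of _ "Suc c"]) (auto simp: less_Suc_eq)
      moreover have "n - Suc c < p" using c(1,2) by simp
      ultimately have "\<exists>j<p. ?I j (R2(10 := qs ! c, 12 := Suc c)) (A2((5, c, 0) := qs ! c)) Z2 (Suc (Suc (Suc (Suc t2))))"
        by blast
      then show "wp ?copy (\<lambda>R A Z t. \<exists>j<p. ?I j R A Z t) R2 A2 Z2 (Suc t2)"
        using c(1) B by (simp add: R2 c(3) A24 mem_cells)
    next
      fix p R2 A2 Z2 t2
      assume I: "?I p R2 A2 Z2 t2" and h: "\<not> holds (Lt 12 0) R2" and U: "unchanged ?copy (R1(12 := 0)) A1 Z1 R2 A2 Z2"
      note U = unchangedD[OF U, simplified]
      have C2: "constants R2" "R2 18 = length qs" using U(1) C1 qs(1) by (auto simp: constants_def)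
      have "R2 0 = n" using C2(1) by (simp add: constants_def)
      with I h have I2: "\<forall>i<n. A2 (5, i, 0) = qs ! i" "t2 \<le> t1 + 1 + 4 * n" by auto
      have o2: "\<forall>i<length qs. A2 (4, i, 0) = qs ! i" using U(2) fs(5) qs(1) by (simp add: qs_def)
      have v2: "\<forall>v<n. v \<notin> set qs \<longrightarrow> A2 (2, v, 0) = 0" using qs(3) by simp
      have qsub: "set qs \<subseteq> {..<n}" using qs(3) by simp
      show "wp clear ?Q R2 A2 Z2 (Suc t2)"
      proof (rule wp_mono[OF wp_clear[OF C2 o2 qsub qs(2) v2]], goal_cases)
        case (1 R3 A3 Z3 t3)
        note U3 = unchangedD[OF 1(1), unfolded clear_def, simplified]
        have "\<forall>i<n. A3 (5, i, 0) = qs ! i" using U3(2) I2(1) by simp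
        moreover have "t3 \<le> t + 50 * n + 10 * arc_count L + 20" using 1(2) I2(2) fs(7) qs(1) by simp
        ultimately show ?case using order 1(2) by blast
      qed
    qed
    then show ?case using B by simp
  qed simp
  then show ?thesis
    unfolding order_roots_def using B n0 constantsD[OF assms(1)] by (simp add: mem_cells)
qed

end

section \<open>Time, space and word size\<close>

locale instance_bounds =
  fixes n k :: nat and E :: "nat set set" and adj :: "nat list list"
  assumes simple: "simple_graph {..<n} E" and conn: "connected_graph {..<n} E"
    and adj: "adjacency_lists n E adj" and k: "2 \<le> k" "k \<le> n"
begin

abbreviation "N \<equiv> length (input_words adj)"
abbreviation "arcs \<equiv> \<Sum>u<n. length (adj ! u)"
text \<open>Covers the start value of the stack bound: no frames, all arcs present, fewer than
  \<open>k\<close> vertices to add.\<close>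

abbreviation "D \<equiv> arcs + k"
abbreviation "inp \<equiv> (\<lambda>a. input_words adj ! a)"

lemma edge: "{u, v} \<in> E \<Longrightarrow> u < n \<and> v < n \<and> u \<noteq> v"
proof -
  assume "{u, v} \<in> E"
  then have "{u, v} \<subseteq> {..<n}" "card {u, v} = 2"
    using simple unfolding simple_graph_def by blast+
  then show ?thesis by (cases "u = v") auto
qed

lemma adjD: "length adj = n" "u < n \<Longrightarrow> distinct (adj ! u)" "u < n \<Longrightarrow> set (adj ! u) = {v. {u, v} \<in> E}"
  using adj by (auto simp: adjacency_lists_def)

lemma finite_E: "finite E"
  using simple by (auto simp: simple_graph_def intro!: finite_subset[of E "Pow {..<n}"])

text \<open>An arc is an orientation of an edge, and an edge has at most two.\<close>

lemma arcs_le: "arcs \<le> 2 * card E" "arcs \<le> n * n"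
proof -
  have c: "length (adj ! u) = card {v. {u, v} \<in> E}" if "u < n" for u
    using distinct_card[OF adjD(2)[OF that]] adjD(3)[OF that] by simp
  have sub: "{v. {u, v} \<in> E} \<subseteq> {..<n}" for u
    using edge by blast
  then have fin: "finite {v. {u, v} \<in> E}" for u
    by (rule finite_subset) simp
  have "arcs = (\<Sum>u<n. card {v. {u, v} \<in> E})"
    using c by simp
  also have "\<dots> = card (SIGMA u:{..<n}. {v. {u, v} \<in> E})"
    using fin by simp
  also have "\<dots> \<le> card (\<Union>e\<in>E. {(u, v). {u, v} = e})"
  proof (rule card_mono)
    have "(\<Union>e\<in>E. {(u, v). {u, v} = e}) \<subseteq> {..<n} \<times> {..<n}"
      using edge by blast
    then show "finite (\<Union>e\<in>E. {(u, v). {u, v} = e})"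
      by (rule finite_subset) simp
  qed auto
  also have "\<dots> \<le> (\<Sum>e\<in>E. card {(u, v). {u, v} = e})"
    by (rule card_UN_le[OF finite_E])
  also have "\<dots> \<le> (\<Sum>e\<in>E. 2)"
  proof (rule sum_mono)
    fix e assume "e \<in> E"
    then have "card e = 2" using simple unfolding simple_graph_def by blast
    then obtain a b where e: "e = {a, b}" unfolding card_2_iff by blast
    have "{(u, v). {u, v} = e} \<subseteq> set [(a, b), (b, a)]"
      unfolding e doubleton_eq_iff list.set by blast
    then have "card {(u, v). {u, v} = e} \<le> card (set [(a, b), (b, a)])"
      by (rule card_mono[OF finite_set])
    also have "\<dots> \<le> length [(a, b), (b, a)]" by (rule card_length)
    finally show "card {(u, v). {u, v} = e} \<le> 2" by simp
  qed
  finally show "arcs \<le> 2 * card E" by simp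
  have "arcs \<le> (\<Sum>u<n. n)"
    using c card_mono[OF finite_lessThan sub] by (intro sum_mono) simp
  then show "arcs \<le> n * n" by simp
qed

lemma length_concat_adj: "length (concat adj) = arcs"
  using adjD(1) by (simp add: length_concat sum_list_sum_nth atLeast0LessThan)

lemma N_eq: "N = Suc n + arcs"
  using adjD(1) length_concat_adj by (simp add: length_input_words list_start_def)

text \<open>A spanning tree has \<open>n - 1\<close> edges.\<close>

lemma n_le: "n \<le> Suc (card E)"
proof -
  have fin: "\<Union>E \<subseteq> {..<n}" using simple by (auto simp: simple_graph_def)
  have "\<exists>F W. out_tree 0 F W \<and> {} \<subseteq> F \<and> card W = n \<and> W \<subseteq> {..<n} \<and> undirected F \<subseteq> undirected {} \<union> E"
    by (rule out_tree_extend[OF out_tree.root conn _ fin]) (use k in simp_all)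
  then obtain F W where F: "out_tree 0 F W" "card W = n" "undirected F \<subseteq> E"
    unfolding undirected_empty Un_empty_left by blast
  have "card F \<le> card E"
    using card_mono[OF finite_E F(3)] card_undirected[OF F(1)] by simp
  then show ?thesis using out_tree_card[OF F(1)] F(2) by simp
qed

text \<open>\<open>n^6\<close> bounds the values of the program and \<open>n^14\<close> the machine
  words. Constants disappear in powers of \<open>n \<ge> 2\<close>, as \<open>16 \<le> n^4\<close>
  and \<open>128 \<le> n^7\<close>.\<close>

lemma powers: "k \<le> n" "n + D + 5 < n ^ 6" "N < n ^ 6" "((n ^ 6 + (n + 1)) * (n + 1) + n) * 10 + 20 \<le> n ^ 14"
proof -
  show "k \<le> n" by (rule k)
  have n2: "2 \<le> n" using k by simp
  have p4: "16 \<le> n ^ 4" using power_mono[OF n2, of 4] by simp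
  have n6: "16 * (n * n) \<le> n ^ 6"
    using mult_le_mono1[OF p4, of "n * n"] by (simp add: eval_nat_numeral)
  have nn: "2 * n \<le> n * n" "2 * 2 \<le> n * n"
    by (rule mult_le_mono1[OF n2], rule mult_le_mono[OF n2 n2])
  show "n + D + 5 < n ^ 6"
    using arcs_le(2) k(2) n6 nn by linarith
  then show "N < n ^ 6"
    using N_eq by linarith
  have "n + 1 \<le> n ^ 6" using n6 nn n2 by linarith
  then have "(n ^ 6 + (n + 1)) * (n + 1) \<le> (2 * n ^ 6) * (2 * n)"
    using n2 by (intro mult_le_mono) auto
  also have "\<dots> = 4 * n ^ 7"
    using power_Suc2[of n 6] by simp
  finally have a: "(n ^ 6 + (n + 1)) * (n + 1) \<le> 4 * n ^ 7" .
  have "n ^ 1 \<le> n ^ 7" "2 \<le> n ^ 7"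
    using n2 power_increasing[of 1 7 n] by auto
  then have "((n ^ 6 + (n + 1)) * (n + 1) + n) * 10 + 20 \<le> 128 * n ^ 7"
    using a by auto
  also have "\<dots> \<le> n ^ 7 * n ^ 7"
  proof (rule mult_le_mono1)
    show "128 \<le> n ^ 7" using power_mono[OF n2, of 7] by simp
  qed
  also have "\<dots> = n ^ 14" by (simp flip: power_add)
  finally show "((n ^ 6 + (n + 1)) * (n + 1) + n) * 10 + 20 \<le> n ^ 14" .
qed

sublocale k_enumeration inp N n D E "n ^ 6" k
  by unfold_locales (use edge powers k in auto)

lemma wp_list_subtrees:
  assumes "R 0 = n" "R 1 = k" "R 2 = 0"
  shows "wp list_subtrees (\<lambda>R' A' Z' t'. \<exists>Ts. Z' = concat (map words_of Ts) \<and> subtree_listing Ts (k_subtrees E k) \<and>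
    t' \<le> 200 * k\<^sup>2 * card (k_subtrees E k) + 23 * arcs + 84 * n + 34) R (\<lambda>_. 0) [] 0"
proof -
  let ?L = "\<lambda>u. adj ! u"
  let ?Q = "\<lambda>R' A' Z' t'. \<exists>Ts. Z' = concat (map words_of Ts) \<and> subtree_listing Ts (k_subtrees E k) \<and>
    t' \<le> 200 * k\<^sup>2 * card (k_subtrees E k) + 23 * arcs + 84 * n + 34"
  let ?R = "R(3 := 1, 4 := 2)"
  have C: "constants ?R" using assms by (simp add: constants_def)
  have fin: "finite (k_subtrees E k)"
    using edges_le_k_subtrees(2)[OF simple conn k(1)] k(2) by simp
  have "wp build_lists (wp (order_roots ;; all_roots) ?Q) ?R (\<lambda>_. 0) [] (Suc (Suc 0))"
  proof (rule wp_mono[OF wp_build_lists[OF C refl refl powers(3) adj]], goal_cases)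
    case (1 R1 A1 Z1 t1)
    note U1 = unchangedD[OF 1(1), unfolded build_lists_def, simplified]
    have C1: "constants R1" and R1: "R1 1 = k" using C assms(2) U1(1) by (auto simp: constants_def)
    have vis: "\<forall>v<n. A1 (2, v, 0) = 0" using U1(2) by simp
    have rep1: "represents A1 ?L" and t1: "t1 \<le> 4 + 6 * arcs + 14 * n" using 1(2) by auto
    show ?case
      unfolding wp_simps(10)
    proof (rule wp_mono[OF wp_order_roots[OF C1 rep1 adjD(3) vis conn]], goal_cases)
      case (2 R2 A2 Z2 t2)
      note U2 = unchangedD[OF 2(1), unfolded order_roots_def search_def mark_def advance_def finish_def clear_def, simplified]
      have C2: "constants R2" and R2: "R2 1 = k" using C1 R1 U2(1) by (auto simp: constants_def)
      from 2(2) obtain qs where qs: "connected_order qs" "\<forall>i<n. A2 (5, i, 0) = qs ! i" "\<forall>v<n. A2 (2, v, 0) = 0"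
        "t2 \<le> t1 + 50 * n + 10 * arcs + 20" by blast
      have rep2: "represents A2 ?L" using rep1 represents_cong[of A2 A1] U2(2) by simp
      have Z2: "Z2 = []" using U1(3) U2(3) by simp
      show ?case
      proof (rule wp_mono[OF wp_all_roots[OF C2 R2 rep2 adjD(3) qs(3,2,1) order.refl fin]], goal_cases)
        case (2 R3 A3 Z3 t3)
        then show ?case using Z2 t1 qs(4) by fastforce
      qed simp
    qed simp
  qed
  moreover have "2 < n ^ 6" using powers(2) by simp
  ultimately show ?thesis
    unfolding list_subtrees_def by simp
qed

text \<open>Every array is linear in the number of edges, by \<open>arcs_le\<close>,
  \<open>n_le\<close> and \<open>k \<le> n\<close>.\<close>

lemma cells_subset:
  "finite (cells n D E)" "card (cells n D E) \<le> 40 * card E + 40"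
proof -
  let ?A = "({0::nat, 1} \<times> (SIGMA u:{..<n}. insert n (set (adj ! u)))) \<union>
    ({2::nat..5} \<times> {..<n} \<times> {0::nat}) \<union> ({6::nat..8} \<times> {..D} \<times> {0::nat})"
  have sub: "cells n D E \<subseteq> ?A"
    using adjD(3) by (auto simp: cells_def)
  have fin: "finite ?A" by auto
  then show "finite (cells n D E)" using sub finite_subset by blast
  have "card (SIGMA u:{..<n}. insert n (set (adj ! u))) = (\<Sum>u<n. card (insert n (set (adj ! u))))" by simp
  also have "\<dots> \<le> (\<Sum>u<n. 1 + length (adj ! u))"
  proof (rule sum_mono)
    fix u
    show "card (insert n (set (adj ! u))) \<le> 1 + length (adj ! u)"
      using card_length[of "adj ! u"] by (simp add: card_insert_if)
  qed
  also have "\<dots> = n + arcs" unfolding sum.distrib by simp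
  finally have s: "card (SIGMA u:{..<n}. insert n (set (adj ! u))) \<le> n + arcs" .
  have "card (cells n D E) \<le> card ?A" by (rule card_mono[OF fin sub])
  also have "\<dots> \<le> card ({0::nat, 1} \<times> (SIGMA u:{..<n}. insert n (set (adj ! u)))) + card ({2::nat..5} \<times> {..<n} \<times> {0::nat}) +
    card ({6::nat..8} \<times> {..D} \<times> {0::nat})"
    by (intro order.trans[OF card_Un_le] add_mono card_Un_le order.refl)
  also have "\<dots> \<le> 2 * (n + arcs) + 4 * n + 3 * (D + 1)"
    using s by (simp only: card_cartesian_product) simp
  also have "\<dots> \<le> 40 * card E + 40"
    using arcs_le(1) n_le k(2) by simp
  finally show "card (cells n D E) \<le> 40 * card E + 40" .
qed

end

section \<open>The compiled program and its resources\<close>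

definition subtree_program :: program where
  "subtree_program = compile 0 list_subtrees"

lemma compilable_list_subtrees: "compilable list_subtrees"
  by (simp add: list_subtrees_def build_lists_def order_roots_def all_roots_def enumerate_root_def node_def
    search_def mark_def advance_def finish_def scan_def test_arc_def next_arc_def found_def clear_def
    print_tree_def backtrack_def remove_def restore_def delete_root_def)

context instance_bounds
begin

sublocale compiler inp N "cells n D E" "n ^ 6" n "n ^ 14"
proof
  show "j < 10 \<and> v \<le> n" if "(j, u, v) \<in> cells n D E" for j u v
    using that edge by (fastforce simp: cells_def)
  show "inp a < n ^ 6" if "a < N" for a
  \<comment> \<open>Cells up to \<open>n\<close> hold pointers, which are at most \<open>N\<close>;
    the later ones hold vertices.\<close>
  proof (cases "a \<le> n")
    case True
    then have "inp a = list_start adj a" using input_words_pointer[of a adj] adjD(1) by simp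
    also have "\<dots> \<le> N"
      using list_start_mono[of a n adj] True adjD(1) by (simp add: length_input_words)
    finally show ?thesis using powers(3) by simp
  next
    case False
    have "inp a \<in> set (concat adj)"
    proof -
      have "inp a = concat adj ! (a - Suc n)" "a - Suc n < length (concat adj)"
        using False that adjD(1) by (auto simp: input_words_def nth_append simp del: upt_Suc)
      then show ?thesis using nth_mem by metis
    qed
    then obtain xs where xs: "xs \<in> set adj" "inp a \<in> set xs" by auto
    from xs(1) obtain u where "u < n" "xs = adj ! u"
      using adjD(1) by (auto simp: in_set_conv_nth)
    with xs(2) have "inp a < n" using adjD(3) edge by blast
    then show ?thesis using powers(2) by linarith
  qed
  have "arcs \<le> n * n" by (rule arcs_le)
  then show "N \<le> 10 * (n + 1)\<^sup>2"
    unfolding N_eq by (simp add: power2_eq_square)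
  show "((n ^ 6 + (n + 1)) * (n + 1) + n) * 10 + 20 \<le> n ^ 14" by (rule powers)
  show "1 \<le> n ^ 6" using powers(2) by simp
qed

lemma initial_simulates:
  "simulates (initial_config adj k) ((\<lambda>_. 0)(0 := n, 1 := k), \<lambda>_. 0, [], 0)"
proof -
  have B1: "n < n ^ 6" "k < n ^ 6" using powers(1,2) by linarith+
  have B2: "n ^ 6 \<le> n ^ 14" "0 < n ^ 14" using bounds by linarith+
  \<comment> \<open>Memory is zero beyond the input, which represents arrays that are zero
    everywhere.\<close>
  have m: "mem (initial_config adj k) (addr n x) = 0" for x
    using addr_ge[of n x] N by (simp add: initial_config_def)
  have w: "mem (initial_config adj k) a < n ^ 14" for a
    using less_le_trans[OF inp[of a] B2(1)] B2(2) by (cases "a < N") (simp_all add: initial_config_def)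
  show ?thesis
    unfolding simulates_def prod.case
    using B1 B2 m w adjD(1) by (auto simp: words_below_def initial_config_def)
qed

lemma subtree_program_correct:
  defines "c \<equiv> initial_config adj k"
  shows "ram_halts subtree_program c"
    "lists_exactly_once (k - 1) (ram_output subtree_program c) (k_subtrees E k)"
    "ram_time subtree_program c \<le> 5000 * (card (k_subtrees E k) * k\<^sup>2)"
    "ram_space subtree_program c N \<le> (card (\<Union>i\<in>set subtree_program. instr_regs i) + 100) * (card E * k)"
    "ram_words subtree_program c (n ^ 14)"
proof -
  let ?R = "(\<lambda>_. 0)(0 := n, 1 := k)" and ?s = "card (k_subtrees E k)"
  have "wp list_subtrees (\<lambda>R' A' Z' t'. \<exists>Ts. Z' = concat (map words_of Ts) \<and> subtree_listing Ts (k_subtrees E k) \<and>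
    t' \<le> 200 * k\<^sup>2 * ?s + 23 * arcs + 84 * n + 34) ?R (\<lambda>_. 0) [] 0"
    by (rule wp_list_subtrees) simp_all
  then obtain R' A' Z' t' Ts where big: "big list_subtrees (?R, \<lambda>_. 0, [], 0) (R', A', Z', t')"
    and Ts: "Z' = concat (map words_of Ts)" "subtree_listing Ts (k_subtrees E k)"
    and t': "t' \<le> 200 * k\<^sup>2 * ?s + 23 * arcs + 84 * n + 34"
    unfolding wp_def by blast
  have code: "code_at subtree_program 0 (compile 0 list_subtrees)"
    by (simp add: code_at_def subtree_program_def)
  have pc0: "pc c = 0" by (simp add: c_def initial_config_def)
  obtain t cf where run: "run subtree_program space (n ^ 14) c t cf" "simulates cf (R', A', Z', t')"
    "pc cf = code_length list_subtrees" "t \<le> 10 * t'"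
    using compile_correct[OF big compilable_list_subtrees code pc0 initial_simulates[folded c_def]]
    by (auto simp: ticks_def)
  have pc: "pc cf = length subtree_program" using run(3) by (simp add: subtree_program_def)
  have "finite space" using cells_subset(1) by simp
  note rc = run_complete[OF run(1) pc simulates_words[OF run(2)] this]
  show "ram_halts subtree_program c" "ram_words subtree_program c (n ^ 14)" by (rule rc)+
  have "ram_output subtree_program c = Z'"
    using rc(3) run(2) by (simp add: simulates_def)
  then show "lists_exactly_once (k - 1) (ram_output subtree_program c) (k_subtrees E k)"
    using Ts unfolding lists_exactly_once_def subtree_listing_def by blast
  have m1: "1 \<le> card E" using n_le k by simp
  have mk: "card E \<le> ?s * (k - 1)"
    using edges_le_k_subtrees(1)[OF simple conn k(1)] k(2) by simp
  also have "\<dots> \<le> ?s * k\<^sup>2"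
    using k(1) by (intro mult_le_mono2) (auto simp: power2_eq_square intro: order.trans[of _ k])
  finally have "card E \<le> ?s * k\<^sup>2" .
  \<comment> \<open>Since there is an edge, all terms in \<open>arcs\<close> and \<open>n\<close>
    are at most a multiple of the number of edges, which is at most \<open>s * k^2\<close>. The
    factor ten of the compiler turns 500 into 5000.\<close>
  then have "t' \<le> 500 * (?s * k\<^sup>2)"
    using t' arcs_le(1) n_le m1 by (simp add: mult.assoc mult.commute)
  then show "ram_time subtree_program c \<le> 5000 * (?s * k\<^sup>2)"
    using rc(2) run(4) by simp
  let ?r = "card (\<Union>i\<in>set subtree_program. instr_regs i)"
  have "card ({..<N} \<union> space) = card ({..<N} \<union> addr n ` cells n D E)"
    by (rule arg_cong[of _ _ card]) blast
  also have "\<dots> \<le> N + card (addr n ` cells n D E)"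
    using card_Un_le[of "{..<N}" "addr n ` cells n D E"] by simp
  also have "\<dots> \<le> N + card (cells n D E)"
    using card_image_le[OF cells_subset(1)] by simp
  also have "\<dots> \<le> 90 * card E"
    using cells_subset(2) N_eq arcs_le(1) n_le m1 by simp
  finally have "ram_space subtree_program c N \<le> ?r + 90 * card E"
    using rc(4)[of N] by linarith
  also have "\<dots> \<le> (?r + 100) * card E"
  proof -
    \<comment> \<open>The fixed number of registers is absorbed because there is at least one
      edge.\<close>
    have "?r \<le> ?r * card E" using m1 by (cases "card E") simp_all
    then show ?thesis unfolding add_mult_distrib by linarith
  qed
  also have "\<dots> \<le> (?r + 100) * (card E * k)"
    using k(1) by (intro mult_le_mono2) simp
  finally show "ram_space subtree_program c N \<le> (?r + 100) * (card E * k)" .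
qed

end

theorem theorem3p2:
  "\<exists>(P :: program) (C :: nat) (d :: nat).
     \<forall>(n :: nat) (E :: nat set set) (adj :: nat list list) (k :: nat).
       simple_graph {..<n} E \<longrightarrow> connected_graph {..<n} E \<longrightarrow> adjacency_lists n E adj \<longrightarrow>
       2 \<le> k \<longrightarrow> k \<le> n \<longrightarrow>
       (let m = card E;
            s = card (k_subtrees E k);
            c = initial_config adj k
        in ram_halts P c \<and>
           lists_exactly_once (k - 1) (ram_output P c) (k_subtrees E k) \<and>
           ram_time P c \<le> C * (s * k ^ 2) \<and>
           ram_space P c (length (input_words adj)) \<le> C * (m * k) \<and>
           ram_words P c (n ^ d))"
proof (intro exI allI impI)
  let ?r = "card (\<Union>i\<in>set subtree_program. instr_regs i)"
  fix n k :: nat and E :: "nat set set" and adj :: "nat list list"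
  assume "simple_graph {..<n} E" "connected_graph {..<n} E" "adjacency_lists n E adj" "2 \<le> k" "k \<le> n"
  then interpret instance_bounds n k E adj
    by unfold_locales
  show "let m = card E; s = card (k_subtrees E k); c = initial_config adj k
    in ram_halts subtree_program c \<and>
       lists_exactly_once (k - 1) (ram_output subtree_program c) (k_subtrees E k) \<and>
       ram_time subtree_program c \<le> (?r + 5000) * (s * k ^ 2) \<and>
       ram_space subtree_program c (length (input_words adj)) \<le> (?r + 5000) * (m * k) \<and>
       ram_words subtree_program c (n ^ 14)"
    unfolding Let_def
  proof (intro conjI)
    show "ram_time subtree_program (initial_config adj k) \<le> (?r + 5000) * (card (k_subtrees E k) * k ^ 2)"
      by (rule order.trans[OF subtree_program_correct(3)]) (intro mult_le_mono1, simp)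
    show "ram_space subtree_program (initial_config adj k) (length (input_words adj)) \<le> (?r + 5000) * (card E * k)"
      by (rule order.trans[OF subtree_program_correct(4)]) (intro mult_le_mono1, simp)
  qed (rule subtree_program_correct)+
qed

end
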